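(* Let $m\ge1$, let $\Phi\in\mathcal{Y}_m$ and let $\epsilon>0$. Then there exist $n\ge 1$ and an isometry $V=(V_1,\ldots,V_n)^t\colon\mathbb{C}^m\to\mathbb{C}^{mn}$ for which $Q_V(z)=\sum_{i=1}^n z^{n-i}V_i\in M_m(\mathbb{C}[z])$ is a regular polynomial, such that the ucp map $\mathcal{T}_{n,m}\to M_m(\mathbb{C})$, $T\mapsto V^*TV$, is pure, and the induced ucp map $$\Phi_{Q_V}\colon C(\mathbb{T},M_m(\mathbb{C}))\to M_m(\mathbb{C}),\qquad \Phi_{Q_V}(f)=\int_{\mathbb{T}}Q_V(z)^*f(z)Q_V(z)\,dz$$ satisfies $\rho(\Phi,\Phi_{Q_V})<\epsilon$.
   Context: $\mathbb{T}$ is the unit circle, $dz$ denotes normalized arc length measure on $\mathbb{T}$, and $C(\mathbb{T},M_m(\mathbb{C}))$ is the $C^*$-algebra of continuous $M_m(\mathbb{C})$-valued functions on $\mathbb{T}$. $\mathcal{Y}_m$ is the convex set of all unital completely positive (ucp) linear maps $C(\mathbb{T},M_m(\mathbb{C}))\to M_m(\mathbb{C})$. Metric: for $\phi,\psi\in\mathcal{Y}_m$, $\rho(\phi,\psi)=\sup\{\|\phi(f)-\psi(f)\|_{M_m(\mathbb{C})}: f\in\mathcal{L}\}$, where $\mathcal{L}=\{f\in C^1(\mathbb{T},M_m(\mathbb{C})):\|f\|_\infty\le1,\ \|f'\|_\infty\le1\}$, $\|f\|_\infty=\sup_{z\in\mathbb{T}}\|f(z)\|$ (operator norm), and $f'$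 is the derivative with respect to the angular variable $\theta$, $z=e^{i\theta}$. Regular polynomial: for an isometry $V=(V_1,\ldots,V_n)^t$ (block column with $V_i\in M_m(\mathbb{C})$, $\sum_iV_i^*V_i=I_m$), the polynomial $Q_V(z)=\sum_{i=1}^nz^{n-i}V_i$ is called regular if all its roots lie on $\mathbb{T}$, where a root is a point $a\in\mathbb{C}$ at which $Q_V(a)$ is the zero matrix. $\mathcal{T}_{n,m}\subset M_{mn}(\mathbb{C})$ is the operator system of block Toeplitz matrices $T=(T_{i-j})_{i,j=1}^n$, $T_k\in M_m(\mathbb{C})$. A ucp map $\phi$ from an operator system $\mathcal{S}$ to $M_m(\mathbb{C})$ is pure if whenever $\psi\colon\mathcal{S}\to M_m(\mathbb{C})$ and $\phi-\psi$ are completely positive, $\psi=t\phi$ for some $t\in[0,1]$. *)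

theory Defs
  imports "HOL-Analysis.Analysis"
begin

section \<open>Complex matrices\<close>

type_synonym 'm cmat = "complex^'m^'m"

definition cscale :: "complex \<Rightarrow> 'm cmat \<Rightarrow> 'm::finite cmat"  (infixr \<open>*\<^sub>C\<close> 75)
  where "c *\<^sub>C A = (\<chi> i j. c * A $ i $ j)"

definition ctranspose :: "'m cmat \<Rightarrow> 'm::finite cmat"
  where "ctranspose A = (\<chi> i j. cnj (A $ j $ i))"

text \<open>The library inner product on \<^typ>\<open>complex^'m\<close> is only the real part of this one.\<close>

definition cinner :: "complex^'m \<Rightarrow> complex^'m \<Rightarrow> complex"
  where "cinner x y = (\<Sum>i\<in>UNIV. cnj (x $ i) * y $ i)"

text \<open>\<^const>\<open>norm\<close> on \<^typ>\<open>complex^'m^'m\<close> is the Frobenius norm; the operator norm is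
  taken with respect to the Euclidean norm of \<^typ>\<open>complex^'m\<close>.\<close>

definition opnorm :: "'m::finite cmat \<Rightarrow> real"
  where "opnorm A = onorm ((*v) A)"

text \<open>Positivity of the block matrix with entries \<open>A i j\<close>, where \<open>i, j\<close> range over \<open>I\<close>.\<close>

definition block_psd :: "'i set \<Rightarrow> ('i \<Rightarrow> 'i \<Rightarrow> 'm::finite cmat) \<Rightarrow> bool"
  where "block_psd I A \<longleftrightarrow>
    (\<forall>x :: 'i \<Rightarrow> complex^'m. (\<Sum>i\<in>I. \<Sum>j\<in>I. cinner (x i) (A i j *v x j)) \<in> \<real>\<^sub>\<ge>\<^sub>0)"


section \<open>Operator systems and completely positive maps\<close>

text \<open>
  Both operator systems below consist of matrix-valued functions on a set \<open>X\<close>: the circle, or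
  the set of index pairs of a block matrix. These functions are stored on the whole type, with value
  \<open>0\<close> off \<open>X\<close>, so that each element of the system has exactly one representative. The predicate
  \<open>os_pos S k F\<close> says that the \<open>k\<close>-by-\<open>k\<close> matrix \<open>F\<close> over the system, with indices \<open>{..<k}\<close>,
  is positive.
\<close>

record ('x, 'm) opsys =
  os_carrier :: "('x \<Rightarrow> 'm cmat) set"
  os_unit :: "'x \<Rightarrow> 'm cmat"
  os_pos :: "nat \<Rightarrow> (nat \<Rightarrow> nat \<Rightarrow> 'x \<Rightarrow> 'm cmat) \<Rightarrow> bool"

definition clinear_map :: "('x, 'm::finite) opsys \<Rightarrow> (('x \<Rightarrow> 'm cmat) \<Rightarrow> 'm cmat) \<Rightarrow> bool"
  where "clinear_map S \<phi> \<longleftrightarrow>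
    (\<forall>a b. \<forall>f\<in>os_carrier S. \<forall>g\<in>os_carrier S.
       \<phi> (\<lambda>x. a *\<^sub>C f x + b *\<^sub>C g x) = a *\<^sub>C \<phi> f + b *\<^sub>C \<phi> g)"

definition cp_map :: "('x, 'm::finite) opsys \<Rightarrow> (('x \<Rightarrow> 'm cmat) \<Rightarrow> 'm cmat) \<Rightarrow> bool"
  where "cp_map S \<phi> \<longleftrightarrow> clinear_map S \<phi> \<and>
    (\<forall>k F. (\<forall>i<k. \<forall>j<k. F i j \<in> os_carrier S) \<and> os_pos S k F
       \<longrightarrow> block_psd {..<k} (\<lambda>i j. \<phi> (F i j)))"

definition ucp_map :: "('x, 'm::finite) opsys \<Rightarrow> (('x \<Rightarrow> 'm cmat) \<Rightarrow> 'm cmat) \<Rightarrow> bool"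
  where "ucp_map S \<phi> \<longleftrightarrow> cp_map S \<phi> \<and> \<phi> (os_unit S) = mat 1"

definition pure_ucp :: "('x, 'm::finite) opsys \<Rightarrow> (('x \<Rightarrow> 'm cmat) \<Rightarrow> 'm cmat) \<Rightarrow> bool"
  where "pure_ucp S \<phi> \<longleftrightarrow> ucp_map S \<phi> \<and>
    (\<forall>\<psi>. cp_map S \<psi> \<and> cp_map S (\<lambda>f. \<phi> f - \<psi> f)
       \<longrightarrow> (\<exists>t\<in>{0..1::real}. \<forall>f\<in>os_carrier S. \<psi> f = t *\<^sub>R \<phi> f))"


section \<open>Continuous matrix-valued functions on the circle\<close>

abbreviation circle :: "complex set"
  where "circle \<equiv> sphere 0 1"

definition CT :: "(complex, 'm::finite) opsys"
  where "CT =
    \<lparr> os_carrier = {f. continuous_on circle f \<and> (\<forall>z. z \<notin> circle \<longrightarrow> f z = 0)},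
      os_unit = (\<lambda>z. if z \<in> circle then mat 1 else 0),
      os_pos = (\<lambda>k F. \<forall>z\<in>circle. block_psd {..<k} (\<lambda>i j. F i j z)) \<rparr>"

definition ucp_maps_CT :: "((complex \<Rightarrow> 'm cmat) \<Rightarrow> 'm::finite cmat) set"
  where "ucp_maps_CT = {\<phi>. ucp_map CT \<phi>}"

definition supnorm :: "(complex \<Rightarrow> 'm::finite cmat) \<Rightarrow> real"
  where "supnorm f = (SUP z\<in>circle. opnorm (f z))"

text \<open>The function \<open>f'\<close> below is the derivative of \<open>f\<close> with respect to the angle.\<close>

definition lip_class :: "(complex \<Rightarrow> 'm::finite cmat) set"
  where "lip_class =
    {f \<in> os_carrier CT. \<exists>f' \<in> os_carrier CT.
       (\<forall>\<theta>. ((\<lambda>t. f (cis t)) has_vector_derivative f' (cis \<theta>)) (at \<theta>)) \<and>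
       supnorm f \<le> 1 \<and> supnorm f' \<le> 1}"

definition rho :: "((complex \<Rightarrow> 'm::finite cmat) \<Rightarrow> 'm cmat) \<Rightarrow> ((complex \<Rightarrow> 'm cmat) \<Rightarrow> 'm cmat) \<Rightarrow> real"
  where "rho \<phi> \<psi> = (SUP f\<in>lip_class. opnorm (\<phi> f - \<psi> f))"


section \<open>Block Toeplitz matrices\<close>

text \<open>Block rows and columns are indexed by \<open>{1..n}\<close>; entry \<open>(i, j)\<close> of a matrix \<open>T\<close> is \<open>T (i, j)\<close>.\<close>

definition toeplitz :: "nat \<Rightarrow> (nat \<times> nat, 'm::finite) opsys"
  where "toeplitz n =
    \<lparr> os_carrier = {T. \<exists>\<tau> :: int \<Rightarrow> 'm cmat. \<forall>i j. T (i, j) =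
         (if i \<in> {1..n} \<and> j \<in> {1..n} then \<tau> (int i - int j) else 0)},
      os_unit = (\<lambda>(i, j). if i \<in> {1..n} \<and> i = j then mat 1 else 0),
      os_pos = (\<lambda>k F. block_psd ({..<k} \<times> {1..n}) (\<lambda>(i, p) (j, q). F i j (p, q))) \<rparr>"


section \<open>Isometries and their polynomials\<close>

text \<open>A block column \<open>(V 1, \<dots>, V n)\<^sup>t\<close> is a sequence \<open>V\<close>, of which only the entries
  with index in \<open>{1..n}\<close> are used.\<close>

definition isometry :: "nat \<Rightarrow> (nat \<Rightarrow> 'm::finite cmat) \<Rightarrow> bool"
  where "isometry n V \<longleftrightarrow> (\<Sum>i\<in>{1..n}. ctranspose (V i) ** V i) = mat 1"

definition Qpoly :: "nat \<Rightarrow> (nat \<Rightarrow> 'm::finite cmat) \<Rightarrow> complex \<Rightarrow> 'm cmat"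
  where "Qpoly n V z = (\<Sum>i\<in>{1..n}. z ^ (n - i) *\<^sub>C V i)"

definition regular :: "nat \<Rightarrow> (nat \<Rightarrow> 'm::finite cmat) \<Rightarrow> bool"
  where "regular n V \<longleftrightarrow> (\<forall>a. Qpoly n V a = 0 \<longrightarrow> a \<in> circle)"

definition compress :: "nat \<Rightarrow> (nat \<Rightarrow> 'm::finite cmat) \<Rightarrow> (nat \<times> nat \<Rightarrow> 'm cmat) \<Rightarrow> 'm cmat"
  where "compress n V T =
    (\<Sum>i\<in>{1..n}. \<Sum>j\<in>{1..n}. ctranspose (V i) ** T (i, j) ** V j)"

definition Phi_Q :: "nat \<Rightarrow> (nat \<Rightarrow> 'm::finite cmat) \<Rightarrow> (complex \<Rightarrow> 'm cmat) \<Rightarrow> 'm cmat"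
  where "Phi_Q n V f = (1 / (2 * pi)) *\<^sub>R integral {0..2 * pi}
    (\<lambda>\<theta>. ctranspose (Qpoly n V (cis \<theta>)) ** f (cis \<theta>) ** Qpoly n V (cis \<theta>))"

end

theory Submission
  imports Defs "HOL-Complex_Analysis.Complex_Analysis" "HOL-Computational_Algebra.Fundamental_Theorem_Algebra"
begin

text \<open>
  \<^bold>\<open>Purity.\<close> For \<open>z\<close> on the circle let \<open>T\<^sub>z\<close> be the block Toeplitz matrix with entries
  \<open>z ^ (i - j) A\<close>. The map \<open>T \<mapsto> V\<^sup>* T V\<close> sends it to \<open>Q(z)\<^sup>* A Q(z)\<close>, and as a map of \<open>A\<close>
  this has a Choi matrix of rank one. If \<open>\<psi>\<close> is completely positive and below \<open>T \<mapsto> V\<^sup>* T V\<close>, then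
  \<open>\<psi>(T\<^sub>z)\<close> therefore is \<open>g(z) Q(z)\<^sup>* A Q(z)\<close> with a number \<open>g(z)\<close> between \<open>0\<close> and \<open>1\<close>, and purity
  means that \<open>g\<close> is constant. Let \<open>s\<close> be the scalar polynomial obtained by applying some linear
  functional to \<open>Q(z)\<close>. Then \<open>g \<bar>s\<bar>\<^sup>2\<close> is a trigonometric polynomial of degree at most \<open>n - 1\<close>
  between \<open>0\<close> and \<open>\<bar>s\<bar>\<^sup>2\<close>. If \<open>s\<close> has degree \<open>n - 1\<close> and all its roots lie on the circle, then
  \<open>g \<bar>s\<bar>\<^sup>2\<close> vanishes at these roots to the order of \<open>\<bar>s\<bar>\<^sup>2\<close>, which is as often as its degree
  permits, and \<open>g\<close> is constant. The existence of one such \<open>s\<close> also makes \<open>Q\<close> regular. This is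
  \<open>purity_criterion\<close>; it reduces the theorem to an approximation problem in which one functional
  of \<open>Q\<close> has to be controlled.

  \<^bold>\<open>Approximation.\<close> A partition of unity and Kraus forms show that \<open>\<Phi>\<close> is close to
  \<open>f \<mapsto> \<Sum>\<^sub>j K\<^sub>j\<^sup>* f(w\<^sub>j) K\<^sub>j\<close> with finitely many distinct points \<open>w\<^sub>j\<close>
  (\<open>point_evaluation_approximation\<close>), and phases can be chosen such that one fixed entry \<open>k\<^sub>j\<close> of
  \<open>K\<^sub>j\<close> is nonnegative for all \<open>j\<close> (\<open>nonneg_entry_kraus\<close>). Put \<open>Q = \<Sum>\<^sub>j g\<^sub>j K\<^sub>j\<close> with scalar
  polynomials \<open>g\<^sub>j\<close> of mean square \<open>1\<close> that are small away from \<open>w\<^sub>j\<close>. Integration against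
  \<open>\<bar>g\<^sub>j\<bar>\<^sup>2\<close> is then almost evaluation at \<open>w\<^sub>j\<close>, and the mixed terms almost vanish
  (\<open>concentration\<close>).

  The distinguished entry of \<open>Q\<close> is \<open>\<Sum>\<^sub>j k\<^sub>j g\<^sub>j\<close>. So what is needed is a family of peaked
  polynomials all of whose nonnegative combinations have full degree and all roots on the circle.
  Having positive real part is a condition that survives nonnegative combinations, and if a
  polynomial \<open>a\<close> has positive real part on the circle, the polynomial that equals
  \<open>a + z\<^sup>M cnj a\<close> there has all its roots on the circle, for large \<open>M\<close>. The analytic halves of
  Fejer kernels are peaked and have positive real part, and they yield the family
  (\<open>peaked_polynomials\<close>).

  Finally \<open>Q\<close> is multiplied from the right by a matrix \<open>R\<close> close to the identity, so that its
  coefficients form an isometry (\<open>normalizing_factor\<close>). The distinguished entry of \<open>Q\<close> is still a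
  linear functional of \<open>Q R\<close>, so that the purity criterion applies.
\<close>

(* From here on the dollar sign denotes vector components only. *)
no_notation fps_nth (infixl \<open>$\<close> 75)


section \<open>Matrix algebra\<close>

lemma cscale_nth [simp]: "(c *\<^sub>C A) $ i $ j = c * A $ i $ j"
  by (simp add: cscale_def)

lemma ctranspose_nth [simp]: "ctranspose A $ i $ j = cnj (A $ j $ i)"
  by (simp add: ctranspose_def)

lemma mat_mult_nth: "(A ** B) $ i $ j = (\<Sum>k\<in>UNIV. A $ i $ k * B $ k $ j)"
  by (simp add: matrix_matrix_mult_def)

lemma cscale_simps:
  "0 *\<^sub>C A = 0" "c *\<^sub>C 0 = 0" "1 *\<^sub>C A = A"
  "c *\<^sub>C (d *\<^sub>C A) = (c * d) *\<^sub>C A"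
  "c *\<^sub>C (A + B) = c *\<^sub>C A + c *\<^sub>C B"
  "(c + d) *\<^sub>C A = c *\<^sub>C A + d *\<^sub>C A"
  "c *\<^sub>C (A - B) = c *\<^sub>C A - c *\<^sub>C B"
  "(c - d) *\<^sub>C A = c *\<^sub>C A - d *\<^sub>C A"
  by (simp_all add: vec_eq_iff algebra_simps)

lemma cscale_sum_right: "c *\<^sub>C (\<Sum>i\<in>I. f i) = (\<Sum>i\<in>I. c *\<^sub>C f i)"
  by (simp add: vec_eq_iff sum_distrib_left)

lemma cscale_sum_left: "(\<Sum>i\<in>I. c i) *\<^sub>C A = (\<Sum>i\<in>I. c i *\<^sub>C A)"
  by (simp add: vec_eq_iff sum_distrib_right)

lemma scaleR_eq_cscale: "r *\<^sub>R (A :: 'm::finite cmat) = complex_of_real r *\<^sub>C A"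
  by (simp add: vec_eq_iff) (simp add: scaleR_conv_of_real)

lemma mult_cscale:
  "(c *\<^sub>C A) ** B = c *\<^sub>C (A ** B)" "A ** (c *\<^sub>C B) = c *\<^sub>C (A ** B)"
  by (simp_all add: vec_eq_iff mat_mult_nth sum_distrib_left algebra_simps)

lemma mult_distribs:
  fixes A B C :: "'m::finite cmat"
  shows "(A + B) ** C = A ** C + B ** C" "A ** (B + C) = A ** B + A ** C"
    "(A - B) ** C = A ** C - B ** C" "A ** (B - C) = A ** B - A ** C"
  by (simp_all add: vec_eq_iff mat_mult_nth sum.distrib sum_subtractf algebra_simps)

lemma mult_sums:
  fixes A :: "'m::finite cmat"
  shows "(\<Sum>i\<in>I. f i) ** A = (\<Sum>i\<in>I. f i ** A)" "A ** (\<Sum>i\<in>I. f i) = (\<Sum>i\<in>I. A ** f i)"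
  by (induction I rule: infinite_finite_induct) (simp_all add: mult_distribs)

lemma mult_zeros [simp]: "(0 :: 'm::finite cmat) ** A = 0" "A ** (0 :: 'm::finite cmat) = 0"
  by (simp_all add: vec_eq_iff mat_mult_nth)

lemma ctranspose_simps:
  "ctranspose (A ** B) = ctranspose B ** ctranspose A"
  "ctranspose (c *\<^sub>C A) = cnj c *\<^sub>C ctranspose A"
  "ctranspose (A + B) = ctranspose A + ctranspose B"
  "ctranspose (A - B) = ctranspose A - ctranspose B"
  "ctranspose (ctranspose A) = A"
  "ctranspose 0 = 0"
  "ctranspose (mat 1) = mat 1"
  by (simp_all add: vec_eq_iff mat_mult_nth mult.commute mat_def)

lemma ctranspose_sum: "ctranspose (\<Sum>i\<in>I. f i) = (\<Sum>i\<in>I. ctranspose (f i))"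
  by (simp add: vec_eq_iff)

lemma cinner_simps:
  "cinner x (y + z) = cinner x y + cinner x z"
  "cinner (x + y) z = cinner x z + cinner y z"
  "cinner x (y - z) = cinner x y - cinner x z"
  "cinner x 0 = 0" "cinner 0 x = 0"
  by (simp_all add: cinner_def sum.distrib sum_subtractf algebra_simps)

lemma cinner_sum_right: "cinner x (\<Sum>i\<in>I. f i) = (\<Sum>i\<in>I. cinner x (f i))"
  by (induction I rule: infinite_finite_induct) (simp_all add: cinner_simps)

lemma cinner_sum_left: "cinner (\<Sum>i\<in>I. f i) x = (\<Sum>i\<in>I. cinner (f i) x)"
  by (induction I rule: infinite_finite_induct) (simp_all add: cinner_simps)

lemma mv_distribs:
  fixes A B :: "'m::finite cmat"
  shows "(A + B) *v x = A *v x + B *v x" "(A - B) *v x = A *v x - B *v x"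
  by (simp_all add: vec_eq_iff matrix_vector_mult_def sum.distrib sum_subtractf algebra_simps)

lemma mv_sum: "(\<Sum>i\<in>I. (f i :: 'm::finite cmat)) *v x = (\<Sum>i\<in>I. f i *v x)"
  by (induction I rule: infinite_finite_induct) (simp_all add: mv_distribs)

lemma cinner_mv_expand: "cinner x (A *v y) = (\<Sum>p\<in>UNIV. \<Sum>q\<in>UNIV. cnj (x $ p) * A $ p $ q * y $ q)"
  by (simp add: cinner_def matrix_vector_mult_def sum_distrib_left mult.assoc)

lemma cinner_cscale_mv: "cinner x ((c *\<^sub>C A) *v y) = c * cinner x (A *v y)"
  by (simp add: cinner_mv_expand sum_distrib_left mult_ac)

lemma cinner_adjoint: "cinner x (ctranspose A *v y) = cinner (A *v x) y"
proof -
  have "cinner x (ctranspose A *v y) = (\<Sum>q\<in>UNIV. \<Sum>p\<in>UNIV. cnj (x $ p) * cnj (A $ q $ p) * y $ q)"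
    unfolding cinner_mv_expand ctranspose_nth by (rule sum.swap)
  also have "\<dots> = cinner (A *v x) y"
    by (simp add: cinner_def matrix_vector_mult_def sum_distrib_left sum_distrib_right mult_ac)
  finally show ?thesis .
qed

lemma cinner_sandwich:
  "cinner x ((ctranspose A ** B ** C) *v y) = cinner (A *v x) (B *v (C *v y))"
  by (simp add: cinner_adjoint flip: matrix_vector_mul_assoc)

lemma norm_cmat_sq: "(norm (A :: 'm::finite cmat))\<^sup>2 = (\<Sum>i\<in>UNIV. \<Sum>j\<in>UNIV. (cmod (A $ i $ j))\<^sup>2)"
  by (simp add: norm_vec_def L2_set_def sum_nonneg)

lemma norm_cscale: "norm (c *\<^sub>C A) = cmod c * norm A"
proof -
  have "(norm (c *\<^sub>C A))\<^sup>2 = (cmod c * norm A)\<^sup>2"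
    by (simp add: norm_cmat_sq power_mult_distrib norm_mult sum_distrib_left)
  then show ?thesis by (simp add: power2_eq_iff_nonneg)
qed

lemma norm_ctranspose: "norm (ctranspose A) = norm A"
proof -
  have "(norm (ctranspose A))\<^sup>2 = (norm A)\<^sup>2"
    unfolding norm_cmat_sq ctranspose_nth complex_mod_cnj by (rule sum.swap)
  then show ?thesis by (simp add: power2_eq_iff_nonneg)
qed

lemma norm_le_entries: "norm (A :: 'm::finite cmat) \<le> (\<Sum>i\<in>UNIV. \<Sum>j\<in>UNIV. cmod (A $ i $ j))"
proof -
  have "norm A \<le> (\<Sum>i\<in>UNIV. norm (A $ i))"
    by (simp add: norm_vec_def L2_set_le_sum)
  also have "\<dots> \<le> (\<Sum>i\<in>UNIV. \<Sum>j\<in>UNIV. cmod (A $ i $ j))"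
    by (intro sum_mono) (simp add: norm_vec_def L2_set_le_sum)
  finally show ?thesis .
qed

lemma norm_mv_le: "norm ((A :: 'm::finite cmat) *v x) \<le> norm A * norm x"
proof -
  have "norm ((A *v x) $ i) \<le> norm (A $ i) * norm x" for i
  proof -
    have "norm ((A *v x) $ i) \<le> (\<Sum>j\<in>UNIV. \<bar>cmod (A $ i $ j)\<bar> * \<bar>cmod (x $ j)\<bar>)"
      unfolding matrix_vector_mult_def by (auto intro!: order_trans[OF norm_sum] simp: norm_mult)
    also have "\<dots> \<le> norm (A $ i) * norm x"
      unfolding norm_vec_def by (rule L2_set_mult_ineq)
    finally show ?thesis .
  qed
  then have "norm (A *v x) \<le> L2_set (\<lambda>i. norm (A $ i) * norm x) UNIV"
    unfolding norm_vec_def[of "A *v x"] by (intro L2_set_mono) auto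
  also have "\<dots> = norm A * norm x"
    by (simp add: L2_set_left_distrib norm_vec_def[of A])
  finally show ?thesis .
qed

text \<open>All estimates are made in the Frobenius norm \<^const>\<open>norm\<close>. It is submultiplicative and dominates
  the operator norm, so that the operator norm only enters at the very end.\<close>

lemma norm_mat_mult_le: "norm ((A :: 'm::finite cmat) ** (B :: 'm cmat)) \<le> norm A * norm B"
proof -
  have col: "(A ** B) $ i $ j = (A *v (\<chi> k. B $ k $ j)) $ i" for i j
    by (simp add: mat_mult_nth matrix_vector_mult_def)
  have "(norm (A ** B))\<^sup>2 = (\<Sum>j\<in>UNIV. \<Sum>i\<in>UNIV. (cmod ((A *v (\<chi> k. B $ k $ j)) $ i))\<^sup>2)"
    unfolding norm_cmat_sq col by (rule sum.swap)
  also have "\<dots> = (\<Sum>j\<in>UNIV. (norm (A *v (\<chi> k. B $ k $ j)))\<^sup>2)"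
    by (simp add: norm_vec_def L2_set_def sum_nonneg)
  also have "\<dots> \<le> (\<Sum>j\<in>UNIV. (norm A * norm (\<chi> k. B $ k $ j))\<^sup>2)"
    by (intro sum_mono power_mono norm_mv_le) auto
  also have "\<dots> = (norm A)\<^sup>2 * (\<Sum>j\<in>UNIV. \<Sum>k\<in>UNIV. (cmod (B $ k $ j))\<^sup>2)"
    by (simp add: power_mult_distrib sum_distrib_left norm_vec_def[of "vec_lambda _"] L2_set_def sum_nonneg)
  also have "(\<Sum>j\<in>UNIV. \<Sum>k\<in>UNIV. (cmod (B $ k $ j))\<^sup>2) = (norm B)\<^sup>2"
    unfolding norm_cmat_sq by (rule sum.swap)
  finally show ?thesis
    by (simp flip: power_mult_distrib add: power2_le_iff_abs_le)
qed

lemma norm_sandwich_le: "norm ((A :: 'm::finite cmat) ** (B :: 'm cmat) ** (C :: 'm cmat)) \<le> norm A * norm B * norm C"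
  by (rule order_trans[OF norm_mat_mult_le]) (intro mult_right_mono norm_mat_mult_le norm_ge_zero)

lemma bounded_linear_mv: "bounded_linear ((*v) (A :: 'm::finite cmat))"
proof (rule bounded_linear_intro[where K = "norm A"])
  show "norm (A *v x) \<le> norm x * norm A" for x
    using norm_mv_le[of A x] by (simp add: mult.commute)
qed (auto simp: vec_eq_iff matrix_vector_mult_def sum.distrib algebra_simps scaleR_sum_right)

lemma opnorm_le_norm: "opnorm A \<le> norm A"
  unfolding opnorm_def by (rule onorm_le) (rule norm_mv_le)

lemma norm_entry_le_opnorm: "cmod (A $ i $ j) \<le> opnorm A"
proof -
  have "A $ i $ j = (A *v axis j 1) $ i"
    by (simp add: matrix_vector_mult_def axis_def if_distrib cong: if_cong)
  also have "cmod \<dots> \<le> norm (A *v axis j 1)" by (rule Finite_Cartesian_Product.norm_nth_le)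
  also have "\<dots> \<le> onorm ((*v) A) * norm (axis j (1::complex))"
    by (rule onorm[OF bounded_linear_mv])
  also have "norm (axis j (1::complex)) = 1" by simp
  finally show ?thesis by (simp add: opnorm_def)
qed

lemma continuous_on_cmat_iff:
  fixes f :: "'a::topological_space \<Rightarrow> 'm::finite cmat"
  shows "continuous_on S f \<longleftrightarrow> (\<forall>i j. continuous_on S (\<lambda>x. f x $ i $ j))"
proof
  assume "\<forall>i j. continuous_on S (\<lambda>x. f x $ i $ j)"
  then have "continuous_on S (\<lambda>x. \<chi> i. \<chi> j. f x $ i $ j)"
    by (intro continuous_on_vec_lambda) auto
  then show "continuous_on S f" by simp
qed (auto intro!: continuous_intros)

lemma continuous_on_cmat_mult:
  fixes f g :: "'a::topological_space \<Rightarrow> 'm::finite cmat"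
  assumes "continuous_on S f" "continuous_on S g"
  shows "continuous_on S (\<lambda>x. f x ** g x)"
  using assms by (simp add: continuous_on_cmat_iff mat_mult_nth continuous_on_sum continuous_on_mult)

lemma continuous_on_ctranspose:
  assumes "continuous_on S f"
  shows "continuous_on S (\<lambda>x. ctranspose (f x))"
  using assms by (simp add: continuous_on_cmat_iff continuous_on_cnj)

lemma continuous_on_cscale:
  assumes "continuous_on S c" "continuous_on S f"
  shows "continuous_on S (\<lambda>x. c x *\<^sub>C f x)"
  using assms by (simp add: continuous_on_cmat_iff continuous_on_mult)

section \<open>Positive semidefinite matrices\<close>

text \<open>Choi matrices are indexed by pairs, so scalar matrices are taken over an arbitrary finite index
  type. The form is conjugate linear in its first argument.\<close>

definition mform :: "('i::finite \<Rightarrow> 'i \<Rightarrow> complex) \<Rightarrow> ('i \<Rightarrow> complex) \<Rightarrow> ('i \<Rightarrow> complex) \<Rightarrow> complex"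
  where "mform c x y = (\<Sum>i\<in>UNIV. \<Sum>j\<in>UNIV. cnj (x i) * c i j * y j)"

definition psd :: "('i::finite \<Rightarrow> 'i \<Rightarrow> complex) \<Rightarrow> bool"
  where "psd c \<longleftrightarrow> (\<forall>x. mform c x x \<in> \<real>\<^sub>\<ge>\<^sub>0)"

lemma mform_simps:
  "mform c (\<lambda>i. x i + x' i) y = mform c x y + mform c x' y"
  "mform c x (\<lambda>i. y i + y' i) = mform c x y + mform c x y'"
  "mform c (\<lambda>i. x i - x' i) y = mform c x y - mform c x' y"
  "mform c x (\<lambda>i. y i - y' i) = mform c x y - mform c x y'"
  "mform c (\<lambda>i. a * x i) y = cnj a * mform c x y"
  "mform c x (\<lambda>i. a * y i) = a * mform c x y"
  "mform (\<lambda>i j. c i j + c' i j) x y = mform c x y + mform c' x y"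
  "mform (\<lambda>i j. c i j - c' i j) x y = mform c x y - mform c' x y"
  "mform (\<lambda>i j. a * c i j) x y = a * mform c x y"
  by (simp_all add: mform_def sum_distrib_left sum.distrib sum_subtractf algebra_simps)

definition unit_at :: "'i \<Rightarrow> 'i \<Rightarrow> complex"
  where "unit_at i j = (if j = i then 1 else 0)"

lemma mform_unit_left: "mform c (unit_at i) y = (\<Sum>j\<in>UNIV. c i j * y j)"
proof -
  have "mform c (unit_at i) y = (\<Sum>k\<in>UNIV. if k = i then \<Sum>j\<in>UNIV. c k j * y j else 0)"
    unfolding mform_def unit_at_def by (intro sum.cong) auto
  then show ?thesis by simp
qed

lemma mform_unit_unit [simp]: "mform c (unit_at i) (unit_at j) = c i j"
  unfolding mform_unit_left by (simp add: unit_at_def if_distrib cong: if_cong)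

lemma mform_rank_one:
  "mform (\<lambda>i j. cnj (v i) * v j) x y = cnj (\<Sum>i\<in>UNIV. v i * x i) * (\<Sum>i\<in>UNIV. v i * y i)"
  unfolding mform_def cnj_sum sum_product by (simp add: mult_ac)

lemma psd_hermitian_form:
  assumes "psd c"
  shows "mform c y x = cnj (mform c x y)"
proof -
  have real: "mform c x x \<in> \<real>" for x
    using assms[unfolded psd_def, rule_format, of x]
    by (simp add: complex_nonneg_Reals_iff complex_is_Real_iff)
  have "mform c (\<lambda>i. x i + y i) (\<lambda>i. x i + y i) - mform c x x - mform c y y \<in> \<real>"
    by (intro Reals_diff real)
  then have 1: "mform c x y + mform c y x \<in> \<real>" by (simp add: mform_simps)
  have "mform c (\<lambda>i. x i + \<i> * y i) (\<lambda>i. x i + \<i> * y i) - mform c x x - mform c y y \<in> \<real>"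
    by (intro Reals_diff real)
  then have 2: "\<i> * mform c x y - \<i> * mform c y x \<in> \<real>" by (simp add: mform_simps algebra_simps)
  from 1 2 show ?thesis by (simp add: complex_is_Real_iff complex_eq_iff)
qed

lemma psd_hermitian:
  assumes "psd c"
  shows "c j i = cnj (c i j)"
  using psd_hermitian_form[OF assms, of "unit_at j" "unit_at i"] by simp

text \<open>The degenerate case of the Cauchy-Schwarz inequality: an isotropic vector of a
  semidefinite form lies in its radical.\<close>

lemma psd_isotropic:
  assumes "psd c" and "mform c x x = 0"
  shows "mform c y x = 0"
proof (rule ccontr)
  define b where "b = mform c y x"
  assume "mform c y x \<noteq> 0"
  then have b0: "b \<noteq> 0" by (simp add: b_def)
  have xy: "mform c x y = cnj b" unfolding b_def by (rule psd_hermitian_form[OF assms(1)])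
  define R where "R = Re (mform c y y)"
  have yy: "mform c y y = of_real R" "0 \<le> R"
    using assms(1) unfolding psd_def R_def
    by (auto simp: complex_nonneg_Reals_iff complex_eq_iff)
  define t where "t = (R + 1) / (cmod b)\<^sup>2"
  define a where "a = - (of_real t * cnj b)"
  have "mform c (\<lambda>i. y i + a * x i) (\<lambda>i. y i + a * x i) = of_real R + a * b + cnj a * cnj b"
    by (simp add: mform_simps assms(2) xy yy algebra_simps flip: b_def)
  also have "\<dots> = of_real (R - 2 * t * (cmod b)\<^sup>2)"
    using complex_norm_square[of b] by (simp add: a_def algebra_simps)
  finally have "mform c (\<lambda>i. y i + a * x i) (\<lambda>i. y i + a * x i) = of_real (R - 2 * t * (cmod b)\<^sup>2)" .
  moreover have "t * (cmod b)\<^sup>2 = R + 1" using b0 by (simp add: t_def)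
  then have "R - 2 * t * (cmod b)\<^sup>2 < 0" using yy by (simp add: mult.assoc)
  ultimately show False
    using assms(1)[unfolded psd_def, rule_format, of "\<lambda>i. y i + a * x i"]
    by (simp add: complex_nonneg_Reals_iff)
qed

text \<open>A positive form below a rank-one form vanishes on the kernel of the latter, hence is a
  multiple of it; the multiple is read off at any vector \<open>w\<close> outside that kernel.\<close>

lemma psd_below_rank_one:
  fixes v w :: "'i::finite \<Rightarrow> complex"
  assumes "psd c" and "psd (\<lambda>i j. cnj (v i) * v j - c i j)"
  defines "s \<equiv> \<Sum>i\<in>UNIV. v i * w i"
  shows "mform c w w \<in> \<real>\<^sub>\<ge>\<^sub>0" and "cmod (mform c w w) \<le> (cmod s)\<^sup>2"
    and "c i j * (cmod s)\<^sup>2 = mform c w w * (cnj (v i) * v j)"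
proof -
  have le: "of_real ((cmod (\<Sum>i\<in>UNIV. v i * x i))\<^sup>2) - mform c x x \<in> \<real>\<^sub>\<ge>\<^sub>0" for x
    using assms(2) unfolding psd_def mform_simps mform_rank_one complex_norm_square
    by (simp only: mult.commute[of "cnj _"])
  show ge: "mform c w w \<in> \<real>\<^sub>\<ge>\<^sub>0" using assms(1) by (simp add: psd_def)
  have "cmod (mform c w w) = Re (mform c w w)"
    using ge by (auto simp: nonneg_Reals_def cmod_eq_Re)
  then show "cmod (mform c w w) \<le> (cmod s)\<^sup>2"
    using le[of w] by (simp add: complex_nonneg_Reals_iff s_def)
  have ker: "mform c y x = 0" if "(\<Sum>i\<in>UNIV. v i * x i) = 0" for x y
  proof -
    have "mform c x x = 0"
      using le[of x] that assms(1)[unfolded psd_def, rule_format, of x]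
      by (simp add: complex_nonneg_Reals_iff complex_eq_iff)
    then show ?thesis by (rule psd_isotropic[OF assms(1)])
  qed
  have key: "mform c y (unit_at j) * s = mform c y w * v j" for y j
  proof -
    have "(\<Sum>i\<in>UNIV. v i * (s * unit_at j i - v j * w i)) = s * (\<Sum>i\<in>UNIV. v i * unit_at j i) - v j * s"
      by (simp add: s_def algebra_simps sum_subtractf sum_distrib_left)
    also have "\<dots> = 0" by (simp add: unit_at_def if_distrib cong: if_cong)
    finally have "mform c y (\<lambda>i. s * unit_at j i - v j * w i) = 0" by (rule ker)
    then show ?thesis by (simp add: mform_simps algebra_simps)
  qed
  have "c i j * s = mform c (unit_at i) w * v j" using key[of "unit_at i" j] by simp
  moreover have "mform c (unit_at i) w * cnj s = mform c w w * cnj (v i)"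
    using arg_cong[OF key[of w i], of cnj]
    by (simp flip: psd_hermitian_form[OF assms(1)])
  ultimately show "c i j * (cmod s)\<^sup>2 = mform c w w * (cnj (v i) * v j)"
    unfolding complex_norm_square by (simp flip: mult.assoc)
qed

text \<open>Gaussian elimination: one rank-one term is split off for each row, and the Schur
  complement that remains is again semidefinite.\<close>

lemma psd_split_rank_one:
  assumes c: "psd c"
  shows "\<exists>v. psd (\<lambda>i j. c i j - cnj (v i) * v j) \<and> (\<forall>j. c t j = cnj (v t) * v j)
    \<and> (\<forall>j. c t j = 0 \<longrightarrow> v j = 0)"
proof (cases "c t t = 0")
  case True
  have "c t j = 0" for j
  proof -
    have "mform c (unit_at j) (unit_at t) = 0" using True psd_isotropic[OF c, of "unit_at t" "unit_at j"] by simp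
    then show ?thesis using psd_hermitian[OF c, of t j] by simp
  qed
  then show ?thesis using c by (intro exI[of _ "\<lambda>_. 0"]) simp
next
  case False
  define r where "r = Re (c t t)"
  have r: "c t t = of_real r" "0 \<le> r"
    using c[unfolded psd_def, rule_format, of "unit_at t"]
    by (auto simp: complex_nonneg_Reals_iff complex_eq_iff r_def)
  with False have r0: "r > 0" by (cases "r = 0") auto
  define v where "v j = c t j / of_real (sqrt r)" for j
  have sq: "complex_of_real (sqrt r) * of_real (sqrt r) = of_real r"
    using r0 by (simp flip: of_real_mult)
  have vt: "v t = of_real (sqrt r)" using sq r r0 by (simp add: v_def field_simps)
  have row: "c t j = cnj (v t) * v j" for j
    using r0 by (simp add: vt) (simp add: v_def)
  have "mform (\<lambda>i j. c i j - cnj (v i) * v j) x x \<in> \<real>\<^sub>\<ge>\<^sub>0" for x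
  proof -
    define b where "b = mform c (unit_at t) x"
    have vx: "(\<Sum>i\<in>UNIV. v i * x i) = b / of_real (sqrt r)"
      by (simp add: b_def mform_unit_left v_def sum_divide_distrib)
    have xb: "mform c x (unit_at t) = cnj b" unfolding b_def by (rule psd_hermitian_form[OF c])
    define x' where "x' = (\<lambda>i. x i - (b / r) * unit_at t i)"
    have "mform c x' x' = mform c x x - cnj b * b / r"
      unfolding x'_def mform_simps xb mform_unit_unit r using r0 by (simp flip: b_def)
    also have "\<dots> = mform (\<lambda>i j. c i j - cnj (v i) * v j) x x"
      unfolding mform_simps mform_rank_one vx using sq by simp
    finally show ?thesis using c[unfolded psd_def, rule_format, of x'] by simp
  qed
  then have "psd (\<lambda>i j. c i j - cnj (v i) * v j)" by (simp add: psd_def)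
  moreover have "v j = 0" if "c t j = 0" for j using that by (simp add: v_def)
  ultimately show ?thesis using row by blast
qed

lemma psd_gram:
  assumes "finite T" and "psd c" and "\<And>i j. i \<notin> T \<Longrightarrow> c i j = 0"
  shows "\<exists>v. \<forall>i j. c i j = (\<Sum>s\<in>T. cnj (v s i) * v s j)"
  using assms
proof (induction T arbitrary: c rule: finite_induct)
  case empty
  then show ?case by simp
next
  case (insert t T)
  obtain v where v: "psd (\<lambda>i j. c i j - cnj (v i) * v j)" "\<And>j. c t j = cnj (v t) * v j"
    "\<And>j. c t j = 0 \<Longrightarrow> v j = 0"
    using psd_split_rank_one[OF insert.prems(1), of t] by blast
  have "c i j - cnj (v i) * v j = 0" if "i \<notin> T" for i j
  proof (cases "i = t")
    case False
    then have "c i j = 0" for j using insert.prems(2) that by simp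
    moreover from this have "v i = 0"
      using psd_hermitian[OF insert.prems(1), of t i] v(3) by simp
    ultimately show ?thesis by simp
  qed (simp add: v(2))
  then obtain u where u: "\<And>i j. c i j - cnj (v i) * v j = (\<Sum>s\<in>T. cnj (u s i) * u s j)"
    using insert.IH[OF v(1)] by auto
  have "c i j = (\<Sum>s\<in>insert t T. cnj ((u(t := v)) s i) * (u(t := v)) s j)" for i j
  proof -
    have "(\<Sum>s\<in>T. cnj ((u(t := v)) s i) * (u(t := v)) s j) = (\<Sum>s\<in>T. cnj (u s i) * u s j)"
      using insert.hyps by (intro sum.cong) auto
    then show ?thesis using insert.hyps u[of i j] by (simp add: algebra_simps)
  qed
  then show ?case by blast
qed

text \<open>A block matrix is flattened to a scalar matrix whose indices are pairs (block, position).\<close>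

lemma psd_of_block_psd:
  assumes "block_psd UNIV A"
  shows "psd (\<lambda>(a, p) (b, q). A a b $ p $ q)"
  unfolding psd_def
proof
  fix x :: "'a \<times> 'b \<Rightarrow> complex"
  have pairs: "(\<Sum>i\<in>UNIV. f i) = (\<Sum>a\<in>UNIV. \<Sum>p\<in>UNIV. f (a, p))" for f :: "'a \<times> 'b \<Rightarrow> complex"
    by (simp add: sum.cartesian_product)
  have "mform (\<lambda>(a, p) (b, q). A a b $ p $ q) x x
      = (\<Sum>a\<in>UNIV. \<Sum>p\<in>UNIV. \<Sum>b\<in>UNIV. \<Sum>q\<in>UNIV. cnj (x (a, p)) * A a b $ p $ q * x (b, q))"
    by (simp add: mform_def pairs)
  also have "\<dots> = (\<Sum>a\<in>UNIV. \<Sum>b\<in>UNIV. cinner (\<chi> p. x (a, p)) (A a b *v (\<chi> q. x (b, q))))"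
    unfolding cinner_mv_expand by (intro sum.cong refl) (simp, subst sum.swap, simp)
  also have "\<dots> \<in> \<real>\<^sub>\<ge>\<^sub>0"
    using assms[unfolded block_psd_def, rule_format, of "\<lambda>a. \<chi> p. x (a, p)"] .
  finally show "mform (\<lambda>(a, p) (b, q). A a b $ p $ q) x x \<in> \<real>\<^sub>\<ge>\<^sub>0" .
qed

lemma block_psd_reindex:
  assumes "bij_betw e I J"
  shows "block_psd J A \<longleftrightarrow> block_psd I (\<lambda>i j. A (e i) (e j))"
proof
  assume A: "block_psd J A"
  show "block_psd I (\<lambda>i j. A (e i) (e j))"
    unfolding block_psd_def
  proof
    fix x :: "'a \<Rightarrow> complex^'c"
    define y where "y = x \<circ> the_inv_into I e"
    have y: "y (e i) = x i" if "i \<in> I" for i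
      using that assms by (auto simp: y_def bij_betw_def the_inv_into_f_f)
    have "(\<Sum>i\<in>J. \<Sum>j\<in>J. cinner (y i) (A i j *v y j))
        = (\<Sum>i\<in>I. \<Sum>j\<in>I. cinner (y (e i)) (A (e i) (e j) *v y (e j)))"
      by (simp flip: sum.reindex_bij_betw[OF assms])
    also have "\<dots> = (\<Sum>i\<in>I. \<Sum>j\<in>I. cinner (x i) (A (e i) (e j) *v x j))"
      by (intro sum.cong) (auto simp: y)
    finally show "(\<Sum>i\<in>I. \<Sum>j\<in>I. cinner (x i) (A (e i) (e j) *v x j)) \<in> \<real>\<^sub>\<ge>\<^sub>0"
      using A[unfolded block_psd_def, rule_format, of y] by simp
  qed
next
  assume A: "block_psd I (\<lambda>i j. A (e i) (e j))"
  show "block_psd J A"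
    unfolding block_psd_def
  proof
    fix x :: "'b \<Rightarrow> complex^'c"
    have "(\<Sum>i\<in>J. \<Sum>j\<in>J. cinner (x i) (A i j *v x j))
        = (\<Sum>i\<in>I. \<Sum>j\<in>I. cinner (x (e i)) (A (e i) (e j) *v x (e j)))"
      by (simp flip: sum.reindex_bij_betw[OF assms])
    then show "(\<Sum>i\<in>J. \<Sum>j\<in>J. cinner (x i) (A i j *v x j)) \<in> \<real>\<^sub>\<ge>\<^sub>0"
      using A[unfolded block_psd_def, rule_format, of "x \<circ> e"] by simp
  qed
qed


section \<open>Means over the circle\<close>

text \<open>The integral against normalized arc length.\<close>

definition mean :: "(real \<Rightarrow> 'a::banach) \<Rightarrow> 'a"
  where "mean F = (1 / (2 * pi)) *\<^sub>R integral {0..2 * pi} F"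

lemma mean_bounded_linear:
  assumes "bounded_linear h" and "continuous_on {0..2 * pi} F"
  shows "mean (\<lambda>\<theta>. h (F \<theta>)) = h (mean F)"
proof -
  have "integral {0..2 * pi} (h \<circ> F) = h (integral {0..2 * pi} F)"
    by (rule integral_linear[OF integrable_continuous_real[OF assms(2)] assms(1)])
  then show ?thesis
    using linear_cmul[OF bounded_linear.linear[OF assms(1)]] by (simp add: mean_def comp_def)
qed

lemma mean_sum:
  assumes "\<And>i. i \<in> I \<Longrightarrow> continuous_on {0..2 * pi} (F i)"
  shows "mean (\<lambda>\<theta>. \<Sum>i\<in>I. F i \<theta>) = (\<Sum>i\<in>I. mean (F i))"
proof (cases "finite I")
  case True
  then have "integral {0..2 * pi} (\<lambda>\<theta>. \<Sum>i\<in>I. F i \<theta>) = (\<Sum>i\<in>I. integral {0..2 * pi} (F i))"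
    using assms by (intro integral_sum integrable_continuous_real) auto
  then show ?thesis by (simp add: mean_def scaleR_sum_right)
qed (simp add: mean_def)

lemma mean_add:
  assumes "continuous_on {0..2 * pi} F" "continuous_on {0..2 * pi} G"
  shows "mean (\<lambda>\<theta>. F \<theta> + G \<theta>) = mean F + mean G"
  using assms by (simp add: mean_def integral_add integrable_continuous_real scaleR_add_right)

lemma mean_diff:
  assumes "continuous_on {0..2 * pi} F" "continuous_on {0..2 * pi} G"
  shows "mean (\<lambda>\<theta>. F \<theta> - G \<theta>) = mean F - mean G"
  using assms by (simp add: mean_def integral_diff integrable_continuous_real scaleR_diff_right)

lemma mean_const [simp]: "mean (\<lambda>\<theta>. c) = c"
  by (simp add: mean_def)

lemma mean_norm_le:
  assumes "continuous_on {0..2 * pi} F" "continuous_on {0..2 * pi} G"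
    and "\<And>\<theta>. norm (F \<theta>) \<le> G \<theta>"
  shows "norm (mean F) \<le> mean G"
proof -
  have "norm (integral {0..2 * pi} F) \<le> integral {0..2 * pi} G"
    using assms by (intro integral_norm_bound_integral integrable_continuous_real) auto
  then show ?thesis by (simp add: mean_def divide_right_mono)
qed

lemma mean_nonneg_Reals:
  fixes F :: "real \<Rightarrow> complex"
  assumes "continuous_on {0..2 * pi} F" and "\<And>\<theta>. F \<theta> \<in> \<real>\<^sub>\<ge>\<^sub>0"
  shows "mean F \<in> \<real>\<^sub>\<ge>\<^sub>0"
proof -
  have "Im (mean F) = mean (\<lambda>\<theta>. Im (F \<theta>))" "Re (mean F) = mean (\<lambda>\<theta>. Re (F \<theta>))"
    using mean_bounded_linear[OF bounded_linear_Im assms(1)]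
      mean_bounded_linear[OF bounded_linear_Re assms(1)] by auto
  moreover have "norm (mean (\<lambda>\<theta>. 0 :: real)) \<le> mean (\<lambda>\<theta>. Re (F \<theta>))"
    using assms by (intro mean_norm_le continuous_intros) (auto simp: complex_nonneg_Reals_iff)
  moreover have "(\<lambda>\<theta>. Im (F \<theta>)) = (\<lambda>\<theta>. 0)"
    using assms(2) by (auto simp: complex_nonneg_Reals_iff)
  ultimately show ?thesis by (simp add: complex_nonneg_Reals_iff)
qed

lemma mean_mult_left:
  fixes F :: "real \<Rightarrow> complex"
  assumes "continuous_on {0..2 * pi} F"
  shows "mean (\<lambda>\<theta>. c * F \<theta>) = c * mean F"
  by (rule mean_bounded_linear[OF bounded_linear_mult_right assms])

lemma bounded_linear_cscale_left: "bounded_linear (\<lambda>c. c *\<^sub>C A)"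
  by (rule bounded_linear_intro[where K = "norm A"])
     (auto simp: vec_eq_iff algebra_simps norm_cscale)

lemma mean_cscale:
  assumes "continuous_on {0..2 * pi} F"
  shows "mean (\<lambda>\<theta>. F \<theta> *\<^sub>C A) = mean F *\<^sub>C A"
  by (rule mean_bounded_linear[OF bounded_linear_cscale_left assms])

lemma mean_cis_orthonormal:
  "mean (\<lambda>\<theta>. cnj (cis \<theta> ^ a) * cis \<theta> ^ b) = (if a = b then 1 else 0)"
proof -
  define k where "k = real b - real a"
  have eq: "cnj (cis \<theta> ^ a) * cis \<theta> ^ b = cis (k * \<theta>)" for \<theta>
    by (simp add: k_def Complex.DeMoivre cis_cnj cis_mult algebra_simps)
  show ?thesis
  proof (cases "a = b")
    case True
    then have "(\<lambda>\<theta>. cnj (cis \<theta> ^ a) * cis \<theta> ^ b) = (\<lambda>\<theta>. 1)"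
      unfolding eq by (simp add: k_def)
    then show ?thesis using True by simp
  next
    case False
    then have k: "k \<noteq> 0" by (simp add: k_def)
    have "((\<lambda>\<theta>. cis (k * \<theta>)) has_integral (cis (k * (2 * pi)) / (\<i> * k) - cis (k * 0) / (\<i> * k))) {0..2 * pi}"
    proof (rule fundamental_theorem_of_calculus)
      show "((\<lambda>\<theta>. cis (k * \<theta>) / (\<i> * k)) has_vector_derivative cis (k * \<theta>)) (at \<theta> within {0..2 * pi})" for \<theta>
      proof -
        have "((\<lambda>w. exp (\<i> * k * w) / (\<i> * k)) has_field_derivative exp (\<i> * k * of_real \<theta>)) (at (of_real \<theta>))"
          using k by (auto intro!: derivative_eq_intros)
        from has_vector_derivative_real_field[OF this] show ?thesis
          by (simp add: cis_conv_exp mult.assoc has_vector_derivative_at_within)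
      qed
    qed simp
    moreover have "cis (k * (2 * pi)) = 1"
    proof -
      have "cis (k * (2 * pi)) = cis (2 * pi * real b) / cis (2 * pi * real a)"
        by (simp add: k_def cis_divide algebra_simps)
      then show ?thesis by simp
    qed
    ultimately have "integral {0..2 * pi} (\<lambda>\<theta>. cis (k * \<theta>)) = 0"
      by (simp add: integral_unique)
    then show ?thesis using False unfolding eq by (simp add: mean_def)
  qed
qed

text \<open>Parseval's identity for polynomials; \<open>mean_Qpoly_gram\<close> below is its matrix version, which turns
  the normalization of \<open>Q\<close> into the isometry condition on its coefficients.\<close>

lemma mean_poly_norm_sq:
  "mean (\<lambda>\<theta>. (cmod (poly p (cis \<theta>)))\<^sup>2) = (\<Sum>i\<le>degree p. (cmod (coeff p i))\<^sup>2)"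
proof -
  let ?I = "{..degree p}"
  have "complex_of_real (mean (\<lambda>\<theta>. (cmod (poly p (cis \<theta>)))\<^sup>2))
      = mean (\<lambda>\<theta>. complex_of_real ((cmod (poly p (cis \<theta>)))\<^sup>2))"
    by (rule mean_bounded_linear[OF bounded_linear_of_real, symmetric]) (intro continuous_intros)
  also have "\<dots> = mean (\<lambda>\<theta>. \<Sum>i\<in>?I. \<Sum>j\<in>?I. (cnj (coeff p i) * coeff p j) * (cnj (cis \<theta> ^ i) * cis \<theta> ^ j))"
  proof -
    have "complex_of_real ((cmod (poly p z))\<^sup>2)
        = (\<Sum>i\<in>?I. \<Sum>j\<in>?I. (cnj (coeff p i) * coeff p j) * (cnj (z ^ i) * z ^ j))" for z
    proof -
      have "complex_of_real ((cmod (poly p z))\<^sup>2) = cnj (poly p z) * poly p z"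
        by (simp only: complex_norm_square mult.commute)
      also have "\<dots> = (\<Sum>i\<in>?I. \<Sum>j\<in>?I. (cnj (coeff p i) * coeff p j) * (cnj (z ^ i) * z ^ j))"
        unfolding poly_altdef cnj_sum sum_product by (simp add: mult_ac)
      finally show ?thesis .
    qed
    then show ?thesis by simp
  qed
  also have "\<dots> = (\<Sum>i\<in>?I. \<Sum>j\<in>?I. (cnj (coeff p i) * coeff p j) * (if i = j then 1 else 0))"
    by (subst mean_sum; (intro continuous_intros)?; intro sum.cong refl)
       (subst mean_sum; (intro continuous_intros)?; intro sum.cong refl; subst mean_mult_left;
         (intro continuous_intros)?; simp only: mean_cis_orthonormal)
  also have "\<dots> = (\<Sum>i\<in>?I. cnj (coeff p i) * coeff p i)"
    by (simp add: if_distrib sum.delta cong: if_cong)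
  also have "\<dots> = of_real (\<Sum>i\<in>?I. (cmod (coeff p i))\<^sup>2)"
    unfolding of_real_sum complex_norm_square by (simp add: mult.commute)
  finally show ?thesis by (simp only: of_real_eq_iff)
qed

lemma continuous_on_Qpoly_cis: "continuous_on S (\<lambda>\<theta>. Qpoly n V (cis \<theta>))"
  unfolding Qpoly_def by (intro continuous_on_sum continuous_on_cscale continuous_intros)

lemma continuous_on_CT_cis:
  assumes "f \<in> os_carrier CT"
  shows "continuous_on S (\<lambda>\<theta>. f (cis \<theta>))"
  by (rule continuous_on_compose2[of circle f])
     (use assms in \<open>auto simp: CT_def intro!: continuous_intros\<close>)

lemma mean_Qpoly_gram:
  "mean (\<lambda>\<theta>. ctranspose (Qpoly n V (cis \<theta>)) ** Qpoly n V (cis \<theta>)) = (\<Sum>i\<in>{1..n}. ctranspose (V i) ** V i)"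
proof -
  let ?I = "{1..n}"
  have "mean (\<lambda>\<theta>. ctranspose (Qpoly n V (cis \<theta>)) ** Qpoly n V (cis \<theta>))
     = mean (\<lambda>\<theta>. \<Sum>i\<in>?I. \<Sum>j\<in>?I. (cnj (cis \<theta> ^ (n - i)) * cis \<theta> ^ (n - j)) *\<^sub>C (ctranspose (V i) ** V j))"
    unfolding Qpoly_def ctranspose_sum ctranspose_simps mult_sums mult_cscale cscale_simps
    by (subst sum.swap) (simp add: mult_sums mult_cscale cscale_simps cscale_sum_right mult.commute)
  also have "\<dots> = (\<Sum>i\<in>?I. \<Sum>j\<in>?I. (if n - i = n - j then 1 else 0) *\<^sub>C (ctranspose (V i) ** V j))"
    by (subst mean_sum; (intro continuous_on_sum continuous_on_cscale continuous_intros)?; intro sum.cong refl)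
       (subst mean_sum; (intro continuous_on_cscale continuous_intros)?; intro sum.cong refl; subst mean_cscale;
         (intro continuous_intros)?; simp only: mean_cis_orthonormal)
  also have "\<dots> = (\<Sum>i\<in>?I. \<Sum>j\<in>?I. if i = j then ctranspose (V i) ** V j else 0)"
    by (intro sum.cong refl) (auto simp: cscale_simps)
  also have "\<dots> = (\<Sum>i\<in>?I. ctranspose (V i) ** V i)" by (simp add: sum.delta)
  finally show ?thesis .
qed

lemma Phi_Q_mean:
  "Phi_Q n V f = mean (\<lambda>\<theta>. ctranspose (Qpoly n V (cis \<theta>)) ** f (cis \<theta>) ** Qpoly n V (cis \<theta>))"
  by (simp add: Phi_Q_def mean_def)

lemma continuous_on_sandwich:
  assumes "f \<in> os_carrier CT"
  shows "continuous_on S (\<lambda>\<theta>. ctranspose (Qpoly n V (cis \<theta>)) ** f (cis \<theta>) ** Qpoly n V (cis \<theta>))"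
  by (intro continuous_on_cmat_mult continuous_on_ctranspose continuous_on_Qpoly_cis
      continuous_on_CT_cis assms)

lemma CT_carrierD: "f \<in> os_carrier CT \<Longrightarrow> continuous_on circle f"
  by (simp add: CT_def)

lemma CT_lincomb:
  assumes "f \<in> os_carrier CT" "g \<in> os_carrier CT"
  shows "(\<lambda>z. a *\<^sub>C f z + b *\<^sub>C g z) \<in> os_carrier CT"
  using assms by (auto simp: CT_def cscale_simps intro!: continuous_on_add continuous_on_cscale continuous_intros)

lemma bounded_linear_cscale_right: "bounded_linear (\<lambda>A. c *\<^sub>C A)"
  by (rule bounded_linear_intro[where K = "cmod c"])
     (auto simp: vec_eq_iff algebra_simps norm_cscale)

lemma bounded_linear_cinner_mv: "bounded_linear (\<lambda>A :: 'm::finite cmat. cinner x (A *v y))"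
proof -
  have "bounded_linear (\<lambda>A :: 'm cmat. A $ p $ q)" for p q
    using bounded_linear_compose[OF bounded_linear_vec_nth bounded_linear_vec_nth] .
  then show ?thesis
    unfolding cinner_mv_expand
    by (intro bounded_linear_sum bounded_linear_mult_const bounded_linear_const_mult)
qed

lemma Phi_Q_ucp:
  assumes "isometry n V"
  shows "Phi_Q n V \<in> ucp_maps_CT"
proof -
  have lin: "clinear_map CT (Phi_Q n V)"
    unfolding clinear_map_def
  proof (intro allI ballI)
    fix a b and f g :: "complex \<Rightarrow> 'a cmat"
    assume f: "f \<in> os_carrier CT" and g: "g \<in> os_carrier CT"
    let ?S = "\<lambda>f \<theta>. ctranspose (Qpoly n V (cis \<theta>)) ** f (cis \<theta>) ** Qpoly n V (cis \<theta>)"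
    have "Phi_Q n V (\<lambda>x. a *\<^sub>C f x + b *\<^sub>C g x) = mean (\<lambda>\<theta>. a *\<^sub>C ?S f \<theta> + b *\<^sub>C ?S g \<theta>)"
      by (simp add: Phi_Q_mean mult_distribs mult_cscale)
    also have "\<dots> = mean (\<lambda>\<theta>. a *\<^sub>C ?S f \<theta>) + mean (\<lambda>\<theta>. b *\<^sub>C ?S g \<theta>)"
      by (intro mean_add continuous_on_cscale continuous_on_sandwich f g continuous_intros)
    also have "\<dots> = a *\<^sub>C Phi_Q n V f + b *\<^sub>C Phi_Q n V g"
      unfolding Phi_Q_mean
      by (simp only: mean_bounded_linear[OF bounded_linear_cscale_right continuous_on_sandwich[OF f]]
          mean_bounded_linear[OF bounded_linear_cscale_right continuous_on_sandwich[OF g]])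
    finally show "Phi_Q n V (\<lambda>x. a *\<^sub>C f x + b *\<^sub>C g x) = a *\<^sub>C Phi_Q n V f + b *\<^sub>C Phi_Q n V g" .
  qed
  have pos: "block_psd {..<k} (\<lambda>i j. Phi_Q n V (F i j))"
    if F: "\<forall>i<k. \<forall>j<k. F i j \<in> os_carrier CT" and P: "os_pos CT k F" for k F
    unfolding block_psd_def
  proof
    fix x :: "nat \<Rightarrow> complex^'a"
    let ?Q = "\<lambda>\<theta>. Qpoly n V (cis \<theta>)"
    let ?g = "\<lambda>i j \<theta>. cinner (x i) ((ctranspose (?Q \<theta>) ** F i j (cis \<theta>) ** ?Q \<theta>) *v x j)"
    have cont: "continuous_on S (?g i j)" if "i < k" "j < k" for i j S
      using F that
      by (intro bounded_linear.continuous_on[OF bounded_linear_cinner_mv] continuous_on_sandwich) auto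
    have "(\<Sum>i\<in>{..<k}. \<Sum>j\<in>{..<k}. cinner (x i) (Phi_Q n V (F i j) *v x j))
      = (\<Sum>i\<in>{..<k}. \<Sum>j\<in>{..<k}. mean (?g i j))"
      unfolding Phi_Q_mean using F
      by (intro sum.cong refl mean_bounded_linear[OF bounded_linear_cinner_mv, symmetric]
          continuous_on_sandwich) auto
    also have "\<dots> = mean (\<lambda>\<theta>. \<Sum>i\<in>{..<k}. \<Sum>j\<in>{..<k}. ?g i j \<theta>)"
      by (subst mean_sum; (intro continuous_on_sum cont; simp)?; intro sum.cong refl)
         (subst mean_sum; (intro continuous_on_sum cont)?; simp)
    also have "\<dots> \<in> \<real>\<^sub>\<ge>\<^sub>0"
    proof (rule mean_nonneg_Reals)
      show "continuous_on {0..2 * pi} (\<lambda>\<theta>. \<Sum>i\<in>{..<k}. \<Sum>j\<in>{..<k}. ?g i j \<theta>)"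
        by (intro continuous_on_sum cont) auto
      show "(\<Sum>i\<in>{..<k}. \<Sum>j\<in>{..<k}. ?g i j \<theta>) \<in> \<real>\<^sub>\<ge>\<^sub>0" for \<theta>
      proof -
        have "block_psd {..<k} (\<lambda>i j. F i j (cis \<theta>))" using P by (simp add: CT_def)
        then show ?thesis
          unfolding cinner_sandwich block_psd_def
          by (elim allE[of _ "\<lambda>i. ?Q \<theta> *v x i"])
      qed
    qed
    finally show "(\<Sum>i\<in>{..<k}. \<Sum>j\<in>{..<k}. cinner (x i) (Phi_Q n V (F i j) *v x j)) \<in> \<real>\<^sub>\<ge>\<^sub>0" .
  qed
  have "Phi_Q n V (os_unit CT) = mat 1"
    using assms mean_Qpoly_gram[of n V] by (simp add: Phi_Q_mean CT_def isometry_def)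
  with lin pos show ?thesis by (auto simp: ucp_maps_CT_def ucp_map_def cp_map_def)
qed


section \<open>Peaked polynomials with all roots on the circle\<close>

text \<open>On the circle this is \<open>a + z ^ (2 * D + 1) * cnj a\<close>, for \<open>a\<close> of degree at most \<open>D\<close>. The exponent
  \<open>2 * D + 1\<close> keeps the frequencies of the two summands disjoint, so that their mean squares add.\<close>

definition self_inv :: "nat \<Rightarrow> complex poly \<Rightarrow> complex poly"
  where "self_inv D a = a + (\<Sum>k\<le>D. monom (cnj (coeff a k)) (2 * D + 1 - k))"

lemma coeff_self_inv:
  "coeff (self_inv D a) n =
    coeff a n + (if D < n \<and> n \<le> 2 * D + 1 then cnj (coeff a (2 * D + 1 - n)) else 0)"
proof -
  have "(\<Sum>k\<le>D. coeff (monom (cnj (coeff a k)) (2 * D + 1 - k)) n)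
      = (\<Sum>k\<le>D. if k = 2 * D + 1 - n \<and> D < n \<and> n \<le> 2 * D + 1 then cnj (coeff a k) else 0)"
    by (intro sum.cong) (auto simp: coeff_monom)
  also have "\<dots> = (if D < n \<and> n \<le> 2 * D + 1 then cnj (coeff a (2 * D + 1 - n)) else 0)"
    by (cases "D < n \<and> n \<le> 2 * D + 1") (auto simp: sum.delta')
  finally show ?thesis by (simp add: self_inv_def coeff_sum)
qed

text \<open>Complex conjugation limits linearity to real coefficients, which is why the scalars \<open>k\<^sub>j\<close> have to
  be real.\<close>

lemma self_inv_sum:
  "(\<Sum>j\<in>J. smult (complex_of_real (r j)) (self_inv D (a j))) = self_inv D (\<Sum>j\<in>J. smult (complex_of_real (r j)) (a j))"
proof (rule poly_eqI)
  fix n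
  show "coeff (\<Sum>j\<in>J. smult (complex_of_real (r j)) (self_inv D (a j))) n
      = coeff (self_inv D (\<Sum>j\<in>J. smult (complex_of_real (r j)) (a j))) n"
    by (cases "D < n \<and> n \<le> 2 * D + 1")
       (auto simp: coeff_self_inv coeff_sum sum.distrib distrib_left)
qed

lemma degree_self_inv_le:
  assumes "degree a \<le> D"
  shows "degree (self_inv D a) \<le> 2 * D + 1"
  using assms by (intro degree_le) (auto simp: coeff_self_inv coeff_eq_0)

lemma sum_coeff_self_inv:
  assumes "degree a \<le> D"
  shows "(\<Sum>i\<le>2 * D + 1. (cmod (coeff (self_inv D a) i))\<^sup>2) = 2 * (\<Sum>i\<le>D. (cmod (coeff a i))\<^sup>2)"
proof -
  let ?c = "\<lambda>i. (cmod (coeff (self_inv D a) i))\<^sup>2"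
  have "{..2 * D + 1} = {..D} \<union> {D + 1..2 * D + 1}" by auto
  then have "sum ?c {..2 * D + 1} = sum ?c {..D} + sum ?c {D + 1..2 * D + 1}"
    by (simp add: sum.union_disjoint)
  also have "sum ?c {..D} = (\<Sum>i\<le>D. (cmod (coeff a i))\<^sup>2)"
    by (intro sum.cong) (auto simp: coeff_self_inv)
  also have "sum ?c {D + 1..2 * D + 1} = (\<Sum>i\<le>D. (cmod (coeff a i))\<^sup>2)"
    by (rule sum.reindex_bij_witness[of _ "\<lambda>i. 2 * D + 1 - i" "\<lambda>i. 2 * D + 1 - i"])
       (use assms in \<open>auto simp: coeff_self_inv coeff_eq_0\<close>)
  finally show ?thesis by simp
qed

lemma poly_bounded_degree: "degree (a :: complex poly) \<le> D \<Longrightarrow> poly a z = (\<Sum>k\<le>D. coeff a k * z ^ k)"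
  unfolding poly_altdef by (rule sum.mono_neutral_left) (auto simp: coeff_eq_0)

lemma poly_self_inv:
  "poly (self_inv D a) z = poly a z + z * (\<Sum>k\<le>D. cnj (coeff a k) * z ^ (2 * D - k))"
proof -
  have "z ^ (2 * D + 1 - k) = z * z ^ (2 * D - k)" if "k \<le> D" for k
    using that by (simp add: Suc_diff_le)
  then show ?thesis
    by (simp add: self_inv_def poly_sum poly_monom sum_distrib_left mult_ac)
qed

lemma reversed_poly:
  assumes "degree a \<le> D" and "D \<le> N" and "z \<noteq> 0"
  shows "(\<Sum>k\<le>D. cnj (coeff a k) * z ^ (N - k)) = z ^ N * cnj (poly a (1 / cnj z))"
proof -
  have "z ^ (N - k) = z ^ N * (1 / z) ^ k" if "k \<le> D" for k
    using that assms by (simp add: power_diff field_simps)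
  then show ?thesis
    by (simp add: poly_bounded_degree[OF assms(1)] sum_distrib_left mult_ac)
qed

lemma inverse_cnj_circle: "z \<in> circle \<Longrightarrow> 1 / cnj z = z"
  using complex_norm_square[of z] by (auto simp: divide_simps)

lemma poly_self_inv_circle:
  assumes "degree a \<le> D" and "z \<in> circle"
  shows "poly (self_inv D a) z = poly a z + z ^ (2 * D + 1) * cnj (poly a z)"
proof -
  have "z \<noteq> 0" using assms(2) by auto
  then show ?thesis
    using reversed_poly[OF assms(1), of "2 * D" z] inverse_cnj_circle[OF assms(2)]
    by (simp add: poly_self_inv)
qed

text \<open>The roots are symmetric under reflection in the circle.\<close>

lemma poly_self_inv_reflect:
  assumes "degree a \<le> D" and "z \<noteq> 0"
  shows "poly (self_inv D a) z = z ^ (2 * D + 1) * cnj (poly (self_inv D a) (1 / cnj z))"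
proof -
  have eq: "poly (self_inv D a) z = poly a z + z ^ (2 * D + 1) * cnj (poly a (1 / cnj z))" if "z \<noteq> 0" for z
    using reversed_poly[OF assms(1), of "2 * D" z] that by (simp add: poly_self_inv)
  show ?thesis
  proof -
    define M where "M = 2 * D + 1"
    define w where "w = 1 / cnj z"
    have w: "w \<noteq> 0" "1 / cnj w = z" "cnj w = 1 / z" using assms(2) by (auto simp: w_def)
    have "cnj (poly (self_inv D a) w) = cnj (poly a w) + (1 / z) ^ M * poly a z"
      using arg_cong[OF eq[OF w(1)], of cnj] unfolding w(2) by (simp add: w(3) M_def)
    moreover have "z ^ M * (1 / z) ^ M = 1"
      using assms(2) by (simp flip: power_mult_distrib)
    ultimately have "z ^ M * cnj (poly (self_inv D a) w) = z ^ M * cnj (poly a w) + poly a z"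
      by (simp add: distrib_left flip: mult.assoc)
    then show ?thesis using eq[OF assms(2)] by (simp only: M_def w_def add.commute)
  qed
qed

text \<open>A polynomial whose real part is positive on the circle has positive real part on the disc,
  so it has no root there. By the maximum modulus principle the second summand of
  \<^const>\<open>self_inv\<close> is then strictly smaller than \<open>a\<close> inside the disc, which excludes roots there,
  and the reflection symmetry excludes roots outside.\<close>

lemma self_inv_roots:
  assumes deg: "degree a \<le> D" and "\<delta> > 0" and Re: "\<And>z. z \<in> circle \<Longrightarrow> Re (poly a z) \<ge> \<delta>"
  shows "degree (self_inv D a) = 2 * D + 1" and "poly (self_inv D a) z = 0 \<Longrightarrow> z \<in> circle"
proof -
  \<comment> \<open>The maximum principle for real parts, by way of \<open>\<bar>exp (- a)\<bar> = exp (- Re a)\<close>.\<close>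
  have Re_disc: "Re (poly a z) \<ge> \<delta>" if "z \<in> cball 0 1" for z
  proof -
    have "norm (exp (- poly a z)) \<le> exp (- \<delta>)"
    proof (rule maximum_modulus_frontier[of "\<lambda>z. exp (- poly a z)" "cball 0 1"])
      show "(\<lambda>z. exp (- poly a z)) holomorphic_on interior (cball 0 1)"
        by (intro holomorphic_intros)
      show "continuous_on (closure (cball 0 1)) (\<lambda>z. exp (- poly a z))"
        by (intro continuous_intros)
    qed (use Re that in auto)
    then show ?thesis by simp
  qed
  have a0: "poly a z \<noteq> 0" if "z \<in> cball 0 1" for z
    using Re_disc[OF that] \<open>\<delta> > 0\<close> by auto
  \<comment> \<open>The second summand of \<^const>\<open>self_inv\<close> is \<open>z * b z\<close>; the split factor \<open>z\<close> makes the
    comparison strict inside the disc.\<close>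
  define b where "b z = (\<Sum>k\<le>D. cnj (coeff a k) * z ^ (2 * D - k))" for z
  have ba: "norm (b z / poly a z) \<le> 1" if "z \<in> cball 0 1" for z
  proof (rule maximum_modulus_frontier[of "\<lambda>z. b z / poly a z" "cball 0 1"])
    show "(\<lambda>z. b z / poly a z) holomorphic_on interior (cball 0 1)"
      unfolding b_def using a0 by (intro holomorphic_intros) auto
    show "continuous_on (closure (cball 0 1)) (\<lambda>z. b z / poly a z)"
      unfolding b_def using a0 by (intro continuous_intros) auto
    show "norm (b z / poly a z) \<le> 1" if "z \<in> frontier (cball 0 1)" for z
    proof -
      have "z \<in> circle" "z \<noteq> 0" using that by auto
      then have "b z = z ^ (2 * D) * cnj (poly a z)"
        using reversed_poly[OF deg, of "2 * D" z] inverse_cnj_circle[of z] by (auto simp: b_def)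
      then show ?thesis
        using \<open>z \<in> circle\<close> by (simp add: norm_mult norm_divide norm_power)
    qed
  qed (use that in auto)
  have inside: "poly (self_inv D a) z \<noteq> 0" if "norm z < 1" for z
  proof
    assume "poly (self_inv D a) z = 0"
    then have "poly a z = - (z * b z)" by (simp add: poly_self_inv b_def add_eq_0_iff2)
    then have "norm (poly a z) = norm z * norm (b z)" by (simp add: norm_mult)
    moreover have "norm (b z) \<le> norm (poly a z)" "norm (poly a z) > 0"
      using ba[of z] a0[of z] that by (auto simp: norm_divide divide_simps split: if_splits)
    ultimately show False
      using mult_left_mono[of "norm (b z)" "norm (poly a z)" "norm z"]
        mult_strict_right_mono[OF that, of "norm (poly a z)"] by simp
  qed
  have "poly a 0 \<noteq> 0" by (rule a0) simp
  then have "coeff (self_inv D a) (2 * D + 1) \<noteq> 0"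
    using deg by (simp add: coeff_self_inv coeff_eq_0 poly_0_coeff_0)
  then have "2 * D + 1 \<le> degree (self_inv D a)" by (rule le_degree)
  then show "degree (self_inv D a) = 2 * D + 1"
    using degree_self_inv_le[OF deg] by simp
  assume root: "poly (self_inv D a) z = 0"
  have "\<not> norm z > 1"
  proof
    assume z: "norm z > 1"
    then have "z \<noteq> 0" by auto
    then have "poly (self_inv D a) (1 / cnj z) = 0"
      using poly_self_inv_reflect[OF deg, of z] root by simp
    moreover have "norm (1 / cnj z) < 1" using z by (simp add: norm_divide divide_less_eq_1)
    ultimately show False using inside by blast
  qed
  moreover have "\<not> norm z < 1" using inside root by blast
  ultimately show "z \<in> circle" by simp
qed

text \<open>The analytic half of the Fejer kernel centred at \<open>w\<close>, written as a sum of geometric sums.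
  Its \<open>k\<close>-th coefficient is \<open>(D + 1 - k) * cnj w ^ k\<close>.\<close>

definition half_fejer :: "nat \<Rightarrow> complex \<Rightarrow> complex poly"
  where "half_fejer D w = (\<Sum>n\<le>D. \<Sum>k\<le>n. monom (cnj w ^ k) k)"

lemma poly_half_fejer: "poly (half_fejer D w) z = (\<Sum>n\<le>D. \<Sum>k\<le>n. (cnj w * z) ^ k)"
  by (simp add: half_fejer_def poly_sum poly_monom power_mult_distrib)

lemma degree_half_fejer: "degree (half_fejer D w) \<le> D"
  unfolding half_fejer_def
  by (intro degree_sum_le finite_atMost) (auto intro: order_trans[OF degree_monom_le])

lemma coeff_half_fejer:
  assumes "k \<le> D"
  shows "coeff (half_fejer D w) k = of_nat (D + 1 - k) * cnj w ^ k"
proof -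
  have "coeff (half_fejer D w) k = (\<Sum>n\<le>D. if k \<le> n then cnj w ^ k else 0)"
    unfolding half_fejer_def coeff_sum coeff_monom by (intro sum.cong refl) (auto simp: sum.delta)
  also have "\<dots> = (\<Sum>n\<in>{k..D}. cnj w ^ k)"
    by (intro sum.mono_neutral_cong_right) auto
  finally show ?thesis using assms by simp
qed

text \<open>Up to the constant \<open>D + 1\<close>, twice the real part is the Fejer kernel, a square. This gives the
  positive lower bound that \<open>self_inv_roots\<close> requires.\<close>

lemma Re_half_fejer:
  assumes "cmod u = 1"
  shows "2 * Re (\<Sum>n\<le>D. \<Sum>k\<le>n. u ^ k) = real D + 1 + (cmod (\<Sum>k\<le>D. u ^ k))\<^sup>2"
proof (induction D)
  case (Suc D)
  define S where "S = (\<Sum>k\<le>D. u ^ k)"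
  have S': "(\<Sum>k\<le>Suc D. u ^ k) = 1 + u * S"
    unfolding S_def sum.atMost_Suc_shift by (simp add: sum_distrib_left)
  have "(cmod (1 + u * S))\<^sup>2 = 1 + 2 * Re (u * S) + (cmod (u * S))\<^sup>2"
    unfolding cmod_power2 by (simp add: power2_eq_square algebra_simps)
  also have "(cmod (u * S))\<^sup>2 = (cmod S)\<^sup>2" using assms by (simp add: norm_mult)
  finally have "(cmod (1 + u * S))\<^sup>2 = 1 + 2 * Re (u * S) + (cmod S)\<^sup>2" .
  moreover have "(\<Sum>n\<le>Suc D. \<Sum>k\<le>n. u ^ k) = (\<Sum>n\<le>D. \<Sum>k\<le>n. u ^ k) + (1 + u * S)"
    by (simp only: sum.atMost_Suc[of "\<lambda>n. \<Sum>k\<le>n. u ^ k"] S')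
  moreover define H where "H = (\<Sum>n\<le>D. \<Sum>k\<le>n. u ^ k)"
  ultimately show ?case using Suc.IH unfolding S' S_def[symmetric]
    by (simp del: times_complex.sel sum.atMost_Suc)
qed simp

text \<open>Multiplication by \<open>1 - u\<close> telescopes every geometric sum. The bound is of order \<open>D\<close>, whereas
  the root mean square is of order \<open>D ^ (3 / 2)\<close>, by \<open>sum_squares_ge\<close>: this is the concentration.\<close>

lemma half_fejer_peak:
  assumes "cmod u = 1"
  shows "cmod (\<Sum>n\<le>D. \<Sum>k\<le>n. u ^ k) * cmod (1 - u) \<le> 2 * (real D + 1)"
proof -
  have "cmod (\<Sum>n\<le>D. \<Sum>k\<le>n. u ^ k) * cmod (1 - u) = cmod (\<Sum>n\<le>D. 1 - u ^ Suc n)"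
  proof -
    have "(\<Sum>k\<le>n. u ^ k) * (1 - u) = 1 - u ^ Suc n" for n
      by (simp only: one_diff_power_eq lessThan_Suc_atMost mult.commute)
    then have "(\<Sum>n\<le>D. \<Sum>k\<le>n. u ^ k) * (1 - u) = (\<Sum>n\<le>D. 1 - u ^ Suc n)"
      by (subst sum_distrib_right) (simp only:)
    then show ?thesis by (simp only: norm_mult[symmetric])
  qed
  also have "\<dots> \<le> (\<Sum>n\<le>D. 2)"
  proof (rule order_trans[OF norm_sum], intro sum_mono)
    show "cmod (1 - u ^ Suc n) \<le> 2" for n
      using norm_triangle_ineq4[of 1 "u ^ Suc n"] assms by (simp add: norm_power norm_mult)
  qed
  finally show ?thesis by simp
qed

lemma sum_squares_ge: "(real D + 1) ^ 3 \<le> 3 * (\<Sum>k\<le>D. (real (D + 1 - k))\<^sup>2)"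
proof -
  have "(\<Sum>k\<le>D. (real (D + 1 - k))\<^sup>2) = (\<Sum>k\<le>D. (real (k + 1))\<^sup>2)"
    by (rule sum.reindex_bij_witness[of _ "\<lambda>k. D - k" "\<lambda>k. D - k"]) (auto simp: Suc_diff_le)
  moreover have "(real D + 1) ^ 3 \<le> 3 * (\<Sum>k\<le>D. (real (k + 1))\<^sup>2)"
    by (induction D) (auto simp: power2_eq_square power3_eq_cube algebra_simps)
  ultimately show ?thesis by simp
qed

text \<open>The polynomials are the normalized \<open>self_inv D (half_fejer D w)\<close>. Their quality as peaks is
  measured by \<open>\<tau>\<close>, uniformly in \<open>w\<close>, and is of order \<open>D ^ (- 1 / 2)\<close>.\<close>

lemma peaked_polynomials:
  fixes \<tau> :: real
  assumes "\<tau> > 0"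
  shows "\<exists>M (g :: complex \<Rightarrow> complex poly).
    (\<forall>w\<in>circle. degree (g w) \<le> M) \<and>
    (\<forall>w\<in>circle. mean (\<lambda>\<theta>. (cmod (poly (g w) (cis \<theta>)))\<^sup>2) = 1) \<and>
    (\<forall>w\<in>circle. \<forall>z\<in>circle. cmod (poly (g w) z) * dist z w \<le> \<tau>) \<and>
    (\<forall>J (k :: 'j \<Rightarrow> real) w. finite J \<and> (\<forall>j\<in>J. w j \<in> circle \<and> k j \<ge> 0) \<and> (\<exists>j\<in>J. k j > 0) \<longrightarrow>
       degree (\<Sum>j\<in>J. smult (complex_of_real (k j)) (g (w j))) = M \<and>
       (\<forall>z. poly (\<Sum>j\<in>J. smult (complex_of_real (k j)) (g (w j))) z = 0 \<longrightarrow> z \<in> circle))"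
proof -
  obtain D :: nat where D: "24 / \<tau>\<^sup>2 < real D"
    using reals_Archimedean2 by blast
  define N where "N = (\<Sum>k\<le>D. (real (D + 1 - k))\<^sup>2)"
  define c where "c = 1 / sqrt (2 * N)"
  define g where "g w = smult (complex_of_real c) (self_inv D (half_fejer D w))" for w
  have N: "(real D + 1) ^ 3 \<le> 3 * N" unfolding N_def by (rule sum_squares_ge)
  have "0 < (real D + 1) ^ 3" by simp
  then have N0: "N > 0" using N by linarith
  then have c0: "c > 0" and c2: "c\<^sup>2 = 1 / (2 * N)" by (auto simp: c_def power_divide)
  have deg: "degree (g w) \<le> 2 * D + 1" for w
    unfolding g_def by (rule order_trans[OF degree_smult_le degree_self_inv_le[OF degree_half_fejer]])
  have norm1: "mean (\<lambda>\<theta>. (cmod (poly (g w) (cis \<theta>)))\<^sup>2) = 1" if w: "w \<in> circle" for w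
  proof -
    have "(\<Sum>i\<le>degree (g w). (cmod (coeff (g w) i))\<^sup>2) = (\<Sum>i\<le>2 * D + 1. (cmod (coeff (g w) i))\<^sup>2)"
      using deg[of w] by (intro sum.mono_neutral_left) (auto simp: coeff_eq_0)
    also have "\<dots> = c\<^sup>2 * (\<Sum>i\<le>2 * D + 1. (cmod (coeff (self_inv D (half_fejer D w)) i))\<^sup>2)"
      by (simp only: g_def coeff_smult norm_mult power_mult_distrib sum_distrib_left norm_of_real power2_abs)
    also have "\<dots> = c\<^sup>2 * (2 * (\<Sum>i\<le>D. (cmod (coeff (half_fejer D w) i))\<^sup>2))"
      by (simp only: sum_coeff_self_inv[OF degree_half_fejer])
    also have "(\<Sum>i\<le>D. (cmod (coeff (half_fejer D w) i))\<^sup>2) = N"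
    proof -
      have "cmod w = 1" using w by simp
      then have "cmod (coeff (half_fejer D w) i) = real (D + 1 - i)" if "i \<le> D" for i
        by (simp only: coeff_half_fejer[OF that] norm_mult norm_power norm_of_nat complex_mod_cnj
            power_one mult_1_right)
      then show ?thesis unfolding N_def by (intro sum.cong refl) auto
    qed
    finally show ?thesis using c2 N0 by (simp add: mean_poly_norm_sq)
  qed
  have peak: "cmod (poly (g w) z) * cmod (z - w) \<le> \<tau>" if w: "w \<in> circle" and z: "z \<in> circle" for w z
  proof -
    define u where "u = cnj w * z"
    have u: "cmod u = 1" using w z by (simp add: u_def norm_mult)
    have zw: "cmod (z - w) = cmod (1 - u)"
    proof -
      have "1 - u = cnj w * (w - z)"
        using w complex_norm_square[of w] by (simp add: u_def algebra_simps)
      then show ?thesis using w by (simp add: norm_mult norm_minus_commute)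
    qed
    let ?a = "poly (half_fejer D w) z"
    have "cmod (poly (g w) z) \<le> c * (2 * cmod ?a)"
    proof -
      have "cmod (?a + z ^ (2 * D + 1) * cnj ?a) \<le> cmod ?a + cmod ?a"
        using z norm_triangle_ineq[of ?a "z ^ (2 * D + 1) * cnj ?a"] by (simp add: norm_mult norm_power)
      then show ?thesis
        using c0 by (simp add: g_def poly_self_inv_circle[OF degree_half_fejer z] norm_mult del: power_Suc)
    qed
    from mult_right_mono[OF this norm_ge_zero[of "1 - u"]]
    have "cmod (poly (g w) z) * cmod (z - w) \<le> 2 * c * (cmod ?a * cmod (1 - u))"
      by (simp add: zw mult_ac)
    also have "\<dots> \<le> 2 * c * (2 * (real D + 1))"
      using half_fejer_peak[OF u, of D] c0 by (intro mult_left_mono) (auto simp: poly_half_fejer u_def)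
    also have "\<dots> \<le> \<tau>"
    proof (rule power2_le_imp_le)
      have "(2 * c * (2 * (real D + 1)))\<^sup>2 = 16 * (real D + 1)\<^sup>2 * c\<^sup>2"
        by (simp add: power2_eq_square algebra_simps)
      also have "\<dots> = 8 * (real D + 1)\<^sup>2 / N" by (simp add: c2)
      also have "\<dots> \<le> 8 * (real D + 1)\<^sup>2 / ((real D + 1) ^ 3 / 3)"
        using N by (intro divide_left_mono) (auto intro!: mult_pos_pos N0)
      also have "\<dots> = 24 / (real D + 1)"
        by (simp add: power2_eq_square power3_eq_cube divide_simps)
      also have "\<dots> \<le> \<tau>\<^sup>2"
      proof -
        have "24 < real D * \<tau>\<^sup>2" using D assms by (simp add: divide_simps split: if_splits)
        then show ?thesis using assms by (simp add: divide_simps algebra_simps add_increasing)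
      qed
      finally show "(2 * c * (2 * (real D + 1)))\<^sup>2 \<le> \<tau>\<^sup>2" .
    qed (use assms in simp)
    finally show ?thesis .
  qed
  have comb: "degree (\<Sum>j\<in>J. smult (complex_of_real (k j)) (g (w j))) = 2 * D + 1 \<and>
       (\<forall>z. poly (\<Sum>j\<in>J. smult (complex_of_real (k j)) (g (w j))) z = 0 \<longrightarrow> z \<in> circle)"
    if J: "finite J" and wk: "\<And>j. j \<in> J \<Longrightarrow> w j \<in> circle \<and> k j \<ge> 0" and ex: "\<exists>j\<in>J. k j > 0"
    for J and k :: "'j \<Rightarrow> real" and w
  proof -
    define a where "a = (\<Sum>j\<in>J. smult (complex_of_real (k j * c)) (half_fejer D (w j)))"
    have eq: "(\<Sum>j\<in>J. smult (complex_of_real (k j)) (g (w j))) = self_inv D a"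
      unfolding a_def self_inv_sum[symmetric] g_def by simp
    have dega: "degree a \<le> D"
      unfolding a_def using J by (intro degree_sum_le order_trans[OF degree_smult_le degree_half_fejer])
    define \<delta> where "\<delta> = (\<Sum>j\<in>J. k j * c * ((real D + 1) / 2))"
    obtain j0 where "j0 \<in> J" "k j0 > 0" using ex by blast
    then have "\<delta> > 0"
      unfolding \<delta>_def using wk c0 J by (intro sum_pos2[of J j0]) auto
    moreover have "Re (poly a z) \<ge> \<delta>" if z: "z \<in> circle" for z
    proof -
      have "Re (poly (half_fejer D (w j)) z) \<ge> (real D + 1) / 2" if "j \<in> J" for j
      proof -
        have "cmod (cnj (w j) * z) = 1" using wk[OF that] z by (simp add: norm_mult)
        from Re_half_fejer[OF this, of D]
        have "2 * Re (poly (half_fejer D (w j)) z) = real D + 1 + (cmod (\<Sum>k\<le>D. (cnj (w j) * z) ^ k))\<^sup>2"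
          by (simp only: poly_half_fejer)
        then have "real D + 1 \<le> 2 * Re (poly (half_fejer D (w j)) z)" by (simp only:) simp
        then show ?thesis by simp
      qed
      then have "\<delta> \<le> (\<Sum>j\<in>J. k j * c * Re (poly (half_fejer D (w j)) z))"
        unfolding \<delta>_def using wk c0 by (intro sum_mono mult_left_mono) auto
      then show ?thesis by (simp add: a_def poly_sum)
    qed
    ultimately show ?thesis unfolding eq using self_inv_roots[OF dega] by blast
  qed
  have 1: "\<forall>w\<in>circle. degree (g w) \<le> 2 * D + 1" using deg by blast
  have 2: "\<forall>w\<in>circle. mean (\<lambda>\<theta>. (cmod (poly (g w) (cis \<theta>)))\<^sup>2) = 1" using norm1 by blast
  have 3: "\<forall>w\<in>circle. \<forall>z\<in>circle. cmod (poly (g w) z) * dist z w \<le> \<tau>"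
    using peak unfolding dist_norm by blast
  have 4: "\<forall>J (k :: 'j \<Rightarrow> real) w. finite J \<and> (\<forall>j\<in>J. w j \<in> circle \<and> k j \<ge> 0) \<and> (\<exists>j\<in>J. k j > 0) \<longrightarrow>
       degree (\<Sum>j\<in>J. smult (complex_of_real (k j)) (g (w j))) = 2 * D + 1 \<and>
       (\<forall>z. poly (\<Sum>j\<in>J. smult (complex_of_real (k j)) (g (w j))) z = 0 \<longrightarrow> z \<in> circle)"
    by (intro allI impI, rule comb) auto
  show ?thesis by (intro exI conjI) (fact 1 2 3 4)+
qed


section \<open>Polynomials dominated on the circle\<close>

lemma circle_islimpt:
  assumes "z \<in> circle"
  shows "z islimpt circle"
proof (rule connected_imp_perfect[OF _ assms])
  show "connected circle" by (rule connected_sphere) simp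
  have "1 \<in> circle" "-1 \<in> circle" "(1::complex) \<noteq> -1" by auto
  then show "circle \<noteq> {a}" for a by (metis singletonD)
qed

lemma infinite_circle: "infinite circle"
  using circle_islimpt[of 1] islimpt_finite by auto

lemma poly_eq_on_circle:
  assumes "finite E" and "\<And>z. z \<in> circle - E \<Longrightarrow> poly p z = poly q z"
  shows "p = q"
proof (rule ccontr)
  assume "p \<noteq> q"
  then have "finite {z. poly (p - q) z = 0}" by (intro poly_roots_finite) simp
  moreover have "circle - E \<subseteq> {z. poly (p - q) z = 0}" using assms(2) by auto
  ultimately have "finite (circle - E)" using finite_subset by blast
  then show False using assms(1) infinite_circle by simp
qed

text \<open>Each root of \<open>s\<close> is a root of \<open>p\<close>, and dividing both sides by the common linear factor
  preserves the inequality, by continuity also at the root itself.\<close>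

lemma dvd_of_le_on_circle:
  fixes p s :: "complex poly"
  assumes "\<And>z. z \<in> circle \<Longrightarrow> cmod (poly p z) \<le> cmod (poly s z)"
    and "\<And>z. poly s z = 0 \<Longrightarrow> z \<in> circle"
  shows "s dvd p"
  using assms
proof (induction "degree s" arbitrary: s p)
  case 0
  then obtain c where c: "s = [:c:]" using degree_eq_zeroE by metis
  have "c \<noteq> 0" using 0(3)[of 0] c by auto
  then show ?case using c by (simp add: is_unit_iff_degree is_unit_triv unit_imp_dvd)
next
  case (Suc d)
  then obtain \<alpha> where \<alpha>: "poly s \<alpha> = 0" 
    using alg_closed_imp_poly_has_root[of s] by auto
  then have "\<alpha> \<in> circle" using Suc.prems by blast
  with Suc.prems(1)[of \<alpha>] \<alpha> have "poly p \<alpha> = 0" by simp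
  then obtain p1 where p1: "p = [:-\<alpha>, 1:] * p1" unfolding poly_eq_0_iff_dvd by (elim dvdE)
  obtain s1 where s1: "s = [:-\<alpha>, 1:] * s1" using \<alpha> unfolding poly_eq_0_iff_dvd by (elim dvdE)
  have "s1 \<noteq> 0" using s1 Suc.hyps(2) by auto
  then have "degree s = degree [:-\<alpha>, 1:] + degree s1"
    unfolding s1 by (intro degree_mult_eq) auto
  then have deg: "degree s1 = d" using Suc.hyps(2) by simp
  have off: "cmod (poly p1 z) \<le> cmod (poly s1 z)" if "z \<in> circle" "z \<noteq> \<alpha>" for z
    using Suc.prems(1)[OF that(1)] that(2) unfolding p1 s1
    by (simp add: norm_mult flip: left_diff_distrib mult.assoc)
  have "cmod (poly p1 \<alpha>) \<le> cmod (poly s1 \<alpha>)"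
  proof (rule tendsto_le)
    show "\<not> trivial_limit (at \<alpha> within circle)"
      using circle_islimpt[OF \<open>\<alpha> \<in> circle\<close>] by (simp add: trivial_limit_within)
    show "((\<lambda>z. cmod (poly s1 z)) \<longlongrightarrow> cmod (poly s1 \<alpha>)) (at \<alpha> within circle)"
      "((\<lambda>z. cmod (poly p1 z)) \<longlongrightarrow> cmod (poly p1 \<alpha>)) (at \<alpha> within circle)"
      by (intro tendsto_intros)+
    show "\<forall>\<^sub>F z in at \<alpha> within circle. cmod (poly p1 z) \<le> cmod (poly s1 z)"
      using off by (auto simp: eventually_at_filter)
  qed
  then have "s1 dvd p1"
    using off Suc.prems(2) by (intro Suc.hyps(1)) (auto simp: deg s1)
  then show ?case unfolding p1 s1 by (intro mult_dvd_mono) auto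
qed

section \<open>Block Toeplitz matrices and Choi matrices\<close>

lemma clinear_map_sum:
  assumes lin: "clinear_map S \<phi>"
    and closed: "\<And>a b f g. f \<in> os_carrier S \<Longrightarrow> g \<in> os_carrier S \<Longrightarrow> (\<lambda>x. a *\<^sub>C f x + b *\<^sub>C g x) \<in> os_carrier S"
    and zero: "(\<lambda>x. 0) \<in> os_carrier S"
    and "finite I" and "\<And>i. i \<in> I \<Longrightarrow> f i \<in> os_carrier S"
  shows "(\<lambda>x. \<Sum>i\<in>I. c i *\<^sub>C f i x) \<in> os_carrier S
    \<and> \<phi> (\<lambda>x. \<Sum>i\<in>I. c i *\<^sub>C f i x) = (\<Sum>i\<in>I. c i *\<^sub>C \<phi> (f i))"
  using assms(4,5)
proof (induction I rule: finite_induct)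
  case empty
  have "\<phi> (\<lambda>x. 0 *\<^sub>C 0 + 0 *\<^sub>C 0) = 0 *\<^sub>C \<phi> (\<lambda>x. 0) + 0 *\<^sub>C \<phi> (\<lambda>x. 0)"
    using lin[unfolded clinear_map_def, rule_format, OF zero zero, of 0 0] by simp
  then show ?case using zero by (simp add: cscale_simps)
next
  case (insert i I)
  let ?g = "\<lambda>x. \<Sum>i\<in>I. c i *\<^sub>C f i x"
  have IH: "?g \<in> os_carrier S" "\<phi> ?g = (\<Sum>i\<in>I. c i *\<^sub>C \<phi> (f i))" and fi: "f i \<in> os_carrier S"
    using insert by auto
  have eq: "(\<lambda>x. \<Sum>i\<in>insert i I. c i *\<^sub>C f i x) = (\<lambda>x. c i *\<^sub>C f i x + 1 *\<^sub>C ?g x)"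
    using insert.hyps by (simp add: cscale_simps)
  have "\<phi> (\<lambda>x. c i *\<^sub>C f i x + 1 *\<^sub>C ?g x) = c i *\<^sub>C \<phi> (f i) + 1 *\<^sub>C \<phi> ?g"
    using lin[unfolded clinear_map_def, rule_format, OF fi IH(1), of "c i" 1] by simp
  then show ?case
    unfolding eq using closed[OF fi IH(1), of "c i" 1] IH(2) insert.hyps by (simp add: cscale_simps)
qed

lemma toeplitz_lincomb:
  assumes "f \<in> os_carrier (toeplitz n)" "g \<in> os_carrier (toeplitz n)"
  shows "(\<lambda>x. a *\<^sub>C f x + b *\<^sub>C g x) \<in> os_carrier (toeplitz n)"
proof -
  obtain \<tau> \<sigma> where "\<And>i j. f (i, j) = (if i \<in> {1..n} \<and> j \<in> {1..n} then \<tau> (int i - int j) else 0)"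
    "\<And>i j. g (i, j) = (if i \<in> {1..n} \<and> j \<in> {1..n} then \<sigma> (int i - int j) else 0)"
    using assms by (auto simp: toeplitz_def)
  then show ?thesis
    by (auto simp: toeplitz_def cscale_simps intro!: exI[of _ "\<lambda>k. a *\<^sub>C \<tau> k + b *\<^sub>C \<sigma> k"])
qed

lemma toeplitz_zero: "(\<lambda>x. 0) \<in> os_carrier (toeplitz n)"
  by (auto simp: toeplitz_def intro!: exI[of _ "\<lambda>k. 0"])

lemma toeplitz_sum:
  assumes "clinear_map (toeplitz n) \<phi>" and "finite I" and "\<And>i. i \<in> I \<Longrightarrow> f i \<in> os_carrier (toeplitz n)"
  shows "\<phi> (\<lambda>x. \<Sum>i\<in>I. c i *\<^sub>C f i x) = (\<Sum>i\<in>I. c i *\<^sub>C \<phi> (f i))"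
  using clinear_map_sum[where S = "toeplitz n" and c = c, OF assms(1) toeplitz_lincomb toeplitz_zero assms(2)] assms(3)
  by blast

definition shift :: "nat \<Rightarrow> int \<Rightarrow> 'm::finite cmat \<Rightarrow> nat \<times> nat \<Rightarrow> 'm cmat"
  where "shift n k A = (\<lambda>(i, j). if i \<in> {1..n} \<and> j \<in> {1..n} \<and> int i - int j = k then A else 0)"

text \<open>For \<open>z\<close> on the circle this is the tensor product of \<open>A\<close> with the positive rank-one Toeplitz matrix
  whose entries are \<open>z ^ (i - j)\<close>. A linear map on the operator system turns these matrices into a trigonometric
  polynomial in \<open>z\<close>, whose coefficients are its values on the shifts.\<close>

definition phase_toeplitz :: "nat \<Rightarrow> complex \<Rightarrow> 'm::finite cmat \<Rightarrow> nat \<times> nat \<Rightarrow> 'm cmat"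
  where "phase_toeplitz n z A =
    (\<lambda>(i, j). if i \<in> {1..n} \<and> j \<in> {1..n} then (z ^ i * cnj z ^ j) *\<^sub>C A else 0)"

definition matrix_unit :: "'m \<Rightarrow> 'm \<Rightarrow> 'm::finite cmat"
  where "matrix_unit a b = (\<chi> i j. if i = a \<and> j = b then 1 else 0)"

lemma matrix_unit_nth: "matrix_unit a b $ i $ j = (if i = a \<and> j = b then 1 else 0)"
  by (simp add: matrix_unit_def)

lemma matrix_unit_decomposition:
  fixes A :: "'m::finite cmat"
  shows "(\<Sum>ab\<in>UNIV. A $ fst ab $ snd ab *\<^sub>C matrix_unit (fst ab) (snd ab)) = A"
proof -
  have "(\<Sum>ab\<in>UNIV. A $ fst ab $ snd ab *\<^sub>C matrix_unit (fst ab) (snd ab)) $ i $ j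
      = (\<Sum>ab\<in>UNIV. if ab = (i, j) then A $ i $ j else 0)" for i j
    unfolding sum_component by (intro sum.cong) (auto simp: matrix_unit_nth)
  then show ?thesis by (simp add: vec_eq_iff)
qed

lemma shift_in_toeplitz: "shift n k A \<in> os_carrier (toeplitz n)"
  by (auto simp: toeplitz_def shift_def intro!: exI[of _ "\<lambda>l. if l = k then A else 0"])

lemma toeplitz_eq_sum_shift:
  assumes "T \<in> os_carrier (toeplitz n)"
  obtains \<tau> where "T = (\<lambda>x. \<Sum>k\<in>{- int (n - 1)..int (n - 1)}. 1 *\<^sub>C shift n k (\<tau> k) x)"
proof -
  obtain \<tau> where \<tau>: "\<And>i j. T (i, j) = (if i \<in> {1..n} \<and> j \<in> {1..n} then \<tau> (int i - int j) else 0)"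
    using assms by (auto simp: toeplitz_def)
  have "T (i, j) = (\<Sum>k\<in>{- int (n - 1)..int (n - 1)}. 1 *\<^sub>C shift n k (\<tau> k) (i, j))" for i j
  proof -
    have "(\<Sum>k\<in>{- int (n - 1)..int (n - 1)}. 1 *\<^sub>C shift n k (\<tau> k) (i, j))
      = (\<Sum>k\<in>{- int (n - 1)..int (n - 1)}. if k = int i - int j then (if i \<in> {1..n} \<and> j \<in> {1..n} then \<tau> k else 0) else 0)"
      by (intro sum.cong) (auto simp: shift_def cscale_simps)
    also have "\<dots> = T (i, j)" by (auto simp: \<tau> sum.delta')
    finally show ?thesis by simp
  qed
  then have "T = (\<lambda>x. \<Sum>k\<in>{- int (n - 1)..int (n - 1)}. 1 *\<^sub>C shift n k (\<tau> k) x)" by auto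
  then show thesis using that by blast
qed

lemma shift_eq_sum_units:
  "shift n k A = (\<lambda>x. \<Sum>ab\<in>UNIV. A $ fst ab $ snd ab *\<^sub>C shift n k (matrix_unit (fst ab) (snd ab)) x)"
proof
  fix x
  show "shift n k A x = (\<Sum>ab\<in>UNIV. A $ fst ab $ snd ab *\<^sub>C shift n k (matrix_unit (fst ab) (snd ab)) x)"
  proof (cases "shift n k (mat 1 :: 'a cmat) x = 0")
    case True
    then have "shift n k B x = 0" for B :: "'a cmat"
      by (auto simp: shift_def mat_def vec_eq_iff split: prod.splits if_splits)
    then show ?thesis by (simp add: cscale_simps)
  next
    case False
    then have "shift n k B x = B" for B :: "'a cmat"
      by (auto simp: shift_def split: prod.splits if_splits)
    then show ?thesis by (simp add: matrix_unit_decomposition)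
  qed
qed

text \<open>The index \<open>d\<close> is the diagonal \<open>d - (n - 1)\<close>; the factor \<open>z ^ (n - 1)\<close> makes
  the exponents natural numbers.\<close>

lemma phase_toeplitz_sum_shift:
  assumes "z \<in> circle"
  shows "(\<lambda>x. z ^ (n - 1) *\<^sub>C phase_toeplitz n z A x)
    = (\<lambda>x. \<Sum>d\<in>{..2 * (n - 1)}. z ^ d *\<^sub>C shift n (int d - int (n - 1)) A x)"
proof (rule ext, clarify)
  fix i j
  show "z ^ (n - 1) *\<^sub>C phase_toeplitz n z A (i, j)
    = (\<Sum>d\<in>{..2 * (n - 1)}. z ^ d *\<^sub>C shift n (int d - int (n - 1)) A (i, j))"
  proof (cases "i \<in> {1..n} \<and> j \<in> {1..n}")
    case True
    have zz: "z * cnj z = 1" using assms complex_norm_square[of z] by simp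
    have "z ^ (n - 1) * z ^ i = z ^ (n - 1 + i - j) * z ^ j"
      using True by (simp flip: power_add)
    then have "z ^ (n - 1) * (z ^ i * cnj z ^ j) = z ^ (n - 1 + i - j) * (z * cnj z) ^ j"
      by (simp add: power_mult_distrib flip: mult.assoc)
    then have 1: "z ^ (n - 1) *\<^sub>C phase_toeplitz n z A (i, j) = z ^ (n - 1 + i - j) *\<^sub>C A"
      using True by (simp add: phase_toeplitz_def cscale_simps zz)
    have "(\<Sum>d\<in>{..2 * (n - 1)}. z ^ d *\<^sub>C shift n (int d - int (n - 1)) A (i, j))
      = (\<Sum>d\<in>{..2 * (n - 1)}. if d = n - 1 + i - j then z ^ d *\<^sub>C A else 0)"
      using True by (intro sum.cong) (auto simp: shift_def cscale_simps)
    also have "\<dots> = z ^ (n - 1 + i - j) *\<^sub>C A"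
      using True by (subst sum.delta) auto
    finally show ?thesis using 1 by simp
  qed (auto simp: phase_toeplitz_def shift_def cscale_simps)
qed

lemma phase_toeplitz_carrier:
  assumes "z \<in> circle"
  shows "phase_toeplitz n z A \<in> os_carrier (toeplitz n)"
proof -
  have "z ^ i * cnj z ^ j = z powi (int i - int j)" for i j
  proof -
    have "z * cnj z = 1" using assms complex_norm_square[of z] by simp
    then have "z \<noteq> 0" "cnj z = 1 / z" by (auto simp: eq_divide_eq mult.commute)
    then show ?thesis by (simp add: power_int_diff power_divide)
  qed
  then show ?thesis
    by (auto simp: toeplitz_def phase_toeplitz_def intro!: exI[of _ "\<lambda>k. z powi k *\<^sub>C A"])
qed

lemma map_phase_toeplitz:
  assumes lin: "clinear_map (toeplitz n) \<psi>" and z: "z \<in> circle"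
  shows "z ^ (n - 1) *\<^sub>C \<psi> (phase_toeplitz n z A)
    = (\<Sum>d\<in>{..2 * (n - 1)}. z ^ d *\<^sub>C \<psi> (shift n (int d - int (n - 1)) A))"
proof -
  have "\<psi> (\<lambda>x. z ^ (n - 1) *\<^sub>C phase_toeplitz n z A x + 0 *\<^sub>C 0)
     = z ^ (n - 1) *\<^sub>C \<psi> (phase_toeplitz n z A) + 0 *\<^sub>C \<psi> (\<lambda>x. 0)"
    using lin[unfolded clinear_map_def, rule_format, OF phase_toeplitz_carrier[OF z] toeplitz_zero,
        of "z ^ (n - 1)" A 0] by simp
  then have "z ^ (n - 1) *\<^sub>C \<psi> (phase_toeplitz n z A) = \<psi> (\<lambda>x. z ^ (n - 1) *\<^sub>C phase_toeplitz n z A x)"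
    by (simp add: cscale_simps)
  also have "\<dots> = (\<Sum>d\<in>{..2 * (n - 1)}. z ^ d *\<^sub>C \<psi> (shift n (int d - int (n - 1)) A))"
    unfolding phase_toeplitz_sum_shift[OF z]
    by (rule toeplitz_sum[OF lin _ shift_in_toeplitz]) simp
  finally show ?thesis .
qed

lemma compress_phase_toeplitz:
  assumes "z \<in> circle" and "n \<ge> 1"
  shows "compress n V (phase_toeplitz n z A) = ctranspose (Qpoly n V z) ** A ** Qpoly n V z"
proof -
  have zz: "z * cnj z = 1" using assms(1) complex_norm_square[of z] by simp
  have ph: "cnj z ^ (n - i) * z ^ (n - j) = z ^ i * cnj z ^ j" if "i \<le> n" "j \<le> n" for i j
  proof -
    have "cnj z ^ (n - i) * z ^ (n - j) = cnj z ^ (n - i) * z ^ (n - j) * (z * cnj z) ^ i * (z * cnj z) ^ j"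
      by (simp add: zz)
    also have "\<dots> = cnj z ^ (n - i + i) * z ^ (n - j + j) * (z ^ i * cnj z ^ j)"
      unfolding power_add power_mult_distrib by (simp only: mult_ac)
    also have "\<dots> = (z * cnj z) ^ n * (z ^ i * cnj z ^ j)"
      using that by (simp add: power_mult_distrib mult_ac)
    finally show ?thesis by (simp add: zz)
  qed
  have "ctranspose (Qpoly n V z) ** A ** Qpoly n V z
    = (\<Sum>j\<in>{1..n}. \<Sum>i\<in>{1..n}. (z ^ (n - j) * cnj z ^ (n - i)) *\<^sub>C (ctranspose (V i) ** A ** V j))"
    unfolding Qpoly_def ctranspose_sum ctranspose_simps mult_sums mult_cscale cscale_simps
    by (simp add: mult_sums mult_cscale cscale_simps cscale_sum_right)
  also have "\<dots> = (\<Sum>i\<in>{1..n}. \<Sum>j\<in>{1..n}. (z ^ i * cnj z ^ j) *\<^sub>C (ctranspose (V i) ** A ** V j))"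
    by (subst sum.swap, intro sum.cong refl) (use ph in \<open>auto simp: mult.commute\<close>)
  also have "\<dots> = compress n V (phase_toeplitz n z A)"
    unfolding compress_def by (intro sum.cong refl) (simp add: phase_toeplitz_def mult_cscale)
  finally show ?thesis by simp
qed

lemma cinner_vscale: "cinner (c *s x) y = cnj c * cinner x y" "cinner x (c *s y) = c * cinner x y"
  by (simp_all add: cinner_def sum_distrib_left mult_ac)

lemma sum_pairs: "(\<Sum>x\<in>A \<times> B. f x) = (\<Sum>a\<in>A. \<Sum>b\<in>B. f (a, b))"
  by (simp add: sum.cartesian_product)

lemma mv_vscale: "A *v (c *s x) = c *s (A *v x)" for A :: "'m::finite cmat"
  by (simp add: vec_eq_iff matrix_vector_mult_def sum_distrib_left mult_ac)

lemma mv_sum_right: "A *v (\<Sum>i\<in>I. x i) = (\<Sum>i\<in>I. A *v x i)" for A :: "'m::finite cmat"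
  by (induction I rule: infinite_finite_induct) (simp_all add: matrix_vector_right_distrib)

lemma phase_toeplitz_positive:
  assumes "block_psd {..<k} A"
  shows "os_pos (toeplitz n) k (\<lambda>a b. phase_toeplitz n z (A a b))"
proof -
  define B where "B = (\<lambda>(a, i) (b, j). phase_toeplitz n z (A a b) (i, j))"
  have "(\<Sum>ai\<in>{..<k} \<times> {1..n}. \<Sum>bj\<in>{..<k} \<times> {1..n}. cinner (x ai) (B ai bj *v x bj)) \<in> \<real>\<^sub>\<ge>\<^sub>0" for x
  proof -
    define y where "y a = (\<Sum>i\<in>{1..n}. cnj z ^ i *s x (a, i))" for a
    have "(\<Sum>ai\<in>{..<k} \<times> {1..n}. \<Sum>bj\<in>{..<k} \<times> {1..n}.
        cinner (x ai) (B ai bj *v x bj))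
      = (\<Sum>a<k. \<Sum>i\<in>{1..n}. \<Sum>b<k. \<Sum>j\<in>{1..n}.
          cinner (x (a, i)) (((z ^ i * cnj z ^ j) *\<^sub>C A a b) *v x (b, j)))"
      unfolding sum_pairs B_def phase_toeplitz_def by (intro sum.cong refl) simp
    also have "\<dots> = (\<Sum>a<k. \<Sum>b<k. \<Sum>i\<in>{1..n}. \<Sum>j\<in>{1..n}.
          cinner (x (a, i)) (((z ^ i * cnj z ^ j) *\<^sub>C A a b) *v x (b, j)))"
      by (rule sum.cong[OF refl]) (rule sum.swap)
    also have "\<dots> = (\<Sum>a<k. \<Sum>b<k. cinner (y a) (A a b *v y b))"
    proof (intro sum.cong refl)
      fix a b
      have yb: "A a b *v y b = (\<Sum>j\<in>{1..n}. cnj z ^ j *s (A a b *v x (b, j)))"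
        unfolding y_def mv_sum_right mv_vscale ..
      have yl: "cinner (y a) u = (\<Sum>i\<in>{1..n}. cnj (cnj z ^ i) * cinner (x (a, i)) u)" for u
        by (simp only: y_def cinner_sum_left cinner_vscale)
      have "cinner (y a) (A a b *v y b)
          = (\<Sum>i\<in>{1..n}. cnj (cnj z ^ i) * (\<Sum>j\<in>{1..n}. cnj z ^ j * cinner (x (a, i)) (A a b *v x (b, j))))"
        unfolding yl unfolding yb cinner_sum_right cinner_vscale ..
      then show "(\<Sum>i\<in>{1..n}. \<Sum>j\<in>{1..n}. cinner (x (a, i)) (((z ^ i * cnj z ^ j) *\<^sub>C A a b) *v x (b, j)))
         = cinner (y a) (A a b *v y b)"
        by (simp only: cinner_cscale_mv sum_distrib_left mult.assoc complex_cnj_power complex_cnj_cnj)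
    qed
    also have "\<dots> \<in> \<real>\<^sub>\<ge>\<^sub>0"
      by (rule assms[unfolded block_psd_def, rule_format])
    finally show ?thesis .
  qed
  then show ?thesis unfolding toeplitz_def opsys.simps block_psd_def B_def by blast
qed

lemma block_psd_matrix_unit: "block_psd UNIV (matrix_unit :: 'm \<Rightarrow> 'm \<Rightarrow> 'm::finite cmat)"
  unfolding block_psd_def
proof
  fix x :: "'m \<Rightarrow> complex^'m"
  have "cinner (x a) (matrix_unit a b *v x b) = cnj (x a $ a) * x b $ b" for a b
  proof -
    have 1: "(matrix_unit a b *v y) $ i = (if i = a then y $ b else 0)" for y :: "complex^'m" and i
    proof -
      have "(matrix_unit a b *v y) $ i = (\<Sum>q\<in>UNIV. if q = b then if i = a then y $ b else 0 else 0)"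
        unfolding matrix_vector_mult_def vec_lambda_beta by (intro sum.cong) (auto simp: matrix_unit_nth)
      then show ?thesis by simp
    qed
    have "cinner (x a) (matrix_unit a b *v x b) = (\<Sum>i\<in>UNIV. if i = a then cnj (x a $ a) * x b $ b else 0)"
      unfolding cinner_def 1 by (intro sum.cong) auto
    then show ?thesis by simp
  qed
  then have "(\<Sum>a\<in>UNIV. \<Sum>b\<in>UNIV. cinner (x a) (matrix_unit a b *v x b))
      = cnj (\<Sum>a\<in>UNIV. x a $ a) * (\<Sum>a\<in>UNIV. x a $ a)"
    by (simp add: sum_product)
  also have "\<dots> = of_real ((cmod (\<Sum>a\<in>UNIV. x a $ a))\<^sup>2)"
    by (simp only: complex_norm_square mult.commute)
  finally show "(\<Sum>a\<in>UNIV. \<Sum>b\<in>UNIV. cinner (x a) (matrix_unit a b *v x b)) \<in> \<real>\<^sub>\<ge>\<^sub>0"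
    by (simp only: nonneg_Reals_of_real_iff) simp
qed

text \<open>The Choi matrix of \<open>A \<mapsto> \<psi> (F A)\<close> is positive, since the matrix units form a positive block
  matrix. The embedding \<open>F\<close> of matrices into the operator system is \<open>phase_toeplitz n z\<close> in one
  application and multiplication by a scalar function in the other.\<close>

lemma choi_psd:
  fixes \<psi> :: "('x \<Rightarrow> 'm::finite cmat) \<Rightarrow> 'm cmat"
    and F :: "'m cmat \<Rightarrow> 'x \<Rightarrow> 'm cmat"
  assumes cp: "cp_map S \<psi>"
    and carrier: "\<And>A. F A \<in> os_carrier S"
    and pos: "\<And>k A. block_psd {..<k} A \<Longrightarrow> os_pos S k (\<lambda>a b. F (A a b))"
  shows "psd (\<lambda>(a, p) (b, q). \<psi> (F (matrix_unit a b)) $ p $ q)"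
proof (rule psd_of_block_psd)
  obtain e :: "nat \<Rightarrow> 'm" where e: "bij_betw e {..<CARD('m)} UNIV"
    using ex_bij_betw_nat_finite[of "UNIV :: 'm set"] by (auto simp: lessThan_atLeast0)
  have "block_psd {..<CARD('m)} (\<lambda>i j. matrix_unit (e i) (e j) :: 'm cmat)"
    using block_psd_matrix_unit block_psd_reindex[OF e] by blast
  from pos[OF this] have "block_psd {..<CARD('m)} (\<lambda>i j. \<psi> (F (matrix_unit (e i) (e j))))"
    using cp[unfolded cp_map_def, THEN conjunct2, rule_format,
        of "CARD('m)" "\<lambda>i j. F (matrix_unit (e i) (e j))"] carrier by blast
  then show "block_psd UNIV (\<lambda>a b. \<psi> (F (matrix_unit a b)))"
    using block_psd_reindex[OF e, of "\<lambda>a b. \<psi> (F (matrix_unit a b))"] by simp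
qed

text \<open>The Choi matrix of \<open>A \<mapsto> Q\<^sup>* A Q\<close> has rank one.\<close>

lemma sandwich_matrix_unit:
  "(ctranspose Q ** matrix_unit a b ** Q) $ p $ q = cnj (Q $ a $ p) * Q $ b $ q"
proof -
  have 1: "(matrix_unit a b ** Q) $ i $ q = (if i = a then Q $ b $ q else 0)" for i
  proof -
    have "(matrix_unit a b ** Q) $ i $ q = (\<Sum>k\<in>UNIV. if k = b then if i = a then Q $ b $ q else 0 else 0)"
      unfolding mat_mult_nth by (intro sum.cong) (auto simp: matrix_unit_nth)
    then show ?thesis by simp
  qed
  have "(ctranspose Q ** (matrix_unit a b ** Q)) $ p $ q
      = (\<Sum>i\<in>UNIV. if i = a then cnj (Q $ a $ p) * Q $ b $ q else 0)"
    unfolding mat_mult_nth[of "ctranspose Q"] 1 by (intro sum.cong) auto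
  then show ?thesis by (simp add: matrix_mul_assoc)
qed

lemma compress_ucp:
  assumes "isometry n V"
  shows "ucp_map (toeplitz n) (compress n V)"
proof -
  have "clinear_map (toeplitz n) (compress n V)"
    by (simp add: clinear_map_def compress_def mult_distribs mult_cscale sum.distrib cscale_sum_right)
  moreover have "block_psd {..<k} (\<lambda>i j. compress n V (F i j))" if P: "os_pos (toeplitz n) k F" for k F
    unfolding block_psd_def
  proof
    fix x :: "nat \<Rightarrow> complex^'a"
    have "(\<Sum>i\<in>{..<k}. \<Sum>j\<in>{..<k}. cinner (x i) (compress n V (F i j) *v x j))
      = (\<Sum>i<k. \<Sum>j<k. \<Sum>p\<in>{1..n}. \<Sum>q\<in>{1..n}. cinner (V p *v x i) (F i j (p, q) *v (V q *v x j)))"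
      by (simp add: compress_def mv_sum cinner_sum_right cinner_sandwich)
    also have "\<dots> = (\<Sum>i<k. \<Sum>p\<in>{1..n}. \<Sum>j<k. \<Sum>q\<in>{1..n}. cinner (V p *v x i) (F i j (p, q) *v (V q *v x j)))"
      by (rule sum.cong[OF refl]) (rule sum.swap)
    also have "\<dots> = (\<Sum>ip\<in>{..<k} \<times> {1..n}. \<Sum>jq\<in>{..<k} \<times> {1..n}.
        cinner ((\<lambda>(i, p). V p *v x i) ip) ((case ip of (i, p) \<Rightarrow> \<lambda>(j, q). F i j (p, q)) jq *v (\<lambda>(i, p). V p *v x i) jq))"
      by (simp only: sum_pairs prod.case)
    also have "\<dots> \<in> \<real>\<^sub>\<ge>\<^sub>0"
      using P unfolding toeplitz_def block_psd_def by simp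
    finally show "(\<Sum>i\<in>{..<k}. \<Sum>j\<in>{..<k}. cinner (x i) (compress n V (F i j) *v x j)) \<in> \<real>\<^sub>\<ge>\<^sub>0" .
  qed
  moreover have "compress n V (os_unit (toeplitz n)) = mat 1"
  proof -
    have "compress n V (os_unit (toeplitz n))
       = (\<Sum>i\<in>{1..n}. \<Sum>j\<in>{1..n}. if i = j then ctranspose (V i) ** V j else 0)"
      unfolding compress_def by (intro sum.cong refl) (auto simp: toeplitz_def)
    then show ?thesis using assms by (simp add: isometry_def sum.delta)
  qed
  ultimately show ?thesis by (simp add: ucp_map_def cp_map_def)
qed

section \<open>The purity criterion\<close>

text \<open>For \<open>s\<close> of degree at most \<open>N\<close> the values on the circle are \<open>z ^ N * cnj (s z)\<close>, so that
  \<open>s * reflected N s\<close> represents \<open>\<bar>s\<bar>\<^sup>2\<close> with \<open>z ^ N\<close> cleared.\<close>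

definition reflected :: "nat \<Rightarrow> complex poly \<Rightarrow> complex poly"
  where "reflected N s = (\<Sum>k\<le>N. monom (cnj (coeff s k)) (N - k))"

lemma poly_reflected:
  assumes "degree s \<le> N" and "z \<noteq> 0"
  shows "poly (reflected N s) z = z ^ N * cnj (poly s (1 / cnj z))"
  using reversed_poly[OF assms(1) order_refl assms(2)] by (simp add: reflected_def poly_sum poly_monom)

lemma poly_reflected_circle:
  assumes "degree s \<le> N" and "z \<in> circle"
  shows "poly (reflected N s) z = z ^ N * cnj (poly s z)"
  using poly_reflected[OF assms(1), of z] inverse_cnj_circle[OF assms(2)] assms(2) by fastforce

lemma coeff_reflected: "k \<le> N \<Longrightarrow> coeff (reflected N s) k = cnj (coeff s (N - k))"
proof -
  assume "k \<le> N"
  have "coeff (reflected N s) k = (\<Sum>j\<le>N. if j = N - k then cnj (coeff s j) else 0)"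
    unfolding reflected_def coeff_sum coeff_monom using \<open>k \<le> N\<close> by (intro sum.cong) auto
  then show ?thesis by (simp add: sum.delta)
qed

lemma reflected_roots:
  assumes deg: "degree s = N" and roots: "\<And>z. poly s z = 0 \<Longrightarrow> z \<in> circle"
  shows "degree (reflected N s) = N" and "poly (reflected N s) z = 0 \<Longrightarrow> z \<in> circle"
proof -
  have s0: "coeff s 0 \<noteq> 0" using roots[of 0] by (auto simp: poly_0_coeff_0)
  then have "coeff (reflected N s) N \<noteq> 0" by (simp add: coeff_reflected)
  moreover have "degree (reflected N s) \<le> N"
    unfolding reflected_def by (intro degree_sum_le finite_atMost) (auto intro: order_trans[OF degree_monom_le])
  ultimately show "degree (reflected N s) = N" by (metis le_degree order_antisym)
  assume z: "poly (reflected N s) z = 0"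
  have "s \<noteq> 0" using s0 by auto
  then have "coeff (reflected N s) 0 \<noteq> 0" using deg by (auto simp: coeff_reflected)
  then have "z \<noteq> 0" using z by (auto simp: poly_0_coeff_0)
  then have "poly s (1 / cnj z) = 0" using z deg by (simp add: poly_reflected)
  then have "1 / cnj z \<in> circle" by (rule roots)
  then show "z \<in> circle" by (simp add: norm_divide)
qed

text \<open>The scalar case of the purity criterion: a trigonometric polynomial of degree \<open>N\<close>
  (given with \<open>z ^ N\<close> cleared) dominated by \<open>\<bar>s\<bar>\<^sup>2\<close> is a multiple of it, because
  \<open>\<bar>s\<bar>\<^sup>2\<close> has the largest possible number of zeros on the circle.\<close>

lemma trig_poly_below_extremal:
  assumes deg: "degree s = N" and roots: "\<And>z. poly s z = 0 \<Longrightarrow> z \<in> circle"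
    and degP: "degree P \<le> 2 * N"
    and le: "\<And>z. z \<in> circle \<Longrightarrow> cmod (poly P z) \<le> (cmod (poly s z))\<^sup>2"
  obtains t where "\<And>z. z \<in> circle \<Longrightarrow> poly P z = t * (z ^ N * of_real ((cmod (poly s z))\<^sup>2))"
proof -
  let ?S = "s * reflected N s"
  have S: "poly ?S z = z ^ N * of_real ((cmod (poly s z))\<^sup>2)" if "z \<in> circle" for z
    using poly_reflected_circle[of s N z] deg that
    unfolding complex_norm_square by (simp add: mult_ac)
  have "s \<noteq> 0" using roots[of 0] by auto
  moreover have "reflected N s \<noteq> 0" using reflected_roots(2)[OF deg roots, of 0] by auto
  ultimately have degS: "degree ?S = 2 * N" and S0: "?S \<noteq> 0"
    using reflected_roots(1)[OF deg roots] deg by (auto simp: degree_mult_eq)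
  have "?S dvd P"
  proof (rule dvd_of_le_on_circle)
    show "cmod (poly P z) \<le> cmod (poly ?S z)" if "z \<in> circle" for z
      using le[OF that] that unfolding S[OF that] by (simp add: norm_mult norm_power)
    show "z \<in> circle" if "poly ?S z = 0" for z
      using that roots reflected_roots(2)[OF deg roots] by auto
  qed
  then obtain q where q: "P = ?S * q" by (elim dvdE)
  have "degree q = 0"
    using degP S0 degS unfolding q by (cases "q = 0") (auto simp: degree_mult_eq)
  then obtain t where "q = [:t:]" by (metis degree_eq_zeroE)
  then have "poly P z = t * (z ^ N * of_real ((cmod (poly s z))\<^sup>2))" if "z \<in> circle" for z
    using S[OF that] by (simp add: q)
  then show thesis by (rule that)
qed

text \<open>The weights \<open>w\<close> describe the linear functional that produces \<open>s\<close>. The multiplier \<open>t\<close> is found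
  from the diagonal value \<open>mform (c z) w w\<close> of the Choi matrix, which is bounded by \<open>\<bar>s\<bar>\<^sup>2\<close>;
  it governs the whole Choi matrix because the latter is dominated by a rank-one matrix.\<close>

lemma purity_criterion:
  fixes V :: "nat \<Rightarrow> 'm::finite cmat" and w :: "'m \<times> 'm \<Rightarrow> complex"
  assumes n: "n \<ge> 1" and iso: "isometry n V"
    and s: "\<And>z. poly s z = (\<Sum>(a, p)\<in>UNIV. Qpoly n V z $ a $ p * w (a, p))"
    and deg: "degree s = n - 1" and roots: "\<And>z. poly s z = 0 \<Longrightarrow> z \<in> circle"
  shows "regular n V" and "pure_ucp (toeplitz n) (compress n V)"
proof -
  show "regular n V"
    unfolding regular_def
  proof (intro allI impI)
    fix a assume "Qpoly n V a = 0"
    then have "poly s a = 0" by (simp add: s case_prod_beta)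
    then show "a \<in> circle" by (rule roots)
  qed
  define N where "N = n - 1"
  have ucp: "ucp_map (toeplitz n) (compress n V)" by (rule compress_ucp[OF iso])
  then have linphi: "clinear_map (toeplitz n) (compress n V)" by (simp add: ucp_map_def cp_map_def)
  define R where "R = {z. poly s z = 0}"
  have finR: "finite R" unfolding R_def using roots[of 0] by (intro poly_roots_finite) auto
  have "\<exists>t\<in>{0..1::real}. \<forall>f\<in>os_carrier (toeplitz n). \<psi> f = t *\<^sub>R compress n V f"
    if cp: "cp_map (toeplitz n) \<psi>" and cp': "cp_map (toeplitz n) (\<lambda>f. compress n V f - \<psi> f)" for \<psi>
  proof -
    have lin: "clinear_map (toeplitz n) \<psi>" using cp by (simp add: cp_map_def)
    \<comment> \<open>\<open>c z\<close> is the Choi matrix of \<open>\<psi>\<close> at \<open>z\<close>, the \<open>e d\<close> are the coefficients of \<open>z ^ N * c z\<close>, and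
      \<open>cnj (v z i) * v z j\<close> is the Choi matrix of the compression.\<close>
    define c where "c z = (\<lambda>(a, p) (b, q). \<psi> (phase_toeplitz n z (matrix_unit a b)) $ p $ q)" for z
    define v where "v z = (\<lambda>(a, p). Qpoly n V z $ a $ p)" for z
    define e where "e d = (\<lambda>(a, p) (b, q). \<psi> (shift n (int d - int N) (matrix_unit a b)) $ p $ q)" for d :: nat
    have vw: "(\<Sum>i\<in>UNIV. v z i * w i) = poly s z" for z
      unfolding s v_def by (intro sum.cong) auto
    have psd1: "psd (c z)" if z: "z \<in> circle" for z
      unfolding c_def
      by (rule choi_psd[OF cp phase_toeplitz_carrier[OF z] phase_toeplitz_positive])
    have psd2: "psd (\<lambda>i j. cnj (v z i) * v z j - c z i j)" if z: "z \<in> circle" for z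
    proof -
      have "(\<lambda>i j. cnj (v z i) * v z j - c z i j) = (\<lambda>(a, p) (b, q).
          (compress n V (phase_toeplitz n z (matrix_unit a b)) - \<psi> (phase_toeplitz n z (matrix_unit a b))) $ p $ q)"
        by (auto simp: fun_eq_iff c_def v_def compress_phase_toeplitz[OF z n] sandwich_matrix_unit)
      then show ?thesis
        using choi_psd[OF cp' phase_toeplitz_carrier[OF z] phase_toeplitz_positive] by simp
    qed
    note below = psd_below_rank_one[OF psd1 psd2, where w = w, unfolded vw]
    have cz: "z ^ N * c z i j = (\<Sum>d\<le>2 * N. z ^ d * e d i j)" if z: "z \<in> circle" for z i j
    proof -
      obtain a p b q where ij: "i = (a, p)" "j = (b, q)" by (metis surj_pair)
      show ?thesis
        using arg_cong[OF map_phase_toeplitz[OF lin z, of "matrix_unit a b"], of "\<lambda>A. A $ p $ q"]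
        by (simp add: ij c_def e_def N_def)
    qed
    define P where "P = (\<Sum>d\<le>2 * N. monom (mform (e d) w w) d)"
    have P: "poly P z = z ^ N * mform (c z) w w" if z: "z \<in> circle" for z
    proof -
      have "z ^ N * mform (c z) w w = mform (\<lambda>i j. \<Sum>d\<le>2 * N. z ^ d * e d i j) w w"
        by (simp only: mform_simps(9)[symmetric] cz[OF z])
      also have "\<dots> = (\<Sum>i\<in>UNIV. \<Sum>j\<in>UNIV. \<Sum>d\<le>2 * N. z ^ d * (cnj (w i) * e d i j * w j))"
        unfolding mform_def by (simp only: sum_distrib_left sum_distrib_right mult_ac)
      also have "\<dots> = (\<Sum>d\<le>2 * N. \<Sum>i\<in>UNIV. \<Sum>j\<in>UNIV. z ^ d * (cnj (w i) * e d i j * w j))"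
        by (subst sum.swap[of _ "{..2 * N}"]) (intro sum.cong refl sum.swap)
      also have "\<dots> = poly P z"
        by (simp add: P_def poly_sum poly_monom mform_def sum_distrib_left mult_ac)
      finally show ?thesis by simp
    qed
    have "degree P \<le> 2 * N"
      unfolding P_def by (intro degree_sum_le finite_atMost) (auto intro: order_trans[OF degree_monom_le])
    moreover have "cmod (poly P z) \<le> (cmod (poly s z))\<^sup>2" if z: "z \<in> circle" for z
      using below(2)[OF z z] z by (simp add: P[OF z] norm_mult norm_power)
    ultimately obtain t where t: "\<And>z. z \<in> circle \<Longrightarrow> poly P z = t * (z ^ N * of_real ((cmod (poly s z))\<^sup>2))"
      using trig_poly_below_extremal[of s N P] deg roots unfolding N_def by metis
    have form: "mform (c z) w w = t * of_real ((cmod (poly s z))\<^sup>2)" if z: "z \<in> circle" for z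
      using t[OF z] z by (auto simp: P[OF z])
    obtain z0 where z0: "z0 \<in> circle" "poly s z0 \<noteq> 0"
    proof -
      have "\<not> circle \<subseteq> R" using finR infinite_circle finite_subset by blast
      then obtain z where "z \<in> circle" "z \<notin> R" by blast
      then show thesis by (intro that[of z]) (auto simp: R_def)
    qed
    define r where "r = (cmod (poly s z0))\<^sup>2"
    have r: "r > 0" using z0 by (simp add: r_def)
    have "t * of_real r \<in> \<real>\<^sub>\<ge>\<^sub>0" "cmod (t * of_real r) \<le> r"
      using below(1,2)[OF z0(1) z0(1)] unfolding form[OF z0(1)] r_def by auto
    then have tt: "t = of_real (Re t)" "0 \<le> Re t" "Re t \<le> 1"
      using r by (auto simp: complex_nonneg_Reals_iff complex_eq_iff norm_mult zero_le_mult_iff cmod_eq_Re)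
    \<comment> \<open>Division by \<open>\<bar>s\<bar>\<^sup>2\<close> is only possible off the roots; the finitely many exceptions do not
      affect the comparison of coefficients that follows.\<close>
    have entries: "c z i j = t * (cnj (v z i) * v z j)" if z: "z \<in> circle - R" for z i j
    proof -
      have "c z i j * of_real ((cmod (poly s z))\<^sup>2) = t * of_real ((cmod (poly s z))\<^sup>2) * (cnj (v z i) * v z j)"
        using below(3)[of z i j] z form[of z] by simp
      then show ?thesis using z by (simp add: R_def)
    qed
    have units: "\<psi> (shift n (int d - int N) (matrix_unit a b))
        = t *\<^sub>C compress n V (shift n (int d - int N) (matrix_unit a b))" if d: "d \<le> 2 * N" for a b d
    proof -
      have "\<psi> (shift n (int d - int N) (matrix_unit a b)) $ p $ q
          = (t *\<^sub>C compress n V (shift n (int d - int N) (matrix_unit a b))) $ p $ q" for p q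
      proof -
        let ?f = "\<lambda>d. \<psi> (shift n (int d - int N) (matrix_unit a b)) $ p $ q"
        let ?g = "\<lambda>d. t * compress n V (shift n (int d - int N) (matrix_unit a b)) $ p $ q"
        have "(\<Sum>d\<le>2 * N. monom (?f d) d) = (\<Sum>d\<le>2 * N. monom (?g d) d)"
        proof (rule poly_eq_on_circle[OF finR])
          fix z assume z: "z \<in> circle - R"
          then have zc: "z \<in> circle" by simp
          have "poly (\<Sum>d\<le>2 * N. monom (?f d) d) z = z ^ N * c z (a, p) (b, q)"
            by (simp add: cz[OF zc] poly_sum poly_monom e_def mult_ac)
          also have "\<dots> = t * (z ^ N * compress n V (phase_toeplitz n z (matrix_unit a b)) $ p $ q)"
            by (simp add: entries[OF z] v_def compress_phase_toeplitz[OF zc n] sandwich_matrix_unit)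
          also have "z ^ N * compress n V (phase_toeplitz n z (matrix_unit a b)) $ p $ q
              = (\<Sum>d\<le>2 * N. z ^ d * compress n V (shift n (int d - int N) (matrix_unit a b)) $ p $ q)"
            using arg_cong[OF map_phase_toeplitz[OF linphi zc, of "matrix_unit a b"], of "\<lambda>A. A $ p $ q"]
            by (simp add: N_def)
          also have "t * \<dots> = poly (\<Sum>d\<le>2 * N. monom (?g d) d) z"
            by (simp add: poly_sum poly_monom sum_distrib_left mult_ac)
          finally show "poly (\<Sum>d\<le>2 * N. monom (?f d) d) z = poly (\<Sum>d\<le>2 * N. monom (?g d) d) z" .
        qed
        from arg_cong[OF this, of "\<lambda>p. coeff p d"] show ?thesis
          using d by (simp add: coeff_sum sum.delta)
      qed
      then show ?thesis by (simp add: vec_eq_iff)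
    qed
    have shifts: "\<psi> (shift n k A) = t *\<^sub>C compress n V (shift n k A)" if k: "\<bar>k\<bar> \<le> int N" for k A
    proof -
      obtain d where d: "k = int d - int N" "d \<le> 2 * N"
      proof
        show "k = int (nat (k + int N)) - int N" "nat (k + int N) \<le> 2 * N" using k by auto
      qed
      have expand: "\<phi> (shift n k A) = (\<Sum>ab\<in>UNIV. A $ fst ab $ snd ab *\<^sub>C \<phi> (shift n k (matrix_unit (fst ab) (snd ab))))"
        if "clinear_map (toeplitz n) \<phi>" for \<phi>
        by (subst shift_eq_sum_units, rule toeplitz_sum[OF that])
           (auto intro: shift_in_toeplitz)
      show ?thesis
        unfolding expand[OF lin] expand[OF linphi]
        by (simp add: d(1) units[OF d(2)] cscale_sum_right cscale_simps mult.commute)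
    qed
    have "\<psi> T = Re t *\<^sub>R compress n V T" if T: "T \<in> os_carrier (toeplitz n)" for T
    proof -
      obtain \<tau> where \<tau>: "T = (\<lambda>x. \<Sum>k\<in>{- int N..int N}. 1 *\<^sub>C shift n k (\<tau> k) x)"
        using toeplitz_eq_sum_shift[OF T] n unfolding N_def by metis
      have expand: "\<phi> T = (\<Sum>k\<in>{- int N..int N}. \<phi> (shift n k (\<tau> k)))" if "clinear_map (toeplitz n) \<phi>" for \<phi>
        unfolding \<tau> by (subst toeplitz_sum[OF that]) (auto intro: shift_in_toeplitz simp: cscale_simps)
      have "\<psi> T = (\<Sum>k\<in>{- int N..int N}. t *\<^sub>C compress n V (shift n k (\<tau> k)))"
        unfolding expand[OF lin] by (intro sum.cong refl shifts) auto
      also have "\<dots> = t *\<^sub>C compress n V T" by (simp add: expand[OF linphi] cscale_sum_right)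
      also have "\<dots> = Re t *\<^sub>R compress n V T" by (simp only: scaleR_eq_cscale flip: tt(1))
      finally show ?thesis .
    qed
    then show ?thesis using tt by (intro bexI[of _ "Re t"]) auto
  qed
  then show "pure_ucp (toeplitz n) (compress n V)" using ucp by (auto simp: pure_ucp_def)
qed


section \<open>Approximation of a ucp map by point evaluations\<close>

definition on_circle :: "(complex \<Rightarrow> 'm::finite cmat) \<Rightarrow> complex \<Rightarrow> 'm cmat"
  where "on_circle f = (\<lambda>z. if z \<in> circle then f z else 0)"

lemma on_circle_CT:
  assumes "continuous_on circle f"
  shows "on_circle f \<in> os_carrier CT"
proof -
  have "continuous_on circle (on_circle f)"
    by (rule continuous_on_eq[OF assms]) (simp add: on_circle_def)
  then show ?thesis by (simp add: CT_def on_circle_def)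
qed

lemma CT_zero: "(\<lambda>z. 0) \<in> os_carrier CT"
  by (simp add: CT_def)

lemma CT_unit: "os_unit CT \<in> os_carrier CT"
proof -
  have "os_unit CT = on_circle (\<lambda>_. mat 1)" by (simp add: CT_def on_circle_def)
  then show ?thesis using on_circle_CT[OF continuous_on_const] by metis
qed

lemma CT_sum:
  assumes "clinear_map CT \<phi>" and "finite I" and "\<And>i. i \<in> I \<Longrightarrow> f i \<in> os_carrier CT"
  shows "\<phi> (\<lambda>x. \<Sum>i\<in>I. c i *\<^sub>C f i x) = (\<Sum>i\<in>I. c i *\<^sub>C \<phi> (f i))"
  using clinear_map_sum[where S = CT and c = c, OF assms(1) CT_lincomb CT_zero assms(2)] assms(3)
  by blast

lemma cinner_norm_le: "cmod (cinner x y) \<le> norm x * norm y"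
proof -
  have "cmod (cinner x y) \<le> (\<Sum>i\<in>UNIV. \<bar>cmod (x $ i)\<bar> * \<bar>cmod (y $ i)\<bar>)"
    unfolding cinner_def by (rule order_trans[OF norm_sum]) (simp add: norm_mult)
  also have "\<dots> \<le> norm x * norm y"
    unfolding norm_vec_def by (rule L2_set_mult_ineq)
  finally show ?thesis .
qed

lemma cinner_self: "cinner x x = of_real ((norm x)\<^sup>2)"
proof -
  have "(norm x)\<^sup>2 = (\<Sum>i\<in>UNIV. (cmod (x $ i))\<^sup>2)"
    by (simp add: norm_vec_def L2_set_def sum_nonneg)
  then show ?thesis
    unfolding cinner_def by (simp only: of_real_sum complex_norm_square mult.commute)
qed

lemma cinner_commute: "cinner y x = cnj (cinner x y)"
  by (simp add: cinner_def mult.commute)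

lemma cinner_axis: "cinner (axis p 1) (A *v axis q 1) = A $ p $ q"
proof -
  have 1: "(A *v axis q 1) $ i = A $ i $ q" for i
    by (simp add: matrix_vector_mult_def axis_def if_distrib cong: if_cong)
  have "cinner (axis p 1) (A *v axis q 1) = (\<Sum>i\<in>UNIV. if i = p then A $ p $ q else 0)"
    unfolding cinner_def 1 by (intro sum.cong refl) (auto simp: axis_def)
  also have "\<dots> = A $ p $ q" by (rule trans[OF sum.delta]) auto
  finally show ?thesis .
qed

lemma scalar_mat_mv: "(c *\<^sub>C (mat 1 :: 'm::finite cmat)) *v x = c *s x"
proof -
  have "(c *\<^sub>C (mat 1 :: 'm cmat)) *v x = c *s (mat 1 *v x)"
    by (simp add: vec_eq_iff matrix_vector_mult_def sum_distrib_left mult.assoc)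
  then show ?thesis by simp
qed

text \<open>If \<open>norm f \<le> c\<close>, the block matrix with rows \<open>(c, f)\<close> and \<open>(f\<^sup>*, c)\<close> is positive.
  Evaluating its image on the vectors \<open>\<omega> *s axis p 1\<close> and \<open>axis q 1\<close>, for each fourth root
  of unity \<open>\<omega>\<close>, bounds the \<open>(p, q)\<close> entry.\<close>

lemma ucp_entry_bound:
  fixes \<Phi> :: "(complex \<Rightarrow> 'm::finite cmat) \<Rightarrow> 'm cmat"
  assumes ucp: "\<Phi> \<in> ucp_maps_CT" and f: "f \<in> os_carrier CT"
    and le: "\<And>z. z \<in> circle \<Longrightarrow> norm (f z) \<le> c"
  shows "cmod (\<Phi> f $ p $ q) \<le> 2 * c"
proof -
  have one: "\<Phi> (os_unit CT) = mat 1" and cp: "cp_map CT \<Phi>"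
    using ucp by (simp_all add: ucp_maps_CT_def ucp_map_def)
  then have lin: "clinear_map CT \<Phi>" by (simp add: cp_map_def)
  have c0: "c \<ge> 0" using order_trans[OF norm_ge_zero le[of 1]] by simp
  define u :: "complex \<Rightarrow> 'm cmat" where "u = (\<lambda>z. complex_of_real c *\<^sub>C os_unit CT z)"
  define g where "g = (\<lambda>z. ctranspose (f z))"
  define F where "F i j = (if i = j then u else if i = 0 then f else g)" for i j :: nat
  have unit: "os_unit CT \<in> os_carrier (CT :: (complex, 'm) opsys)"
    by (rule CT_unit)
  have u: "u \<in> os_carrier CT" "\<Phi> u = complex_of_real c *\<^sub>C mat 1"
    using CT_lincomb[OF unit unit, of c 0]
      lin[unfolded clinear_map_def, rule_format, OF unit unit, of c 0] one
    by (simp_all add: u_def cscale_simps)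
  have g: "g \<in> os_carrier CT"
    using f by (auto simp: CT_def g_def ctranspose_simps intro: continuous_on_ctranspose)
  have expand: "(\<Sum>i\<in>{..<2}. \<Sum>j\<in>{..<2}. cinner (x i) (A i j *v x j))
      = cinner (x 0) (A 0 0 *v x 0) + cinner (x 0) (A 0 1 *v x 1)
        + (cinner (x 1) (A 1 0 *v x 0) + cinner (x 1) (A 1 1 *v x 1))"
    for x :: "nat \<Rightarrow> complex^'m" and A
    by (simp add: numeral_2_eq_2)
  have "block_psd {..<2} (\<lambda>i j. F i j z)" if z: "z \<in> circle" for z
    unfolding block_psd_def
  proof
    fix x :: "nat \<Rightarrow> complex^'m"
    have uz: "u z = complex_of_real c *\<^sub>C mat 1" using z by (simp add: u_def CT_def)
    have x: "cinner (x 1) (g z *v x 0) = cnj (cinner (x 0) (f z *v x 1))"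
      unfolding g_def cinner_adjoint by (rule cinner_commute)
    have "cmod (cinner (x 0) (f z *v x 1)) \<le> norm (x 0) * (c * norm (x 1))"
      by (intro order_trans[OF cinner_norm_le] mult_left_mono order_trans[OF norm_mv_le]
          mult_right_mono le[OF z]) auto
    moreover have "c * (norm (x 0) - norm (x 1))\<^sup>2 \<ge> 0" using c0 by simp
    moreover have "- Re (cinner (x 0) (f z *v x 1)) \<le> cmod (cinner (x 0) (f z *v x 1))"
      using abs_Re_le_cmod[of "cinner (x 0) (f z *v x 1)"] by linarith
    ultimately have "0 \<le> c * (norm (x 0))\<^sup>2 + 2 * Re (cinner (x 0) (f z *v x 1)) + c * (norm (x 1))\<^sup>2"
      by (simp add: power2_diff algebra_simps)
    then show "(\<Sum>i\<in>{..<2}. \<Sum>j\<in>{..<2}. cinner (x i) (F i j z *v x j)) \<in> \<real>\<^sub>\<ge>\<^sub>0"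
      unfolding expand F_def
      by (simp add: uz x scalar_mat_mv cinner_vscale cinner_self complex_nonneg_Reals_iff del: One_nat_def)
  qed
  then have "os_pos CT 2 F" by (simp add: CT_def)
  moreover have "\<forall>i<2. \<forall>j<2. F i j \<in> os_carrier CT" using u(1) g f by (simp add: F_def)
  ultimately have blk: "block_psd {..<2} (\<lambda>i j. \<Phi> (F i j))"
    using cp[unfolded cp_map_def, THEN conjunct2, rule_format, of 2 F] by blast
  define a where "a = \<Phi> f $ p $ q"
  define b where "b = \<Phi> g $ q $ p"
  have key: "of_real (2 * c) + cnj \<omega> * a + \<omega> * b \<in> \<real>\<^sub>\<ge>\<^sub>0" if "cmod \<omega> = 1" for \<omega>
  proof -
    let ?x = "\<lambda>i::nat. if i = 0 then \<omega> *s axis p 1 else axis q 1"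
    have ww: "\<omega> * cnj \<omega> = 1"
      using that complex_norm_square[of \<omega>] by simp
    have self: "cinner (axis r 1) (axis r (1::complex)) = 1" for r :: 'm
      by (simp add: cinner_self)
    have "(\<Sum>i\<in>{..<2}. \<Sum>j\<in>{..<2}. cinner (?x i) (\<Phi> (F i j) *v ?x j)) = of_real (2 * c) + cnj \<omega> * a + \<omega> * b"
      unfolding expand F_def
      by (simp add: u(2) scalar_mat_mv mv_vscale cinner_vscale cinner_axis self a_def b_def ww del: One_nat_def)
    then show ?thesis using blk[unfolded block_psd_def, rule_format, of ?x] by simp
  qed
  have "\<bar>Re a\<bar> \<le> c" "\<bar>Im a\<bar> \<le> c"
    using key[of 1] key[of "-1"] key[of \<i>] key[of "-\<i>"] by (auto simp: complex_nonneg_Reals_iff)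
  then show ?thesis using cmod_le[of a] by (simp add: a_def)
qed

text \<open>A crude bound suffices, since only continuity of \<open>\<Phi>\<close> in the supremum norm is at stake.\<close>

lemma ucp_bound:
  fixes \<Phi> :: "(complex \<Rightarrow> 'm::finite cmat) \<Rightarrow> 'm cmat"
  assumes "\<Phi> \<in> ucp_maps_CT" and "f \<in> os_carrier CT"
    and "\<And>z. z \<in> circle \<Longrightarrow> norm (f z) \<le> c"
  shows "norm (\<Phi> f) \<le> 2 * (real CARD('m))\<^sup>2 * c"
proof -
  have "norm (\<Phi> f) \<le> (\<Sum>p\<in>(UNIV :: 'm set). \<Sum>q\<in>(UNIV :: 'm set). 2 * c)"
    using ucp_entry_bound[OF assms] by (intro order_trans[OF norm_le_entries] sum_mono) auto
  then show ?thesis by (simp add: power2_eq_square mult_ac)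
qed

text \<open>Kraus form of the map \<open>A \<mapsto> \<psi> (F A)\<close>, from a Gram decomposition of its Choi matrix.\<close>

lemma kraus:
  fixes \<psi> :: "('x \<Rightarrow> 'm::finite cmat) \<Rightarrow> 'm cmat" and F :: "'m cmat \<Rightarrow> 'x \<Rightarrow> 'm cmat"
  assumes cp: "cp_map S \<psi>" and carrier: "\<And>A. F A \<in> os_carrier S"
    and pos: "\<And>k A. block_psd {..<k} A \<Longrightarrow> os_pos S k (\<lambda>a b. F (A a b))"
    and lin: "\<And>A. \<psi> (F A) = (\<Sum>ab\<in>UNIV. A $ fst ab $ snd ab *\<^sub>C \<psi> (F (matrix_unit (fst ab) (snd ab))))"
  shows "\<exists>K :: 'm \<times> 'm \<Rightarrow> 'm cmat. \<forall>A. \<psi> (F A) = (\<Sum>s\<in>UNIV. ctranspose (K s) ** A ** K s)"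
proof -
  define c where "c = (\<lambda>(a, p) (b, q). \<psi> (F (matrix_unit a b)) $ p $ q)"
  have "psd c" unfolding c_def by (rule choi_psd[OF cp carrier pos])
  then have "\<exists>v. \<forall>i j. c i j = (\<Sum>s\<in>(UNIV :: ('m \<times> 'm) set). cnj (v s i) * v s j)"
    by (intro psd_gram) auto
  then obtain v where v: "\<And>i j. c i j = (\<Sum>s\<in>(UNIV :: ('m \<times> 'm) set). cnj (v s i) * v s j)" by auto
  define K :: "'m \<times> 'm \<Rightarrow> 'm cmat" where "K s = (\<chi> a p. v s (a, p))" for s
  have unit: "\<psi> (F (matrix_unit a b)) = (\<Sum>s\<in>UNIV. ctranspose (K s) ** matrix_unit a b ** K s)" for a b
  proof -
    have "\<psi> (F (matrix_unit a b)) $ p $ q = (\<Sum>s\<in>UNIV. ctranspose (K s) ** matrix_unit a b ** K s) $ p $ q" for p q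
      using v[of "(a, p)" "(b, q)"] by (simp add: sandwich_matrix_unit K_def c_def)
    then show ?thesis by (simp only: vec_eq_iff) simp
  qed
  have decomp: "A = (\<Sum>ab\<in>UNIV. A $ fst ab $ snd ab *\<^sub>C matrix_unit (fst ab) (snd ab))" for A :: "'m cmat"
    by (simp only: matrix_unit_decomposition)
  have "\<psi> (F A) = (\<Sum>s\<in>UNIV. ctranspose (K s) ** A ** K s)" for A
  proof -
    have "\<psi> (F A) = (\<Sum>ab\<in>UNIV. \<Sum>s\<in>UNIV. A $ fst ab $ snd ab *\<^sub>C
        (ctranspose (K s) ** matrix_unit (fst ab) (snd ab) ** K s))"
      unfolding lin[of A] unit cscale_sum_right ..
    also have "\<dots> = (\<Sum>s\<in>UNIV. \<Sum>ab\<in>UNIV. A $ fst ab $ snd ab *\<^sub>C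
        (ctranspose (K s) ** matrix_unit (fst ab) (snd ab) ** K s))"
      by (rule sum.swap)
    also have "\<dots> = (\<Sum>s\<in>UNIV. ctranspose (K s) ** A ** K s)"
      by (subst (2) decomp) (simp add: mult_sums mult_cscale)
    finally show ?thesis .
  qed
  then show ?thesis by blast
qed

lemma injective_choice:
  assumes "finite J" and "\<And>j. j \<in> J \<Longrightarrow> infinite (A j)"
  shows "\<exists>w. inj_on w J \<and> (\<forall>j\<in>J. w j \<in> A j)"
  using assms
proof (induction J rule: finite_induct)
  case (insert i J)
  then obtain w where w: "inj_on w J" "\<forall>j\<in>J. w j \<in> A j" by auto
  have "infinite (A i - w ` J)" using insert by simp
  then obtain x where "x \<in> A i" "x \<notin> w ` J" by (metis Diff_iff finite.emptyI ex_in_conv)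
  then have "inj_on (w(i := x)) (insert i J) \<and> (\<forall>j\<in>insert i J. (w(i := x)) j \<in> A j)"
    using w insert.hyps by (auto simp: inj_on_def)
  then show ?case by blast
qed simp

lemma partition_of_unity_circle:
  fixes \<delta> :: real
  assumes "\<delta> > 0"
  obtains Z :: "complex set" and e :: "complex \<Rightarrow> complex \<Rightarrow> real" where
    "finite Z" "Z \<subseteq> circle" "\<And>\<zeta>. continuous_on circle (e \<zeta>)" "\<And>\<zeta> z. e \<zeta> z \<ge> 0"
    "\<And>z. z \<in> circle \<Longrightarrow> (\<Sum>\<zeta>\<in>Z. e \<zeta> z) = 1"
    "\<And>\<zeta> z. dist z \<zeta> \<ge> \<delta> \<Longrightarrow> e \<zeta> z = 0"
proof -
  have "seq_compact circle" by (rule compact_imp_seq_compact[OF compact_sphere])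
  from seq_compact_imp_totally_bounded[OF this, rule_format, OF assms]
  obtain Z where Z: "finite Z" "Z \<subseteq> circle" "circle \<subseteq> (\<Union>\<zeta>\<in>Z. ball \<zeta> \<delta>)"
    by (elim exE conjE)
  define h where "h \<zeta> z = max 0 (\<delta> - dist z \<zeta>)" for \<zeta> z :: complex
  define H where "H z = (\<Sum>\<zeta>\<in>Z. h \<zeta> z)" for z
  have H: "H z > 0" if z: "z \<in> circle" for z
  proof -
    obtain \<zeta> where "\<zeta> \<in> Z" "dist z \<zeta> < \<delta>" using Z(3) z by (auto simp: dist_commute)
    then show ?thesis unfolding H_def using Z(1) by (intro sum_pos2[of Z \<zeta>]) (auto simp: h_def)
  qed
  show thesis
  proof (rule that[of Z "\<lambda>\<zeta> z. h \<zeta> z / H z"])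
    show "continuous_on circle (\<lambda>z. h \<zeta> z / H z)" for \<zeta>
    proof (intro continuous_on_divide ballI)
      show "continuous_on circle H" "continuous_on circle (h \<zeta>)"
        unfolding H_def h_def by (intro continuous_intros)+
    qed (use H in fastforce)
    show "h \<zeta> z / H z \<ge> 0" for \<zeta> z
      by (auto simp: H_def h_def intro!: divide_nonneg_nonneg sum_nonneg)
    show "(\<Sum>\<zeta>\<in>Z. h \<zeta> z / H z) = 1" if "z \<in> circle" for z
      using H[OF that] by (simp flip: sum_divide_distrib H_def)
    show "h \<zeta> z / H z = 0" if "dist z \<zeta> \<ge> \<delta>" for \<zeta> z using that by (simp add: h_def)
  qed (use Z in auto)
qed

text \<open>Both sides are the trace of the identity.\<close>

lemma sum_norm_sq_kraus:
  fixes K :: "'j \<Rightarrow> 'm::finite cmat"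
  assumes "(\<Sum>j\<in>J. ctranspose (K j) ** K j) = mat 1"
  shows "(\<Sum>j\<in>J. (norm (K j))\<^sup>2) = real CARD('m)"
proof -
  have "complex_of_real ((norm A)\<^sup>2) = (\<Sum>q\<in>UNIV. (ctranspose A ** A) $ q $ q)" for A :: "'m cmat"
  proof -
    have "complex_of_real ((norm A)\<^sup>2) = (\<Sum>p\<in>UNIV. \<Sum>q\<in>UNIV. cnj (A $ p $ q) * A $ p $ q)"
      unfolding norm_cmat_sq of_real_sum complex_norm_square by (simp only: mult.commute)
    also have "\<dots> = (\<Sum>q\<in>UNIV. \<Sum>p\<in>UNIV. cnj (A $ p $ q) * A $ p $ q)" by (rule sum.swap)
    finally show ?thesis by (simp add: mat_mult_nth)
  qed
  then have "complex_of_real (\<Sum>j\<in>J. (norm (K j))\<^sup>2) = (\<Sum>j\<in>J. \<Sum>q\<in>UNIV. (ctranspose (K j) ** K j) $ q $ q)"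
    by simp
  also have "\<dots> = (\<Sum>q\<in>UNIV. (\<Sum>j\<in>J. ctranspose (K j) ** K j) $ q $ q)"
    by (subst sum.swap) simp
  also have "\<dots> = of_real (real CARD('m))" by (simp add: assms mat_def)
  finally show ?thesis by (simp only: of_real_eq_iff)
qed

text \<open>The partition of unity splits \<open>\<Phi>\<close> into maps \<open>A \<mapsto> \<Phi> (e \<zeta> * A)\<close>. Each has a Kraus form,
  and the Kraus operators that share a centre \<open>\<zeta>\<close> are moved to different points near \<open>\<zeta>\<close>: the
  mixed terms of a sum of peaks are only negligible when the peaks are at different points.\<close>

lemma point_evaluation_approximation:
  fixes \<Phi> :: "(complex \<Rightarrow> 'm::finite cmat) \<Rightarrow> 'm cmat" and \<delta> :: real
  assumes \<Phi>: "\<Phi> \<in> ucp_maps_CT" and \<delta>: "\<delta> > 0"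
  shows "\<exists>(J :: (complex \<times> 'm \<times> 'm) set) (K :: complex \<times> 'm \<times> 'm \<Rightarrow> 'm cmat) w.
    finite J \<and> inj_on w J \<and> w ` J \<subseteq> circle \<and> (\<Sum>j\<in>J. ctranspose (K j) ** K j) = mat 1 \<and>
    (\<forall>f L. f \<in> os_carrier CT \<and> L \<ge> 0 \<and> (\<forall>x\<in>circle. \<forall>y\<in>circle. norm (f x - f y) \<le> L * dist x y) \<longrightarrow>
       norm (\<Phi> f - (\<Sum>j\<in>J. ctranspose (K j) ** f (w j) ** K j))
         \<le> (2 * (real CARD('m))\<^sup>2 + real CARD('m)) * (L * \<delta>))"
proof -
  have one: "\<Phi> (os_unit CT) = mat 1" and cp: "cp_map CT \<Phi>"
    using \<Phi> by (simp_all add: ucp_maps_CT_def ucp_map_def)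
  then have lin: "clinear_map CT \<Phi>" by (simp add: cp_map_def)
  obtain Z and e :: "complex \<Rightarrow> complex \<Rightarrow> real" where Z: "finite Z" "Z \<subseteq> circle"
    and e: "\<And>\<zeta>. continuous_on circle (e \<zeta>)" "\<And>\<zeta> z. e \<zeta> z \<ge> 0"
      "\<And>z. z \<in> circle \<Longrightarrow> (\<Sum>\<zeta>\<in>Z. e \<zeta> z) = 1" "\<And>\<zeta> z. dist z \<zeta> \<ge> \<delta> \<Longrightarrow> e \<zeta> z = 0"
    using partition_of_unity_circle[OF \<delta>] by metis
  define F where "F \<zeta> A = on_circle (\<lambda>z. complex_of_real (e \<zeta> z) *\<^sub>C A)" for \<zeta> and A :: "'m cmat"
  have F: "F \<zeta> A \<in> os_carrier CT" for \<zeta> A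
    unfolding F_def by (intro on_circle_CT continuous_on_cscale continuous_on_of_real e(1) continuous_on_const)
  have Fpos: "os_pos CT k (\<lambda>a b. F \<zeta> (A a b))" if A: "block_psd {..<k} A" for k \<zeta> and A :: "nat \<Rightarrow> nat \<Rightarrow> 'm cmat"
  proof -
    have "block_psd {..<k} (\<lambda>a b. F \<zeta> (A a b) z)" if "z \<in> circle" for z
      unfolding block_psd_def
    proof
      fix x :: "nat \<Rightarrow> complex^'m"
      have "(\<Sum>i\<in>{..<k}. \<Sum>j\<in>{..<k}. cinner (x i) (F \<zeta> (A i j) z *v x j))
          = of_real (e \<zeta> z) * (\<Sum>i\<in>{..<k}. \<Sum>j\<in>{..<k}. cinner (x i) (A i j *v x j))"
        using that by (simp add: F_def on_circle_def cinner_cscale_mv sum_distrib_left)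
      also have "\<dots> \<in> \<real>\<^sub>\<ge>\<^sub>0"
        using A[unfolded block_psd_def, rule_format, of x] e(2)[of \<zeta> z]
        by (intro nonneg_Reals_mult_I) auto
      finally show "(\<Sum>i\<in>{..<k}. \<Sum>j\<in>{..<k}. cinner (x i) (F \<zeta> (A i j) z *v x j)) \<in> \<real>\<^sub>\<ge>\<^sub>0" .
    qed
    then show ?thesis by (simp add: CT_def)
  qed
  have Flin: "\<Phi> (F \<zeta> A) = (\<Sum>ab\<in>UNIV. A $ fst ab $ snd ab *\<^sub>C \<Phi> (F \<zeta> (matrix_unit (fst ab) (snd ab))))" for \<zeta> A
  proof -
    have "F \<zeta> A = (\<lambda>z. \<Sum>ab\<in>UNIV. A $ fst ab $ snd ab *\<^sub>C F \<zeta> (matrix_unit (fst ab) (snd ab)) z)"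
    proof
      fix z
      have "complex_of_real (e \<zeta> z) *\<^sub>C A
          = complex_of_real (e \<zeta> z) *\<^sub>C (\<Sum>ab\<in>UNIV. A $ fst ab $ snd ab *\<^sub>C matrix_unit (fst ab) (snd ab))"
        by (simp only: matrix_unit_decomposition)
      also have "\<dots> = (\<Sum>ab\<in>UNIV. A $ fst ab $ snd ab *\<^sub>C (complex_of_real (e \<zeta> z) *\<^sub>C matrix_unit (fst ab) (snd ab)))"
        by (simp add: cscale_sum_right cscale_simps mult.commute)
      finally show "F \<zeta> A z = (\<Sum>ab\<in>UNIV. A $ fst ab $ snd ab *\<^sub>C F \<zeta> (matrix_unit (fst ab) (snd ab)) z)"
        by (simp add: F_def on_circle_def cscale_simps)
    qed
    then show ?thesis
      using CT_sum[OF lin, of UNIV "\<lambda>ab. F \<zeta> (matrix_unit (fst ab) (snd ab))" "\<lambda>ab. A $ fst ab $ snd ab"] F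
      by simp
  qed
  have "\<forall>\<zeta>. \<exists>K :: 'm \<times> 'm \<Rightarrow> 'm cmat. \<forall>A. \<Phi> (F \<zeta> A) = (\<Sum>s\<in>UNIV. ctranspose (K s) ** A ** K s)"
    by (rule allI) (rule kraus[where F = "F \<zeta>" for \<zeta>, OF cp F Fpos Flin])
  from choice[OF this] obtain K0 :: "complex \<Rightarrow> 'm \<times> 'm \<Rightarrow> 'm cmat"
    where "\<forall>\<zeta> A. \<Phi> (F \<zeta> A) = (\<Sum>s\<in>UNIV. ctranspose (K0 \<zeta> s) ** A ** K0 \<zeta> s)"
    by (elim exE)
  then have K0: "\<Phi> (F \<zeta> A) = (\<Sum>s\<in>UNIV. ctranspose (K0 \<zeta> s) ** A ** K0 \<zeta> s)" for \<zeta> A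
    by (elim allE)
  define J where "J = Z \<times> (UNIV :: ('m \<times> 'm) set)"
  define K where "K = (\<lambda>(\<zeta>, s). K0 \<zeta> s)"
  have finJ: "finite J" unfolding J_def using Z(1) by (intro finite_SigmaI) auto
  have "infinite (circle \<inter> ball (fst j) \<delta>)" if "j \<in> J" for j
  proof -
    have "fst j islimpt circle" using that Z(2) by (intro circle_islimpt) (auto simp: J_def)
    then show ?thesis using \<delta> unfolding islimpt_eq_infinite_ball by blast
  qed
  then have "\<exists>w. inj_on w J \<and> (\<forall>j\<in>J. w j \<in> circle \<inter> ball (fst j) \<delta>)"
    by (intro injective_choice finJ)
  then obtain w where "inj_on w J \<and> (\<forall>j\<in>J. w j \<in> circle \<inter> ball (fst j) \<delta>)"
    by (elim exE)
  then have w: "inj_on w J" "\<And>j. j \<in> J \<Longrightarrow> w j \<in> circle" "\<And>j. j \<in> J \<Longrightarrow> dist (fst j) (w j) < \<delta>"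
    by auto
  have partial: "(\<Sum>j\<in>J. ctranspose (K j) ** f (fst j) ** K j) = \<Phi> (on_circle (\<lambda>z. \<Sum>\<zeta>\<in>Z. complex_of_real (e \<zeta> z) *\<^sub>C f \<zeta>))"
    for f
  proof -
    have "(\<Sum>j\<in>J. ctranspose (K j) ** f (fst j) ** K j) = (\<Sum>\<zeta>\<in>Z. 1 *\<^sub>C \<Phi> (F \<zeta> (f \<zeta>)))"
      unfolding J_def K_def K0 by (simp add: sum_pairs cscale_simps)
    also have "\<dots> = \<Phi> (\<lambda>z. \<Sum>\<zeta>\<in>Z. 1 *\<^sub>C F \<zeta> (f \<zeta>) z)"
      using CT_sum[OF lin Z(1), of "\<lambda>\<zeta>. F \<zeta> (f \<zeta>)" "\<lambda>_. 1"] F by simp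
    also have "(\<lambda>z. \<Sum>\<zeta>\<in>Z. 1 *\<^sub>C F \<zeta> (f \<zeta>) z) = on_circle (\<lambda>z. \<Sum>\<zeta>\<in>Z. complex_of_real (e \<zeta> z) *\<^sub>C f \<zeta>)"
      by (auto simp: F_def on_circle_def cscale_simps fun_eq_iff)
    finally show ?thesis .
  qed
  have K1: "(\<Sum>j\<in>J. ctranspose (K j) ** K j) = mat 1"
  proof -
    have "on_circle (\<lambda>z. \<Sum>\<zeta>\<in>Z. complex_of_real (e \<zeta> z) *\<^sub>C mat 1) = (os_unit CT :: complex \<Rightarrow> 'm cmat)"
    proof
      fix z
      have "(\<Sum>\<zeta>\<in>Z. complex_of_real (e \<zeta> z) *\<^sub>C (mat 1 :: 'm cmat)) = mat 1" if "z \<in> circle"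
        using e(3)[OF that] by (simp flip: cscale_sum_left of_real_sum add: cscale_simps)
      then show "on_circle (\<lambda>z. \<Sum>\<zeta>\<in>Z. complex_of_real (e \<zeta> z) *\<^sub>C mat 1) z = (os_unit CT :: complex \<Rightarrow> 'm cmat) z"
        by (simp add: on_circle_def CT_def)
    qed
    then show ?thesis using partial[of "\<lambda>_. mat 1"] one by simp
  qed
  have approx: "norm (\<Phi> f - (\<Sum>j\<in>J. ctranspose (K j) ** f (w j) ** K j)) \<le> (2 * (real CARD('m))\<^sup>2 + real CARD('m)) * (L * \<delta>)"
    if f: "f \<in> os_carrier CT" and L: "L \<ge> 0"
      and lip: "\<And>x y. x \<in> circle \<Longrightarrow> y \<in> circle \<Longrightarrow> norm (f x - f y) \<le> L * dist x y" for f L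
  proof -
    define g where "g = on_circle (\<lambda>z. \<Sum>\<zeta>\<in>Z. complex_of_real (e \<zeta> z) *\<^sub>C f \<zeta>)"
    have g: "g \<in> os_carrier CT"
      unfolding g_def
      by (intro on_circle_CT continuous_on_sum continuous_on_cscale continuous_on_of_real e(1) continuous_on_const)
    have fg: "norm (f z - g z) \<le> L * \<delta>" if z: "z \<in> circle" for z
    proof -
      have "f z = (\<Sum>\<zeta>\<in>Z. complex_of_real (e \<zeta> z) *\<^sub>C f z)"
        using e(3)[OF z] by (simp flip: cscale_sum_left of_real_sum add: cscale_simps)
      then have "f z - g z = (\<Sum>\<zeta>\<in>Z. complex_of_real (e \<zeta> z) *\<^sub>C (f z - f \<zeta>))"
        using z by (simp add: g_def on_circle_def cscale_simps sum_subtractf)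
      also have "norm \<dots> \<le> (\<Sum>\<zeta>\<in>Z. e \<zeta> z * (L * \<delta>))"
      proof (rule order_trans[OF norm_sum], rule sum_mono)
        fix \<zeta> assume \<zeta>: "\<zeta> \<in> Z"
        show "norm (complex_of_real (e \<zeta> z) *\<^sub>C (f z - f \<zeta>)) \<le> e \<zeta> z * (L * \<delta>)"
        proof (cases "dist z \<zeta> < \<delta>")
          case True
          have "norm (f z - f \<zeta>) \<le> L * dist z \<zeta>" using \<zeta> Z(2) z by (intro lip) auto
          also have "\<dots> \<le> L * \<delta>" using True L by (intro mult_left_mono) auto
          finally show ?thesis using e(2)[of \<zeta> z] by (simp add: norm_cscale mult_left_mono)
        qed (simp add: e(4) cscale_simps)
      qed
      also have "\<dots> = L * \<delta>" using e(3)[OF z] by (simp flip: sum_distrib_right)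
      finally show ?thesis .
    qed
    have "\<Phi> (\<lambda>z. 1 *\<^sub>C f z + (-1) *\<^sub>C g z) = 1 *\<^sub>C \<Phi> f + (-1) *\<^sub>C \<Phi> g"
      by (rule lin[unfolded clinear_map_def, rule_format, OF f g])
    moreover have "(-1) *\<^sub>C A = - A" for A :: "'m cmat" by (simp add: vec_eq_iff)
    ultimately have "\<Phi> (\<lambda>z. f z - g z) = \<Phi> f - \<Phi> g" by (simp add: cscale_simps)
    moreover have "(\<lambda>z. f z - g z) \<in> os_carrier CT"
      using f g by (auto simp: CT_def intro: continuous_on_diff)
    ultimately have 1: "norm (\<Phi> f - \<Phi> g) \<le> 2 * (real CARD('m))\<^sup>2 * (L * \<delta>)"
      using ucp_bound[OF \<Phi>, of "\<lambda>z. f z - g z" "L * \<delta>"] fg by simp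
    have "\<Phi> g - (\<Sum>j\<in>J. ctranspose (K j) ** f (w j) ** K j)
        = (\<Sum>j\<in>J. ctranspose (K j) ** (f (fst j) - f (w j)) ** K j)"
      unfolding g_def partial[of f, symmetric] by (simp add: mult_distribs sum_subtractf)
    also have "norm \<dots> \<le> (\<Sum>j\<in>J. (norm (K j))\<^sup>2 * (L * \<delta>))"
    proof (rule order_trans[OF norm_sum], rule sum_mono)
      fix j assume j: "j \<in> J"
      have "norm (f (fst j) - f (w j)) \<le> L * dist (fst j) (w j)"
        using j w(2)[OF j] Z(2) by (intro lip) (auto simp: J_def)
      also have "\<dots> \<le> L * \<delta>" using w(3)[OF j] L by (intro mult_left_mono) auto
      finally have "norm (K j) * norm (f (fst j) - f (w j)) * norm (K j) \<le> norm (K j) * (L * \<delta>) * norm (K j)"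
        by (intro mult_right_mono mult_left_mono) auto
      then show "norm (ctranspose (K j) ** (f (fst j) - f (w j)) ** K j) \<le> (norm (K j))\<^sup>2 * (L * \<delta>)"
        using norm_sandwich_le[of "ctranspose (K j)" "f (fst j) - f (w j)" "K j"]
        by (simp add: norm_ctranspose power2_eq_square mult_ac)
    qed
    also have "\<dots> = real CARD('m) * (L * \<delta>)"
      using sum_norm_sq_kraus[OF K1] by (simp flip: sum_distrib_right)
    finally have 2: "norm (\<Phi> g - (\<Sum>j\<in>J. ctranspose (K j) ** f (w j) ** K j)) \<le> real CARD('m) * (L * \<delta>)" .
    show ?thesis
      using 1 2 norm_triangle_ineq[of "\<Phi> f - \<Phi> g" "\<Phi> g - (\<Sum>j\<in>J. ctranspose (K j) ** f (w j) ** K j)"]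
      by (simp add: distrib_right)
  qed
  have "w ` J \<subseteq> circle" using w(2) by auto
  moreover have "\<forall>f L. f \<in> os_carrier CT \<and> L \<ge> 0 \<and> (\<forall>x\<in>circle. \<forall>y\<in>circle. norm (f x - f y) \<le> L * dist x y) \<longrightarrow>
       norm (\<Phi> f - (\<Sum>j\<in>J. ctranspose (K j) ** f (w j) ** K j))
         \<le> (2 * (real CARD('m))\<^sup>2 + real CARD('m)) * (L * \<delta>)"
    by (intro allI impI, rule approx) auto
  ultimately show ?thesis
    by (intro exI[of _ J] exI[of _ K] exI[of _ w] conjI finJ w(1) K1)
qed

text \<open>Multiplying a Kraus operator by a phase does not change the map, but makes any one of its entries
  nonnegative. An entry that is nonzero for some \<open>j\<close> exists because the operators do not all vanish.\<close>

lemma nonneg_entry_kraus: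
  fixes K :: "'j \<Rightarrow> 'm::finite cmat"
  assumes "(\<Sum>j\<in>J. ctranspose (K j) ** K j) = mat 1"
  shows "\<exists>(K' :: 'j \<Rightarrow> 'm cmat) p q (k :: 'j \<Rightarrow> real).
    (\<forall>j A. ctranspose (K' j) ** A ** K' j = ctranspose (K j) ** A ** K j) \<and>
    (\<forall>j. K' j $ p $ q = complex_of_real (k j) \<and> k j \<ge> 0) \<and> (\<exists>j\<in>J. k j > 0)"
proof -
  have "\<exists>j\<in>J. K j \<noteq> 0"
  proof (rule ccontr)
    assume "\<not> (\<exists>j\<in>J. K j \<noteq> 0)"
    then have "(mat 1 :: 'm cmat) = 0" using assms by simp
    then show False by (simp add: vec_eq_iff mat_def split: if_splits)
  qed
  then obtain j0 p q where j0: "j0 \<in> J" "K j0 $ p $ q \<noteq> 0" by (auto simp: vec_eq_iff)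
  define c where "c j = (if K j $ p $ q = 0 then 1 else cnj (sgn (K j $ p $ q)))" for j
  have c1: "cnj (c j) * c j = 1" for j
  proof -
    have "cmod (c j) = 1" by (simp add: c_def norm_sgn)
    then show ?thesis using complex_norm_square[of "c j"] by (simp add: mult.commute)
  qed
  have conj: "ctranspose (c j *\<^sub>C K j) ** A ** (c j *\<^sub>C K j) = ctranspose (K j) ** A ** K j" for j A
    by (simp add: ctranspose_simps mult_cscale cscale_simps c1 mult.commute[of "c j"])
  have entry: "(c j *\<^sub>C K j) $ p $ q = complex_of_real (cmod (K j $ p $ q))" for j
    by (simp add: c_def sgn_eq complex_norm_square[symmetric] power2_eq_square mult.commute)
  have "\<exists>j\<in>J. cmod (K j $ p $ q) > 0" using j0 by auto
  then show ?thesis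
    by (intro exI[of _ "\<lambda>j. c j *\<^sub>C K j"] exI[of _ p] exI[of _ q] exI[of _ "\<lambda>j. cmod (K j $ p $ q)"]
        conjI allI conj entry norm_ge_zero)
qed


section \<open>Lipschitz bounds\<close>

lemma abs_sin_ge:
  assumes "\<bar>x\<bar> \<le> pi / 2"
  shows "\<bar>x\<bar> \<le> 3 * \<bar>sin x\<bar>"
proof -
  have pos: "x \<le> 3 * sin x" if x: "0 \<le> x" "x \<le> pi / 2" for x :: real
  proof -
    have "\<bar>sin x - (\<Sum>m<3. sin_coeff m * x ^ m)\<bar> \<le> inverse (fact 3) * \<bar>x\<bar> ^ 3"
      by (rule Maclaurin_sin_bound)
    then have "\<bar>sin x - x\<bar> \<le> x ^ 3 / 6"
      using x by (simp add: numeral_3_eq_3 sin_coeff_def fact_numeral field_simps)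
    moreover have "x ^ 3 \<le> 4 * x"
    proof -
      have "x \<le> 2" using x pi_less_4 by linarith
      then have "x * x \<le> 2 * 2" using x by (intro mult_mono) auto
      then have "(x * x) * x \<le> 4 * x" using x by (intro mult_right_mono) auto
      then show ?thesis by (simp add: power3_eq_cube)
    qed
    ultimately show ?thesis by linarith
  qed
  show ?thesis
    using pos[of x] pos[of "-x"] assms by (cases "x \<ge> 0") auto
qed

text \<open>Derivatives with respect to the angle bound differences by the length of an arc; this compares
  the arc with the chord.\<close>

lemma circle_angles:
  assumes "z \<in> circle" "w \<in> circle"
  obtains s t where "z = cis s" "w = cis t" "\<bar>s - t\<bar> \<le> 3 * dist z w"
proof -
  define t u where "t = Arg w" and "u = Arg (z / w)"
  have w: "w = cis t" using assms rcis_cmod_Arg[of w] by (simp add: t_def rcis_def)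
  have "z / w = cis u"
    using assms rcis_cmod_Arg[of "z / w"] by (simp add: u_def rcis_def norm_divide)
  then have z: "z = cis u * cis t" using w by (simp add: field_simps)
  have "dist z w = norm (cis u - 1)"
  proof -
    have "z - w = (cis u - 1) * cis t" by (simp add: z w algebra_simps)
    then show ?thesis by (simp add: dist_norm norm_mult)
  qed
  also have "\<dots> = 2 * \<bar>sin (u / 2)\<bar>"
    using dist_exp_i_1[of u] by (simp add: cis_conv_exp)
  finally have "dist z w = 2 * \<bar>sin (u / 2)\<bar>" .
  moreover have "\<bar>u / 2\<bar> \<le> pi / 2"
    using Arg_bounded[of "z / w"] by (auto simp: u_def abs_if)
  ultimately have "\<bar>u\<bar> \<le> 3 * dist z w" using abs_sin_ge[of "u / 2"] by simp
  then show thesis by (intro that[of "u + t" t]) (simp_all add: z w cis_mult)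
qed

lemma opnorm_le_supnorm:
  assumes "f \<in> os_carrier CT" "z \<in> circle"
  shows "opnorm (f z) \<le> supnorm f"
proof -
  have "compact (f ` circle)"
    using assms(1) by (intro compact_continuous_image CT_carrierD compact_sphere)
  then obtain b where "\<And>A. A \<in> f ` circle \<Longrightarrow> norm A \<le> b"
    using compact_imp_bounded bounded_iff by metis
  then have "bdd_above ((\<lambda>z. opnorm (f z)) ` circle)"
    by (intro bdd_aboveI2[where M = b] order_trans[OF opnorm_le_norm]) auto
  then show ?thesis unfolding supnorm_def using assms(2) by (intro cSUP_upper)
qed

lemma norm_le_of_entries:
  fixes A :: "'m::finite cmat"
  assumes "\<And>i j. cmod (A $ i $ j) \<le> b"
  shows "norm A \<le> (real CARD('m))\<^sup>2 * b"
proof -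
  have "norm A \<le> (\<Sum>i\<in>(UNIV :: 'm set). \<Sum>j\<in>(UNIV :: 'm set). b)"
    using assms by (intro order_trans[OF norm_le_entries] sum_mono) auto
  then show ?thesis by (simp add: power2_eq_square mult_ac)
qed

text \<open>The mean value inequality is applied to each entry, because the bounds of the class are in terms
  of the operator norm and the conclusions are in terms of the Frobenius norm.\<close>

lemma lip_class_bounds:
  fixes f :: "complex \<Rightarrow> 'm::finite cmat"
  assumes "f \<in> lip_class"
  shows "f \<in> os_carrier CT"
    and "z \<in> circle \<Longrightarrow> norm (f z) \<le> (real CARD('m))\<^sup>2"
    and "z \<in> circle \<Longrightarrow> w \<in> circle \<Longrightarrow> norm (f z - f w) \<le> 3 * (real CARD('m))\<^sup>2 * dist z w"
proof -
  obtain f' where f: "f \<in> os_carrier CT" and f': "f' \<in> os_carrier CT"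
    and der: "\<And>\<theta>. ((\<lambda>t. f (cis t)) has_vector_derivative f' (cis \<theta>)) (at \<theta>)"
    and sup: "supnorm f \<le> 1" "supnorm f' \<le> 1"
    using assms unfolding lip_class_def by blast
  show "f \<in> os_carrier CT" by (rule f)
  have entry: "cmod (g z $ i $ j) \<le> 1" if "g \<in> os_carrier CT" "supnorm g \<le> 1" "z \<in> circle"
    for g :: "complex \<Rightarrow> 'm cmat" and z i j
    using norm_entry_le_opnorm[of "g z" i j] opnorm_le_supnorm[OF that(1,3)] that(2) by linarith
  show "norm (f z) \<le> (real CARD('m))\<^sup>2" if "z \<in> circle"
    using norm_le_of_entries[of "f z" 1] entry[OF f sup(1) that] by simp
  show "norm (f z - f w) \<le> 3 * (real CARD('m))\<^sup>2 * dist z w" if z: "z \<in> circle" and w: "w \<in> circle"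
  proof -
    obtain s t where st: "z = cis s" "w = cis t" "\<bar>s - t\<bar> \<le> 3 * dist z w"
      using circle_angles[OF z w] by blast
    have "cmod ((f z - f w) $ i $ j) \<le> 3 * dist z w" for i j
    proof -
      have "((\<lambda>t. f (cis t) $ i $ j) has_vector_derivative f' (cis \<theta>) $ i $ j) (at \<theta> within UNIV)" for \<theta>
        using bounded_linear.has_vector_derivative[OF
            bounded_linear_compose[OF bounded_linear_vec_nth bounded_linear_vec_nth] der, of i j]
        by simp
      then have der': "((\<lambda>t. f (cis t) $ i $ j) has_derivative (\<lambda>h. h *\<^sub>R (f' (cis \<theta>) $ i $ j))) (at \<theta> within UNIV)" for \<theta>
        by (simp add: has_vector_derivative_def)
      have "norm (f (cis s) $ i $ j - f (cis t) $ i $ j) \<le> 1 * norm (s - t)"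
      proof (rule differentiable_bound[OF convex_UNIV der'])
        show "onorm (\<lambda>h. h *\<^sub>R (f' (cis \<theta>) $ i $ j)) \<le> 1" for \<theta>
          using entry[OF f' sup(2), of "cis \<theta>" i j]
          by (intro onorm_le) (simp add: mult_left_le)
      qed auto
      then show ?thesis using st by simp
    qed
    from norm_le_of_entries[OF this] show ?thesis by (simp add: mult_ac)
  qed
qed

lemma opnorm_zero: "opnorm (0 :: 'm::finite cmat) = 0"
proof -
  have "(*v) (0 :: 'm cmat) = (\<lambda>x. 0)"
    by (simp add: fun_eq_iff vec_eq_iff matrix_vector_mult_def)
  then show ?thesis by (simp add: opnorm_def onorm_zero)
qed

lemma zero_in_lip_class: "(\<lambda>z. 0) \<in> lip_class"
  unfolding lip_class_def
  using CT_zero by (auto intro!: bexI[of _ "\<lambda>z. 0"] simp: supnorm_def opnorm_zero)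

section \<open>Normalization to an isometry\<close>

text \<open>The equation \<open>(1 + X) ** (1 + E) ** (1 + X) = 1\<close> is solved for small \<open>E\<close> by Banach's
  fixed point theorem, after isolating the linear term \<open>2 * X\<close>. The iteration preserves
  hermitian matrices.\<close>

lemma normalizing_factor:
  fixes E :: "'m::finite cmat"
  assumes herm: "ctranspose E = E" and E: "norm E \<le> \<eta>" and \<eta>: "\<eta> \<le> 1 / 8"
  obtains X where "ctranspose X = X" "norm X \<le> 2 * \<eta>" "(mat 1 + X) ** (mat 1 + E) ** (mat 1 + X) = mat 1"
proof -
  define T where "T X = - ((1 / 2) *\<^sub>R (X ** X + (E + X ** E + E ** X + X ** E ** X)))" for X :: "'m cmat"
  define D where "D = {X :: 'm cmat. ctranspose X = X \<and> norm X \<le> 2 * \<eta>}"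
  have \<eta>0: "0 \<le> \<eta>" using E norm_ge_zero[of E] by linarith
  have ct_scale: "ctranspose (- ((1 / 2) *\<^sub>R A)) = - ((1 / 2) *\<^sub>R ctranspose A)" for A :: "'m cmat"
    by (simp add: vec_eq_iff)
  have "closed D"
  proof -
    have "closed {X :: 'm cmat. ctranspose X = X}"
      by (intro closed_Collect_eq continuous_on_ctranspose continuous_on_id)
    moreover have "closed {X :: 'm cmat. norm X \<le> 2 * \<eta>}"
      by (intro closed_Collect_le continuous_intros)
    ultimately show ?thesis unfolding D_def by (auto simp: Collect_conj_eq)
  qed
  have mul: "norm (A ** B) \<le> a * b" if "norm A \<le> a" "norm B \<le> b" for A B :: "'m cmat" and a b
    using norm_mat_mult_le[of A B] that mult_mono'[of "norm A" a "norm B" b] by simp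
  have "\<exists>!X\<in>D. T X = X"
  proof (rule Banach_fix[of D "1 / 2" T])
    show "complete D" using \<open>closed D\<close> by (simp add: complete_eq_closed)
    have "0 \<in> D" using \<eta>0 by (simp add: D_def ctranspose_simps)
    then show "D \<noteq> {}" by blast
    show "T ` D \<subseteq> D"
    proof
      fix Y assume "Y \<in> T ` D"
      then obtain X where X: "ctranspose X = X" "norm X \<le> 2 * \<eta>" and Y: "Y = T X" by (auto simp: D_def)
      have "ctranspose Y = Y"
        unfolding Y T_def ct_scale ctranspose_simps X(1) herm
        by (simp add: matrix_mul_assoc add_ac)
      moreover have "norm Y \<le> 2 * \<eta>"
      proof -
        have "norm (X ** X) \<le> (2 * \<eta>) * (2 * \<eta>)" "norm (X ** E) \<le> (2 * \<eta>) * \<eta>"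
          "norm (E ** X) \<le> \<eta> * (2 * \<eta>)" "norm (X ** E ** X) \<le> ((2 * \<eta>) * \<eta>) * (2 * \<eta>)"
          by (intro mul X(2) E)+
        then have "norm (X ** X + (E + X ** E + E ** X + X ** E ** X))
            \<le> (2 * \<eta>) * (2 * \<eta>) + (\<eta> + (2 * \<eta>) * \<eta> + \<eta> * (2 * \<eta>) + ((2 * \<eta>) * \<eta>) * (2 * \<eta>))"
          by (intro order_trans[OF norm_triangle_ineq] add_mono E)
        also have "\<dots> \<le> 4 * \<eta>"
        proof -
          have "\<eta> * \<eta> \<le> \<eta> * (1 / 8)" using \<eta> \<eta>0 by (intro mult_left_mono)
          moreover have "\<eta> * \<eta> * \<eta> \<le> \<eta> * \<eta> * (1 / 8)" using \<eta> \<eta>0 by (intro mult_left_mono) auto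
          ultimately show ?thesis using \<eta>0 by (simp add: algebra_simps)
        qed
        finally show ?thesis by (simp add: Y T_def)
      qed
      ultimately show "Y \<in> D" by (simp add: D_def)
    qed
    show "dist (T X) (T Y) \<le> 1 / 2 * dist X Y" if XY: "X \<in> D" "Y \<in> D" for X Y
    proof -
      define d where "d = norm (X - Y)"
      have n: "norm X \<le> 2 * \<eta>" "norm Y \<le> 2 * \<eta>" "norm (X - Y) \<le> d"
        using XY by (simp_all add: D_def d_def)
      have "T X - T Y = - ((1 / 2) *\<^sub>R (X ** (X - Y) + (X - Y) ** Y
          + ((X - Y) ** E + E ** (X - Y) + (X ** E ** (X - Y) + (X - Y) ** E ** Y))))"
        unfolding T_def by (simp add: mult_distribs matrix_mul_assoc algebra_simps flip: scaleR_add_right)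
      then have "norm (T X - T Y) = 1 / 2 * norm (X ** (X - Y) + (X - Y) ** Y
          + ((X - Y) ** E + E ** (X - Y) + (X ** E ** (X - Y) + (X - Y) ** E ** Y)))"
        by simp
      also have "\<dots> \<le> 1 / 2 * ((2 * \<eta>) * d + d * (2 * \<eta>)
          + (d * \<eta> + \<eta> * d + (((2 * \<eta>) * \<eta>) * d + (d * \<eta>) * (2 * \<eta>))))"
        by (intro mult_left_mono order_trans[OF norm_triangle_ineq] add_mono mul n E) auto
      also have "\<dots> = (3 * \<eta> + 2 * (\<eta> * \<eta>)) * d" by (simp add: algebra_simps)
      also have "\<dots> \<le> (1 / 2) * d"
      proof (rule mult_right_mono)
        have "\<eta> * \<eta> \<le> (1 / 8) * (1 / 8)" using \<eta> \<eta>0 by (intro mult_mono) auto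
        then show "3 * \<eta> + 2 * (\<eta> * \<eta>) \<le> 1 / 2" using \<eta> by simp
      qed (simp add: d_def)
      finally show ?thesis by (simp add: dist_norm d_def)
    qed
  qed auto
  then obtain X where X: "X \<in> D" "T X = X" by blast
  show thesis
  proof (rule that[of X])
    have "X ** X + (E + X ** E + E ** X + X ** E ** X) = - (2 *\<^sub>R X)"
    proof -
      have "- (2 *\<^sub>R X) = - (2 *\<^sub>R T X)" by (simp only: X(2))
      then show ?thesis by (simp add: T_def)
    qed
    moreover have "(mat 1 + X) ** (mat 1 + E) ** (mat 1 + X)
      = mat 1 + 2 *\<^sub>R X + (X ** X + (E + X ** E + E ** X + X ** E ** X))"
      by (simp add: mult_distribs matrix_mul_assoc scaleR_2 algebra_simps)
    ultimately show "(mat 1 + X) ** (mat 1 + E) ** (mat 1 + X) = mat 1" by simp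
  qed (use X in \<open>auto simp: D_def\<close>)
qed

section \<open>Concentration at the peaks\<close>

text \<open>Expand \<open>Q\<^sup>* f Q\<close> into terms \<open>cnj (g i) * g j\<close> times \<open>K\<^sub>i\<^sup>* f K\<^sub>j\<close>. Off the diagonal, every point of the
  circle has total distance at least \<open>\<sigma>\<close> from \<open>w i\<close> and \<open>w j\<close>, so that one of the two factors is
  small. On the diagonal, \<open>f - f (w j)\<close> is small where \<open>g j\<close> is large. Both cases leave one factor
  \<open>\<tau>\<close> and at most first powers of \<open>\<bar>g j\<bar>\<close>, whose means are bounded by those of the squares.\<close>

lemma concentration:
  fixes K :: "'j \<Rightarrow> 'm::finite cmat" and g :: "'j \<Rightarrow> complex poly" and f :: "complex \<Rightarrow> 'm cmat"
  assumes J: "finite J" and w: "\<And>j. j \<in> J \<Longrightarrow> w j \<in> circle"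
    and sep: "\<sigma> > 0" "\<And>i j. i \<in> J \<Longrightarrow> j \<in> J \<Longrightarrow> i \<noteq> j \<Longrightarrow> \<sigma> \<le> dist (w i) (w j)"
    and norm1: "\<And>j. j \<in> J \<Longrightarrow> mean (\<lambda>\<theta>. (cmod (poly (g j) (cis \<theta>)))\<^sup>2) = 1"
    and peak: "\<And>j z. j \<in> J \<Longrightarrow> z \<in> circle \<Longrightarrow> cmod (poly (g j) z) * dist z (w j) \<le> \<tau>"
    and f: "f \<in> os_carrier CT" and L: "L \<ge> 0"
    and bound: "\<And>z. z \<in> circle \<Longrightarrow> norm (f z) \<le> L"
    and lip: "\<And>x y. x \<in> circle \<Longrightarrow> y \<in> circle \<Longrightarrow> norm (f x - f y) \<le> L * dist x y"
  defines "Q \<equiv> \<lambda>z. \<Sum>j\<in>J. poly (g j) z *\<^sub>C K j"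
  shows "norm (mean (\<lambda>\<theta>. ctranspose (Q (cis \<theta>)) ** f (cis \<theta>) ** Q (cis \<theta>))
      - (\<Sum>j\<in>J. ctranspose (K j) ** f (w j) ** K j))
    \<le> (\<Sum>j\<in>J. norm (K j))\<^sup>2 * (1 + 1 / \<sigma>) * (2 * real (card J)) * (L * \<tau>)"
proof (cases "J = {}")
  case True
  then show ?thesis by (simp add: Q_def ctranspose_simps)
next
  case False
  then obtain j0 where j0: "j0 \<in> J" by blast
  have \<tau>: "\<tau> \<ge> 0"
    using order_trans[OF _ peak[OF j0, of 1]] by simp
  define G where "G j z = cmod (poly (g j) z)" for j z
  \<comment> \<open>\<open>W\<close> dominates the sum of the \<open>G j\<close> and has a mean that is known exactly.\<close>
  define W where "W z = (\<Sum>j\<in>J. 1 + (G j z)\<^sup>2)" for z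
  define \<kappa> where "\<kappa> = (\<Sum>j\<in>J. norm (K j))"
  define P where "P z = (\<Sum>j\<in>J. complex_of_real ((G j z)\<^sup>2) *\<^sub>C (ctranspose (K j) ** f (w j) ** K j))" for z
  define N where "N = (\<lambda>\<theta>. ctranspose (Q (cis \<theta>)) ** f (cis \<theta>) ** Q (cis \<theta>))"
  have G0: "0 \<le> G j z" for j z by (simp add: G_def)
  have G1: "G j z \<le> 1 + (G j z)\<^sup>2" for j z
  proof -
    have "0 \<le> (G j z - 1 / 2)\<^sup>2" by simp
    then show ?thesis by (simp add: power2_eq_square algebra_simps)
  qed
  have GW: "(\<Sum>j\<in>J. G j z) \<le> W z" for z unfolding W_def by (intro sum_mono G1)
  have G_le: "G j z \<le> (\<Sum>j\<in>J. G j z)" if "j \<in> J" for j z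
    using J that G0 by (intro member_le_sum) auto
  have G_le2: "G i z + G j z \<le> (\<Sum>j\<in>J. G j z)" if "i \<in> J" "j \<in> J" "i \<noteq> j" for i j z
  proof -
    have "(\<Sum>j\<in>{i, j}. G j z) \<le> (\<Sum>j\<in>J. G j z)" using J that G0 by (intro sum_mono2) auto
    then show ?thesis using that by simp
  qed
  have contQ: "continuous_on S (\<lambda>\<theta>. Q (cis \<theta>))" for S
    unfolding Q_def by (intro continuous_on_sum continuous_on_cscale continuous_intros)
  have contN: "continuous_on S N" for S
    unfolding N_def by (intro continuous_on_cmat_mult continuous_on_ctranspose contQ continuous_on_CT_cis f)
  have contG: "continuous_on S (\<lambda>\<theta>. G j (cis \<theta>))" for S j
    unfolding G_def by (intro continuous_intros)
  have contP: "continuous_on S (\<lambda>\<theta>. P (cis \<theta>))" for S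
    unfolding P_def by (intro continuous_on_sum continuous_on_cscale continuous_intros contG)
  have pointwise: "norm (ctranspose (Q z) ** f z ** Q z - P z) \<le> \<kappa>\<^sup>2 * (1 + 1 / \<sigma>) * (L * \<tau>) * W z"
    if z: "z \<in> circle" for z
  proof -
    let ?t = "\<lambda>i j. (cnj (poly (g i) z) * poly (g j) z) *\<^sub>C (ctranspose (K i) ** f z ** K j)"
    let ?d = "\<lambda>i j. if i = j then complex_of_real ((G j z)\<^sup>2) *\<^sub>C (ctranspose (K j) ** f (w j) ** K j) else 0"
    have "ctranspose (Q z) ** f z ** Q z = (\<Sum>j\<in>J. \<Sum>i\<in>J. ?t i j)"
      unfolding Q_def ctranspose_sum ctranspose_simps mult_sums mult_cscale
      by (simp add: mult_sums mult_cscale cscale_simps cscale_sum_right mult.commute)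
    also have "\<dots> = (\<Sum>i\<in>J. \<Sum>j\<in>J. ?t i j)" by (rule sum.swap)
    moreover have "P z = (\<Sum>i\<in>J. \<Sum>j\<in>J. ?d i j)"
      unfolding P_def using J by (simp add: sum.delta)
    ultimately have "ctranspose (Q z) ** f z ** Q z - P z = (\<Sum>i\<in>J. \<Sum>j\<in>J. ?t i j - ?d i j)"
      by (simp add: sum_subtractf)
    also have "norm \<dots> \<le> (\<Sum>i\<in>J. \<Sum>j\<in>J. norm (K i) * norm (K j) * ((1 + 1 / \<sigma>) * (L * \<tau>) * W z))"
    proof (intro order_trans[OF norm_sum] sum_mono)
      fix i j assume ij: "i \<in> J" "j \<in> J"
      have sandwich: "norm (c *\<^sub>C (ctranspose (K i) ** A ** K j)) \<le> norm (K i) * norm (K j) * b"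
        if "cmod c * norm A \<le> b" for c A b
      proof -
        have "norm (c *\<^sub>C (ctranspose (K i) ** A ** K j)) \<le> cmod c * (norm (K i) * norm A * norm (K j))"
          using norm_sandwich_le[of "ctranspose (K i)" A "K j"]
          by (simp add: norm_cscale norm_ctranspose mult_left_mono)
        also have "\<dots> = norm (K i) * norm (K j) * (cmod c * norm A)" by simp
        also have "\<dots> \<le> norm (K i) * norm (K j) * b" using that by (intro mult_left_mono) auto
        finally show ?thesis .
      qed
      have Lt: "0 \<le> L * \<tau>" using L \<tau> by simp
      show "norm (?t i j - ?d i j) \<le> norm (K i) * norm (K j) * ((1 + 1 / \<sigma>) * (L * \<tau>) * W z)"
      proof (cases "i = j")
        case True
        have sq: "cnj (poly (g j) z) * poly (g j) z = complex_of_real ((G j z)\<^sup>2)"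
          unfolding G_def complex_norm_square by (rule mult.commute)
        have "(G j z)\<^sup>2 * norm (f z - f (w j)) \<le> (G j z)\<^sup>2 * (L * dist z (w j))"
          by (intro mult_left_mono lip z w ij) auto
        also have "\<dots> = G j z * L * (G j z * dist z (w j))" by (simp add: power2_eq_square)
        also have "\<dots> \<le> G j z * L * \<tau>"
          using peak[OF ij(2) z] L G0 by (intro mult_left_mono) (auto simp: G_def)
        also have "\<dots> \<le> W z * L * \<tau>"
          using order_trans[OF G_le[OF ij(2)] GW] L \<tau> by (intro mult_right_mono) auto
        also have "\<dots> \<le> (1 + 1 / \<sigma>) * (L * \<tau>) * W z"
        proof -
          have "0 \<le> W z" unfolding W_def by (intro sum_nonneg) auto
          then have "0 \<le> 1 / \<sigma> * (W z * (L * \<tau>))" 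
            using sep(1) by (intro mult_nonneg_nonneg[OF _ mult_nonneg_nonneg[OF _ Lt]]) auto
          then show ?thesis by (simp add: algebra_simps)
        qed
        finally have "norm (complex_of_real ((G j z)\<^sup>2) *\<^sub>C (ctranspose (K i) ** (f z - f (w j)) ** K j))
            \<le> norm (K i) * norm (K j) * ((1 + 1 / \<sigma>) * (L * \<tau>) * W z)"
          by (intro sandwich) (simp add: norm_power)
        moreover have "?t i j - ?d i j = complex_of_real ((G j z)\<^sup>2) *\<^sub>C (ctranspose (K i) ** (f z - f (w j)) ** K j)"
          using True by (simp only: sq mult_distribs cscale_simps simp_thms if_True)
        ultimately show ?thesis by simp
      next
        case False
        have "\<sigma> \<le> dist z (w i) + dist z (w j)"
          using sep(2)[OF ij False] dist_triangle2[of "w i" "w j" z] by (simp add: dist_commute)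
        then have "G i z * G j z * \<sigma> \<le> G i z * G j z * (dist z (w i) + dist z (w j))"
          using G0 by (intro mult_left_mono) auto
        also have "\<dots> = (G i z * dist z (w i)) * G j z + (G j z * dist z (w j)) * G i z"
          by (simp add: algebra_simps)
        also have "\<dots> \<le> \<tau> * G j z + \<tau> * G i z"
          using peak[OF ij(1) z] peak[OF ij(2) z] G0 by (intro add_mono mult_right_mono) (auto simp: G_def)
        also have "\<dots> = \<tau> * (G i z + G j z)" by (simp add: algebra_simps)
        also have "\<dots> \<le> \<tau> * W z"
          using order_trans[OF G_le2[OF ij False] GW] \<tau> by (intro mult_left_mono) auto
        finally have GG: "G i z * G j z \<le> \<tau> * W z / \<sigma>" using sep(1) by (simp add: field_simps)
        have W0: "0 \<le> W z" unfolding W_def by (intro sum_nonneg) auto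
        have "G i z * G j z * norm (f z) \<le> (\<tau> * W z / \<sigma>) * L"
          using GG bound[OF z] G0 \<tau> W0 sep(1) by (intro mult_mono) auto
        also have "\<dots> \<le> (1 + 1 / \<sigma>) * (L * \<tau>) * W z"
          using mult_nonneg_nonneg[OF Lt W0] by (simp add: algebra_simps)
        finally have "norm (?t i j) \<le> norm (K i) * norm (K j) * ((1 + 1 / \<sigma>) * (L * \<tau>) * W z)"
          by (intro sandwich) (simp add: norm_mult G_def)
        then show ?thesis using False by simp
      qed
    qed
    also have "\<dots> = \<kappa>\<^sup>2 * ((1 + 1 / \<sigma>) * (L * \<tau>) * W z)"
      unfolding \<kappa>_def power2_eq_square sum_product by (simp only: sum_distrib_right)
    finally show ?thesis by (simp only: mult.assoc)
  qed
  have "mean (\<lambda>\<theta>. P (cis \<theta>)) = (\<Sum>j\<in>J. ctranspose (K j) ** f (w j) ** K j)"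
  proof -
    have "mean (\<lambda>\<theta>. P (cis \<theta>))
        = (\<Sum>j\<in>J. mean (\<lambda>\<theta>. complex_of_real ((G j (cis \<theta>))\<^sup>2) *\<^sub>C (ctranspose (K j) ** f (w j) ** K j)))"
      unfolding P_def by (intro mean_sum continuous_on_cscale continuous_intros contG)
    also have "\<dots> = (\<Sum>j\<in>J. ctranspose (K j) ** f (w j) ** K j)"
    proof (intro sum.cong refl)
      fix j assume j: "j \<in> J"
      have "mean (\<lambda>\<theta>. complex_of_real ((G j (cis \<theta>))\<^sup>2)) = complex_of_real (mean (\<lambda>\<theta>. (G j (cis \<theta>))\<^sup>2))"
        by (intro mean_bounded_linear[OF bounded_linear_of_real] continuous_intros contG)
      also have "\<dots> = 1" using norm1[OF j] by (simp add: G_def)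
      finally have 1: "mean (\<lambda>\<theta>. complex_of_real ((G j (cis \<theta>))\<^sup>2)) = 1" .
      have "mean (\<lambda>\<theta>. complex_of_real ((G j (cis \<theta>))\<^sup>2) *\<^sub>C (ctranspose (K j) ** f (w j) ** K j))
        = mean (\<lambda>\<theta>. complex_of_real ((G j (cis \<theta>))\<^sup>2)) *\<^sub>C (ctranspose (K j) ** f (w j) ** K j)"
        by (intro mean_cscale continuous_intros contG)
      then show "mean (\<lambda>\<theta>. complex_of_real ((G j (cis \<theta>))\<^sup>2) *\<^sub>C (ctranspose (K j) ** f (w j) ** K j))
        = ctranspose (K j) ** f (w j) ** K j"
        by (simp only: 1 cscale_simps)
    qed
    finally show ?thesis .
  qed
  then have "mean N - (\<Sum>j\<in>J. ctranspose (K j) ** f (w j) ** K j) = mean (\<lambda>\<theta>. N \<theta> - P (cis \<theta>))"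
    by (subst mean_diff[OF contN contP]) simp
  also have "norm \<dots> \<le> mean (\<lambda>\<theta>. \<kappa>\<^sup>2 * (1 + 1 / \<sigma>) * (L * \<tau>) * W (cis \<theta>))"
  proof (rule mean_norm_le)
    show "continuous_on {0..2 * pi} (\<lambda>\<theta>. N \<theta> - P (cis \<theta>))"
      by (intro continuous_on_diff contN contP)
    show "continuous_on {0..2 * pi} (\<lambda>\<theta>. \<kappa>\<^sup>2 * (1 + 1 / \<sigma>) * (L * \<tau>) * W (cis \<theta>))"
      unfolding W_def by (intro continuous_intros contG)
    show "norm (N \<theta> - P (cis \<theta>)) \<le> \<kappa>\<^sup>2 * (1 + 1 / \<sigma>) * (L * \<tau>) * W (cis \<theta>)" for \<theta>
      unfolding N_def by (rule pointwise) simp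
  qed
  also have "\<dots> = \<kappa>\<^sup>2 * (1 + 1 / \<sigma>) * (L * \<tau>) * mean (\<lambda>\<theta>. W (cis \<theta>))"
    unfolding W_def by (rule mean_bounded_linear[OF bounded_linear_mult_right]) (intro continuous_intros contG)
  also have "mean (\<lambda>\<theta>. W (cis \<theta>)) = 2 * real (card J)"
  proof -
    have "mean (\<lambda>\<theta>. W (cis \<theta>)) = (\<Sum>j\<in>J. mean (\<lambda>\<theta>. 1 + (G j (cis \<theta>))\<^sup>2))"
      unfolding W_def by (intro mean_sum continuous_intros contG)
    also have "\<dots> = (\<Sum>j\<in>J. 2)"
    proof (intro sum.cong refl)
      fix j assume "j \<in> J"
      have "mean (\<lambda>\<theta>. 1 + (G j (cis \<theta>))\<^sup>2) = mean (\<lambda>\<theta>. 1) + mean (\<lambda>\<theta>. (G j (cis \<theta>))\<^sup>2)"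
        by (intro mean_add continuous_intros contG)
      then show "mean (\<lambda>\<theta>. 1 + (G j (cis \<theta>))\<^sup>2) = 2" using norm1[OF \<open>j \<in> J\<close>] by (simp add: G_def)
    qed
    finally show ?thesis by simp
  qed
  finally show ?thesis unfolding N_def \<kappa>_def by (simp add: mult_ac)
qed


section \<open>Density of the pure regular maps\<close>

lemma Qpoly_of_polys:
  assumes "\<And>j. j \<in> J \<Longrightarrow> degree (g j) \<le> M"
  shows "Qpoly (M + 1) (\<lambda>i. \<Sum>j\<in>J. coeff (g j) (M + 1 - i) *\<^sub>C A j) z = (\<Sum>j\<in>J. poly (g j) z *\<^sub>C A j)"
proof -
  have "Qpoly (M + 1) (\<lambda>i. \<Sum>j\<in>J. coeff (g j) (M + 1 - i) *\<^sub>C A j) z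
      = (\<Sum>d\<le>M. \<Sum>j\<in>J. (coeff (g j) d * z ^ d) *\<^sub>C A j)"
    unfolding Qpoly_def
    by (rule sum.reindex_bij_witness[of _ "\<lambda>d. M + 1 - d" "\<lambda>i. M + 1 - i"])
       (auto simp: cscale_sum_right cscale_simps mult.commute)
  also have "\<dots> = (\<Sum>j\<in>J. \<Sum>d\<le>M. (coeff (g j) d * z ^ d) *\<^sub>C A j)" by (rule sum.swap)
  also have "\<dots> = (\<Sum>j\<in>J. poly (g j) z *\<^sub>C A j)"
    by (intro sum.cong refl) (simp add: poly_bounded_degree[OF assms] cscale_sum_left)
  finally show ?thesis .
qed

lemma finite_separated:
  assumes "finite J" "inj_on w J"
  obtains \<sigma> :: real where "\<sigma> > 0" "\<And>i j. i \<in> J \<Longrightarrow> j \<in> J \<Longrightarrow> i \<noteq> j \<Longrightarrow> \<sigma> \<le> dist (w i) (w j)"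
proof -
  define S where "S = insert 1 ((\<lambda>(i, j). dist (w i) (w j)) ` {(i, j) \<in> J \<times> J. i \<noteq> j})"
  have "finite {(i, j) \<in> J \<times> J. i \<noteq> j}"
    by (rule finite_subset[of _ "J \<times> J"]) (use assms(1) in auto)
  then have S: "finite S" "S \<noteq> {}" by (auto simp: S_def)
  have "x > 0" if "x \<in> S" for x
    using that assms(2) by (auto simp: S_def inj_on_def)
  then have "Min S > 0" using S by simp
  moreover have "Min S \<le> dist (w i) (w j)" if "i \<in> J" "j \<in> J" "i \<noteq> j" for i j
    using S that by (intro Min_le) (auto simp: S_def)
  ultimately show thesis by (rule that)
qed

lemma conjugation_near_identity:
  fixes X G :: "'m::finite cmat"
  assumes "norm X \<le> 2 * \<eta>" "\<eta> \<le> 1 / 8" "norm G \<le> b"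
  shows "norm ((mat 1 + X) ** G ** (mat 1 + X) - G) \<le> 5 * \<eta> * b"
proof -
  have \<eta>0: "0 \<le> \<eta>" and b0: "0 \<le> b" using assms norm_ge_zero[of X] norm_ge_zero[of G] by linarith+
  have mul: "norm (A ** B) \<le> a * c" if "norm A \<le> a" "norm B \<le> c" for A B :: "'m cmat" and a c
    using norm_mat_mult_le[of A B] that mult_mono'[of "norm A" a "norm B" c] by simp
  have "(mat 1 + X) ** G ** (mat 1 + X) - G = X ** G + G ** X + X ** G ** X"
    by (simp add: mult_distribs algebra_simps)
  also have "norm \<dots> \<le> (2 * \<eta>) * b + b * (2 * \<eta>) + ((2 * \<eta>) * b) * (2 * \<eta>)"
    by (intro order_trans[OF norm_triangle_ineq] add_mono mul assms)
  also have "\<dots> = 4 * \<eta> * b + \<eta> * b * (4 * \<eta>)" by (simp add: algebra_simps)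
  also have "\<dots> \<le> 4 * \<eta> * b + \<eta> * b * 1"
    using assms(2) \<eta>0 b0 by (intro add_left_mono mult_left_mono) auto
  finally show ?thesis by (simp add: algebra_simps)
qed

text \<open>The approximation problem for a finite sum of point evaluations: peaked polynomials at the points \<open>w j\<close>
  carry the Kraus operators \<open>K j\<close>, and the normalizing factor turns the result into an isometry.
  The factor mixes columns, so the extremal polynomial is no longer an entry of \<open>Qpoly n V\<close>, but it
  still is a linear functional of it.\<close>

lemma pure_approximation_of_point_evaluations:
  fixes K :: "'j \<Rightarrow> 'm::finite cmat"
  assumes J: "finite J" and inj: "inj_on w J" and w: "w ` J \<subseteq> circle"
    and K1: "(\<Sum>j\<in>J. ctranspose (K j) ** K j) = mat 1"
    and k: "\<And>j. K j $ p $ q = complex_of_real (k j)" "\<And>j. k j \<ge> 0" "\<exists>j\<in>J. k j > 0"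
    and L: "(real CARD('m))\<^sup>2 \<le> L" and \<epsilon>: "\<epsilon> > 0"
  shows "\<exists>n V. n \<ge> 1 \<and> isometry n V \<and> regular n V \<and> pure_ucp (toeplitz n) (compress n V) \<and>
    (\<forall>f\<in>os_carrier CT. (\<forall>z\<in>circle. norm (f z) \<le> L) \<and> (\<forall>x\<in>circle. \<forall>y\<in>circle. norm (f x - f y) \<le> L * dist x y)
      \<longrightarrow> norm ((\<Sum>j\<in>J. ctranspose (K j) ** f (w j) ** K j) - Phi_Q n V f) \<le> \<epsilon>)"
proof -
  define m where "m = real CARD('m)"
  have L0: "L \<ge> 0" using L by (rule order_trans[rotated]) simp
  have m0: "m \<ge> 0" by (simp add: m_def)
  obtain \<sigma> where \<sigma>: "\<sigma> > 0" "\<And>i j. i \<in> J \<Longrightarrow> j \<in> J \<Longrightarrow> i \<noteq> j \<Longrightarrow> \<sigma> \<le> dist (w i) (w j)"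
    using finite_separated[OF J inj] by blast
  define B where "B = (\<Sum>j\<in>J. norm (K j))\<^sup>2 * (1 + 1 / \<sigma>) * (2 * real (card J)) * L + 1"
  have B: "B > 0"
    unfolding B_def using \<sigma>(1) L0 by (intro add_nonneg_pos mult_nonneg_nonneg) auto
  \<comment> \<open>\<open>\<eta>\<close> bounds the error of the concentration step. The bound \<open>1 / 8\<close> is what the normalization
    needs; the other one absorbs the effect of \<open>R\<close>, which is at most \<open>5 * \<eta> * (1 + m * L)\<close>.\<close>
  define \<eta> where "\<eta> = min (1 / 8) (\<epsilon> / (5 * (1 + m * L) + 1))"
  have D: "5 * (1 + m * L) + 1 > 0" using m0 L0 by (intro add_nonneg_pos) auto
  have \<eta>: "\<eta> > 0" "\<eta> \<le> 1 / 8" "\<eta> * (5 * (1 + m * L) + 1) \<le> \<epsilon>"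
  proof -
    show "\<eta> > 0" using \<epsilon> D by (simp add: \<eta>_def)
    show "\<eta> \<le> 1 / 8" unfolding \<eta>_def by (rule min.cobounded1)
    have "\<eta> * (5 * (1 + m * L) + 1) \<le> \<epsilon> / (5 * (1 + m * L) + 1) * (5 * (1 + m * L) + 1)"
      using D unfolding \<eta>_def by (intro mult_right_mono min.cobounded2) simp
    then show "\<eta> * (5 * (1 + m * L) + 1) \<le> \<epsilon>" using D by simp
  qed
  define \<tau> where "\<tau> = \<eta> / B"
  have \<tau>: "\<tau> > 0" using \<eta> B by (simp add: \<tau>_def)
  obtain M and h :: "complex \<Rightarrow> complex poly" where
    H: "\<forall>x\<in>circle. degree (h x) \<le> M"
      "\<forall>x\<in>circle. mean (\<lambda>\<theta>. (cmod (poly (h x) (cis \<theta>)))\<^sup>2) = 1"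
      "\<forall>x\<in>circle. \<forall>z\<in>circle. cmod (poly (h x) z) * dist z x \<le> \<tau>" and
    comb: "\<forall>J (k :: 'j \<Rightarrow> real) w. finite J \<and> (\<forall>j\<in>J. w j \<in> circle \<and> k j \<ge> 0) \<and> (\<exists>j\<in>J. k j > 0) \<longrightarrow>
       degree (\<Sum>j\<in>J. smult (complex_of_real (k j)) (h (w j))) = M \<and>
       (\<forall>z. poly (\<Sum>j\<in>J. smult (complex_of_real (k j)) (h (w j))) z = 0 \<longrightarrow> z \<in> circle)"
    using peaked_polynomials[OF \<tau>, where ?'j = 'j] by (elim exE conjE)
  define g where "g j = h (w j)" for j
  have wc: "w j \<in> circle" if "j \<in> J" for j using w that by blast
  define Q where "Q z = (\<Sum>j\<in>J. poly (g j) z *\<^sub>C K j)" for z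
  define G where "G f = mean (\<lambda>\<theta>. ctranspose (Q (cis \<theta>)) ** f (cis \<theta>) ** Q (cis \<theta>))"
    for f :: "complex \<Rightarrow> 'm cmat"
  have close: "norm (G f - (\<Sum>j\<in>J. ctranspose (K j) ** f (w j) ** K j)) \<le> \<eta>"
    if f: "f \<in> os_carrier CT" "\<And>z. z \<in> circle \<Longrightarrow> norm (f z) \<le> L"
      "\<And>x y. x \<in> circle \<Longrightarrow> y \<in> circle \<Longrightarrow> norm (f x - f y) \<le> L * dist x y" for f
  proof -
    have "norm (G f - (\<Sum>j\<in>J. ctranspose (K j) ** f (w j) ** K j))
        \<le> (\<Sum>j\<in>J. norm (K j))\<^sup>2 * (1 + 1 / \<sigma>) * (2 * real (card J)) * (L * \<tau>)"
      unfolding G_def Q_def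
    proof (rule concentration[OF J wc \<sigma>])
      show "mean (\<lambda>\<theta>. (cmod (poly (g j) (cis \<theta>)))\<^sup>2) = 1" if "j \<in> J" for j
        unfolding g_def by (rule H(2)[rule_format, OF wc[OF that]])
      show "cmod (poly (g j) z) * dist z (w j) \<le> \<tau>" if "j \<in> J" "z \<in> circle" for j z
        unfolding g_def by (rule H(3)[rule_format, OF wc[OF that(1)] that(2)])
    qed (use f L0 in auto)
    also have "\<dots> = (B - 1) * \<tau>" by (simp add: B_def)
    also have "\<dots> \<le> B * \<tau>" using \<tau> by (simp add: algebra_simps)
    also have "\<dots> = \<eta>" using B by (simp add: \<tau>_def)
    finally show ?thesis .
  qed
  define S where "S = mean (\<lambda>\<theta>. ctranspose (Q (cis \<theta>)) ** Q (cis \<theta>))"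
  have "norm (S - mat 1) \<le> \<eta>"
  proof -
    have "norm (mat 1 :: 'm cmat) \<le> (real CARD('m))\<^sup>2 * 1"
      by (rule norm_le_of_entries) (simp add: mat_def)
    then have "norm (G (os_unit CT) - (\<Sum>j\<in>J. ctranspose (K j) ** os_unit CT (w j) ** K j)) \<le> \<eta>"
      using L L0 by (intro close CT_unit) (auto simp: CT_def)
    moreover have "(\<Sum>j\<in>J. ctranspose (K j) ** os_unit CT (w j) ** K j) = mat 1"
      unfolding K1[symmetric] by (intro sum.cong refl) (use wc in \<open>simp add: CT_def\<close>)
    moreover have "G (os_unit CT) = S" by (simp add: G_def S_def CT_def)
    ultimately show ?thesis by simp
  qed
  have contQ: "continuous_on A (\<lambda>\<theta>. Q (cis \<theta>))" for A
    unfolding Q_def by (intro continuous_on_sum continuous_on_cscale continuous_intros)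
  have herm: "ctranspose (S - mat 1) = S - mat 1"
  proof -
    have "bounded_linear (ctranspose :: 'm cmat \<Rightarrow> 'm cmat)"
      by (rule bounded_linear_intro[where K = 1]) (auto simp: vec_eq_iff norm_ctranspose)
    then have "ctranspose S = mean (\<lambda>\<theta>. ctranspose (ctranspose (Q (cis \<theta>)) ** Q (cis \<theta>)))"
      unfolding S_def
      by (intro mean_bounded_linear[symmetric] continuous_on_cmat_mult continuous_on_ctranspose contQ)
    then show ?thesis by (simp add: ctranspose_simps S_def)
  qed
  obtain X where X: "ctranspose X = X" "norm X \<le> 2 * \<eta>"
    and X1: "(mat 1 + X) ** (mat 1 + (S - mat 1)) ** (mat 1 + X) = mat 1"
    by (rule normalizing_factor[OF herm \<open>norm (S - mat 1) \<le> \<eta>\<close> \<eta>(2)])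
  define R where "R = mat 1 + X"
  have R: "ctranspose R = R" "R ** S ** R = mat 1"
    using X1 by (simp_all add: R_def ctranspose_simps X(1))
  define V where "V i = (\<Sum>j\<in>J. coeff (g j) (M + 1 - i) *\<^sub>C (K j ** R))" for i
  have QV: "Qpoly (M + 1) V z = Q z ** R" for z
  proof -
    have "Qpoly (M + 1) V z = (\<Sum>j\<in>J. poly (g j) z *\<^sub>C (K j ** R))"
      unfolding V_def by (rule Qpoly_of_polys) (simp only: g_def H(1)[rule_format, OF wc])
    then show ?thesis by (simp add: Q_def mult_sums mult_cscale)
  qed
  have conj: "mean (\<lambda>\<theta>. R ** F \<theta> ** R) = R ** mean F ** R" if "continuous_on {0..2 * pi} F" for F :: "real \<Rightarrow> 'm cmat"
  proof (rule mean_bounded_linear[OF _ that])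
    show "bounded_linear (\<lambda>A. R ** A ** R)"
    proof (rule bounded_linear_intro[where K = "norm R * norm R"])
      show "R ** (A + A') ** R = R ** A ** R + R ** A' ** R" for A A' by (simp add: mult_distribs)
      show "R ** (r *\<^sub>R A) ** R = r *\<^sub>R (R ** A ** R)" for r A by (simp add: scaleR_eq_cscale mult_cscale)
      show "norm (R ** A ** R) \<le> norm A * (norm R * norm R)" for A
        using norm_sandwich_le[of R A R] by (simp add: mult_ac)
    qed
  qed
  have iso: "isometry (M + 1) V"
  proof -
    have "(\<Sum>i\<in>{1..M + 1}. ctranspose (V i) ** V i) = mean (\<lambda>\<theta>. R ** (ctranspose (Q (cis \<theta>)) ** Q (cis \<theta>)) ** R)"
      unfolding mean_Qpoly_gram[symmetric] QV ctranspose_simps R(1) by (simp add: matrix_mul_assoc)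
    also have "\<dots> = R ** S ** R"
      unfolding S_def by (intro conj continuous_on_cmat_mult continuous_on_ctranspose contQ)
    finally show ?thesis by (simp add: isometry_def R(2))
  qed
  define s where "s = (\<Sum>j\<in>J. smult (complex_of_real (k j)) (g j))"
  have s: "degree s = M \<and> (\<forall>z. poly s z = 0 \<longrightarrow> z \<in> circle)"
    unfolding s_def g_def by (rule comb[rule_format]) (use J wc k(2,3) in auto)
  \<comment> \<open>\<open>S ** R\<close> is the inverse of \<open>R\<close>, so these weights recover entry \<open>(p, q)\<close> of \<open>Q\<close> from \<open>Q ** R\<close>.\<close>
  define u where "u = (\<lambda>(a, r). if a = p then (S ** R) $ r $ q else 0)"
  have su: "poly s z = (\<Sum>(a, r)\<in>UNIV. Qpoly (M + 1) V z $ a $ r * u (a, r))" for z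
  proof -
    have "Q z = Qpoly (M + 1) V z ** (S ** R)"
      unfolding QV using R(2) by (simp flip: matrix_mul_assoc)
    then have "Q z $ p $ q = (\<Sum>r\<in>UNIV. Qpoly (M + 1) V z $ p $ r * (S ** R) $ r $ q)"
      by (simp only: mat_mult_nth)
    moreover have "poly s z = Q z $ p $ q"
      by (simp add: s_def Q_def poly_sum k(1) mult.commute)
    moreover have "(\<Sum>(a, r)\<in>UNIV. Qpoly (M + 1) V z $ a $ r * u (a, r))
        = (\<Sum>a\<in>UNIV. if a = p then \<Sum>r\<in>UNIV. Qpoly (M + 1) V z $ p $ r * (S ** R) $ r $ q else 0)"
      unfolding UNIV_Times_UNIV[symmetric] sum_pairs prod.case u_def by (intro sum.cong refl) auto
    ultimately show ?thesis by simp
  qed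
  have pure: "regular (M + 1) V" "pure_ucp (toeplitz (M + 1)) (compress (M + 1) V)"
    using purity_criterion[OF _ iso su] s by auto
  have approx: "norm ((\<Sum>j\<in>J. ctranspose (K j) ** f (w j) ** K j) - Phi_Q (M + 1) V f) \<le> \<epsilon>"
    if f: "f \<in> os_carrier CT" "\<forall>z\<in>circle. norm (f z) \<le> L"
      "\<forall>x\<in>circle. \<forall>y\<in>circle. norm (f x - f y) \<le> L * dist x y" for f
  proof -
    define A where "A = (\<Sum>j\<in>J. ctranspose (K j) ** f (w j) ** K j)"
    have GA: "norm (G f - A) \<le> \<eta>" unfolding A_def using f by (intro close) auto
    have "norm A \<le> (\<Sum>j\<in>J. (norm (K j))\<^sup>2 * L)"
      unfolding A_def
    proof (intro order_trans[OF norm_sum] sum_mono)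
      fix j assume j: "j \<in> J"
      have "norm (K j) * norm (f (w j)) * norm (K j) \<le> norm (K j) * L * norm (K j)"
        using f(2) wc[OF j] by (intro mult_right_mono mult_left_mono) auto
      then show "norm (ctranspose (K j) ** f (w j) ** K j) \<le> (norm (K j))\<^sup>2 * L"
        using norm_sandwich_le[of "ctranspose (K j)" "f (w j)" "K j"]
        by (simp add: norm_ctranspose power2_eq_square mult_ac)
    qed
    also have "\<dots> = m * L"
      using sum_norm_sq_kraus[OF K1] by (simp add: m_def flip: sum_distrib_right)
    finally have "norm A \<le> m * L" .
    then have "norm (G f) \<le> 1 + m * L"
      using GA \<eta>(2) norm_triangle_ineq[of "G f - A" A] by simp
    from conjugation_near_identity[OF X(2) \<eta>(2) this]
    have "norm (R ** G f ** R - G f) \<le> 5 * \<eta> * (1 + m * L)" by (simp add: R_def)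
    moreover have "Phi_Q (M + 1) V f = R ** G f ** R"
    proof -
      have "Phi_Q (M + 1) V f = mean (\<lambda>\<theta>. R ** (ctranspose (Q (cis \<theta>)) ** f (cis \<theta>) ** Q (cis \<theta>)) ** R)"
        unfolding Phi_Q_mean QV ctranspose_simps R(1) by (simp add: matrix_mul_assoc)
      also have "\<dots> = R ** G f ** R"
        unfolding G_def
        by (intro conj continuous_on_cmat_mult continuous_on_ctranspose contQ continuous_on_CT_cis f(1))
      finally show ?thesis .
    qed
    ultimately have "norm (Phi_Q (M + 1) V f - A) \<le> 5 * \<eta> * (1 + m * L) + \<eta>"
      using GA norm_triangle_ineq[of "Phi_Q (M + 1) V f - G f" "G f - A"] by simp
    also have "\<dots> \<le> \<epsilon>" using \<eta>(3) by (simp add: algebra_simps)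
    finally show ?thesis by (simp add: A_def norm_minus_commute)
  qed
  show ?thesis
    by (intro exI[of _ "M + 1"] exI[of _ V] conjI iso pure) (use approx in auto)
qed

theorem theorem2:
  fixes \<Phi> :: "(complex \<Rightarrow> complex^'m^'m) \<Rightarrow> complex^'m^'m"
    and \<epsilon> :: real
  assumes "\<Phi> \<in> ucp_maps_CT" and "\<epsilon> > 0"
  shows "\<exists>(n::nat) (V :: nat \<Rightarrow> complex^'m^'m).
           n \<ge> 1 \<and> isometry n V \<and> regular n V \<and>
           pure_ucp (toeplitz n) (compress n V) \<and>
           Phi_Q n V \<in> ucp_maps_CT \<and>
           rho \<Phi> (Phi_Q n V) < \<epsilon>"
proof -
  define m where "m = real CARD('m)"
  define L where "L = 3 * m\<^sup>2"
  have m: "m \<ge> 1" by (simp add: m_def Suc_le_eq)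
  then have L: "L > 0" by (simp add: L_def)
  define c where "c = (2 * m\<^sup>2 + m) * L"
  have c: "c > 0" unfolding c_def using m L by (intro mult_pos_pos add_nonneg_pos) auto
  define \<delta> where "\<delta> = \<epsilon> / (4 * c)"
  have \<delta>: "\<delta> > 0" using assms(2) c by (simp add: \<delta>_def)
  obtain J :: "(complex \<times> 'm \<times> 'm) set" and K0 w where
    J: "finite J" "inj_on w J" "w ` J \<subseteq> circle" and K0: "(\<Sum>j\<in>J. ctranspose (K0 j) ** K0 j) = mat 1" and
    approx: "\<forall>f L. f \<in> os_carrier CT \<and> L \<ge> 0 \<and> (\<forall>x\<in>circle. \<forall>y\<in>circle. norm (f x - f y) \<le> L * dist x y) \<longrightarrow>
       norm (\<Phi> f - (\<Sum>j\<in>J. ctranspose (K0 j) ** f (w j) ** K0 j))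
         \<le> (2 * (real CARD('m))\<^sup>2 + real CARD('m)) * (L * \<delta>)"
    using point_evaluation_approximation[OF assms(1) \<delta>] by (elim exE conjE)
  obtain K p q k where K: "\<forall>j A. ctranspose (K j) ** A ** K j = ctranspose (K0 j) ** A ** K0 j"
    and k: "\<forall>j. K j $ p $ q = complex_of_real (k j) \<and> k j \<ge> 0" "\<exists>j\<in>J. k j > 0"
    using nonneg_entry_kraus[OF K0] by (elim exE conjE)
  have K1: "(\<Sum>j\<in>J. ctranspose (K j) ** K j) = mat 1"
    using K[rule_format, of _ "mat 1"] K0 by simp
  have "(real CARD('m))\<^sup>2 \<le> L" using m by (simp add: L_def m_def)
  from pure_approximation_of_point_evaluations[OF J K1 _ _ k(2) this, of p q "\<epsilon> / 4"] k(1) assms(2)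
  obtain n V where V: "n \<ge> 1" "isometry n V" "regular n V" "pure_ucp (toeplitz n) (compress n V)"
    and close: "\<And>f. f \<in> os_carrier CT \<Longrightarrow> (\<forall>z\<in>circle. norm (f z) \<le> L) \<and>
        (\<forall>x\<in>circle. \<forall>y\<in>circle. norm (f x - f y) \<le> L * dist x y) \<Longrightarrow>
        norm ((\<Sum>j\<in>J. ctranspose (K j) ** f (w j) ** K j) - Phi_Q n V f) \<le> \<epsilon> / 4"
    by auto
  have "rho \<Phi> (Phi_Q n V) \<le> \<epsilon> / 2"
    unfolding rho_def
  proof (rule cSUP_least)
    show "lip_class \<noteq> ({} :: (complex \<Rightarrow> complex^'m^'m) set)" using zero_in_lip_class by blast
    fix f :: "complex \<Rightarrow> complex^'m^'m"
    assume f: "f \<in> lip_class"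
    note fb = lip_class_bounds[OF f]
    define A where "A = (\<Sum>j\<in>J. ctranspose (K j) ** f (w j) ** K j)"
    have lip: "norm (f x - f y) \<le> L * dist x y" if "x \<in> circle" "y \<in> circle" for x y
      using fb(3)[OF that] by (simp add: L_def m_def)
    have "norm (f z) \<le> L" if "z \<in> circle" for z
      using fb(2)[OF that] \<open>(real CARD('m))\<^sup>2 \<le> L\<close> by linarith
    then have 2: "norm (A - Phi_Q n V f) \<le> \<epsilon> / 4"
      unfolding A_def using lip by (intro close fb(1)) auto
    have "norm (\<Phi> f - A) \<le> (2 * m\<^sup>2 + m) * (L * \<delta>)"
      unfolding A_def K[rule_format] m_def using L fb(1) lip by (intro approx[rule_format]) auto
    also have "\<dots> = c * \<delta>" by (simp only: c_def mult.assoc)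
    also have "\<dots> = \<epsilon> / 4" using c by (simp add: \<delta>_def)
    finally have "norm (\<Phi> f - Phi_Q n V f) \<le> \<epsilon> / 2"
      using 2 norm_triangle_ineq[of "\<Phi> f - A" "A - Phi_Q n V f"] by simp
    then show "opnorm (\<Phi> f - Phi_Q n V f) \<le> \<epsilon> / 2"
      by (rule order_trans[OF opnorm_le_norm])
  qed
  then have "rho \<Phi> (Phi_Q n V) < \<epsilon>" using assms(2) by linarith
  with V Phi_Q_ucp[OF V(2)] show ?thesis by blast
qed

end
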